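(* Fix an integer $n\geq1$. The model Riemann–Hilbert problem described in the context has a unique solution $M$, given by $$M(p)=C\begin{bmatrix} f(p) & f(p+\tau)\\ h(p) & h(p+\tau)\end{bmatrix}\ \ (0\le \mathrm{Im}\,p<\tfrac12\mathrm{Im}\,\tau),\qquad M(p)=C\begin{bmatrix} -f(p+\tau) & f(p)\\ -h(p+\tau) & h(p)\end{bmatrix}\ \ (\tfrac12\mathrm{Im}\,\tau<\mathrm{Im}\,p<\mathrm{Im}\,\tau),$$ extended to the whole plane by $M(p+\tau)=M(p)$, where, writing $\theta_j(\cdot)=\theta_j(\cdot;2\tau)$, $$f(p)={\rm e}^{-i\pi p}\frac{\theta_1(p-\mathscr D-\tau)\,\theta_2(p)}{\theta_1(p-\mathscr D)\,\theta_1(p)}\ (n\text{ even}),\qquad f(p)={\rm e}^{-i\pi p}\frac{\theta_1(p-\mathscr D-\tau)\,\theta_3(p)}{\theta_1(p-\mathscr D)\,\theta_1(p)}\ (n\text{ odd}),$$ $$h(p)={\rm e}^{-i\pi p+i\pi\tau+2i\pi\mathscr D-\frac{i\pi}2}\frac{\theta_1(p-\mathscr D-\tau)\,\theta_3(p)}{\theta_1(p-\mathscr D)\,\theta_4(p)}\ (n\text{ even}),\qquad h(p)={\rm e}^{-i\pi p+i\pi\tau+2i\pi\mathscr D-\frac{i\pi}2}\frac{\theta_1(p-\mathscr D-\tau)\,\theta_2(p)}{\theta_1(p-\mathscr D)\,\theta_4(p)}\ (n\text{ odd}),$$ and $$C=\begin{bmatrix}\frac{\theta_1(\mathscr D)}{\theta_1(\mathscr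 D+\tau)}&0\\0&\frac{\theta_1(\mathscr D+\tau)}{\theta_1(\mathscr D)}\end{bmatrix}\frac{\theta_1'(0)}{\theta_2(0)}\ (n\text{ even}),\qquad C=\begin{bmatrix}\frac{\theta_1(\mathscr D)}{\theta_1(\mathscr D+\tau)}&0\\0&\frac{\theta_1(\mathscr D+\tau)}{\theta_1(\mathscr D)}\end{bmatrix}\frac{\theta_1'(0)}{\theta_3(0)}\ (n\text{ odd}).$$ Moreover, $f$ and $h$ are meromorphic on $\mathbb{C}$ and, regarded on the doubled curve $\mathcal E_{2\tau}=\mathbb{C}/(\mathbb{Z}+2\tau\mathbb{Z})$, satisfy $\mathrm{div}(f)\geq-(0)-(\mathscr D)+(\mathscr D+\tau)$, $f(p+1)=(-1)^{n-1}f(p)$, $f(p+2\tau)=-f(p)$, and $\mathrm{div}(h)\geq-(\tau)-(\mathscr D)+(\mathscr D+\tau)$, $h(p+1)=(-1)^{n-1}h(p)$, $h(p+2\tau)=-h(p)$; these properties characterize $f$ and $h$ each up to a multiplicative constant.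
   Context: Let $\tau\in i\mathbb{R}_{>0}$, $\Lambda_\tau=\mathbb{Z}+\tau\mathbb{Z}$, $\mathcal E_\tau=\mathbb{C}/\Lambda_\tau$, and fix $\mathscr D\in(0,1)$. Let $\gamma$ be the image in $\mathcal E_\tau$ of the line $\{\mathrm{Im}\,p=\tfrac12\mathrm{Im}\,\tau\}$, oriented by increasing real part; for $p$ on it, $p_+$ and $p_-$ denote boundary values from above (larger $\mathrm{Im}\,p$) and from below. Jacobi theta functions are in the normalization $\theta_j(p;\tau')=\vartheta_j(\pi p\,|\,\tau')$ of DLMF 20.2 with nome $q={\rm e}^{i\pi\tau'}$: $\theta_1(p;\tau')=2\sum_{k\ge0}(-1)^kq^{(k+1/2)^2}\sin((2k+1)\pi p)$, $\theta_2(p;\tau')=2\sum_{k\ge0}q^{(k+1/2)^2}\cos((2k+1)\pi p)$, $\theta_3(p;\tau')=1+2\sum_{k\ge1}q^{k^2}\cos(2k\pi p)$, $\theta_4(p;\tau')=1+2\sum_{k\ge1}(-1)^kq^{k^2}\cos(2k\pi p)$. For a meromorphic function $F$, $\mathrm{div}(F)\ge\sum$ means poles/zeros bounded as indicated (modulo the relevant lattice), $(a)$ denoting the point $a$. Model problem (for given $n$): find a $2\times2$ matrix-valued function $M$ on $\mathbb{C}\setminus\bigcup_{k\in\mathbb Z}\{\mathrm{Im}\,p=(k+\tfrac12)\mathrm{Im}\,\tau\}$, meromorphic there, such that: (1) $M(p+1)=(-1)^{n-1}M(p)$ and $M(p+\tau)=M(p)$; (2) near $p\equiv0 \bmod \Lambda_\tau$,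 $M(p)=\begin{bmatrix}p^{-1}+\mathcal O(1)&\mathcal O(1)\\\mathcal O(1)&p^{-1}+\mathcal O(1)\end{bmatrix}$; (3) near $p\equiv\mathscr D \bmod\Lambda_\tau$ the first column is $\mathcal O((p-\mathscr D)^{-1})$ and the second column is $\mathcal O(p-\mathscr D)$; (4) there are no other poles; (5) $M$ has continuous boundary values on the lines $\{\mathrm{Im}\,p=(k+\tfrac12)\mathrm{Im}\,\tau\}$ satisfying $M(p_+)=M(p_-)\begin{bmatrix}0&1\\-1&0\end{bmatrix}$. *)

theory Defs
  imports "HOL-Complex_Analysis.Complex_Analysis" "HOL-Library.Landau_Symbols"
begin

section \<open>Jacobi theta functions (DLMF 20.2 normalization, theta_j(p;t) = vartheta_j(pi p | t))\<close>

definition jtheta1 :: "complex \<Rightarrow> complex \<Rightarrow> complex" where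
  "jtheta1 (p::complex) (t::complex) = 2 * (\<Sum>k::nat. (-1)^k * exp (\<i> * pi * t * (of_nat k + 1/2)^2)
                                 * sin ((2 * of_nat k + 1) * of_real pi * p))"

definition jtheta2 :: "complex \<Rightarrow> complex \<Rightarrow> complex" where
  "jtheta2 (p::complex) (t::complex) = 2 * (\<Sum>k::nat. exp (\<i> * pi * t * (of_nat k + 1/2)^2)
                                 * cos ((2 * of_nat k + 1) * of_real pi * p))"

definition jtheta3 :: "complex \<Rightarrow> complex \<Rightarrow> complex" where
  "jtheta3 (p::complex) (t::complex) = 1 + 2 * (\<Sum>k::nat. exp (\<i> * pi * t * (of_nat (Suc k))^2)
                                 * cos (2 * of_nat (Suc k) * of_real pi * p))"

definition jtheta4 :: "complex \<Rightarrow> complex \<Rightarrow> complex" where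
  "jtheta4 (p::complex) (t::complex) = 1 + 2 * (\<Sum>k::nat. (-1)^(Suc k) * exp (\<i> * pi * t * (of_nat (Suc k))^2)
                                 * cos (2 * of_nat (Suc k) * of_real pi * p))"

definition mat22 :: "complex \<Rightarrow> complex \<Rightarrow> complex \<Rightarrow> complex \<Rightarrow> complex^2^2" where
  "mat22 a b c d = (\<chi> i j. if i = 1 then (if j = 1 then a else b) else (if j = 1 then c else d))"

definition jumpJ :: "complex^2^2" where
  "jumpJ = mat22 0 1 (-1) 0"

definition ent :: "complex^2^2 \<Rightarrow> 2 \<Rightarrow> 2 \<Rightarrow> complex" where
  "ent A i j = vec_nth (vec_nth A i) j"

definition RHP_domain :: "complex \<Rightarrow> complex set" where
  "RHP_domain \<tau> = {p. \<forall>k::int. Im p \<noteq> (of_int k + 1/2) * Im \<tau>}"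

definition RHP_poles :: "complex \<Rightarrow> real \<Rightarrow> complex set" where
  "RHP_poles \<tau> D = {p. \<exists>a b::int. p = of_int a + of_int b * \<tau>
                                  \<or> p = complex_of_real D + of_int a + of_int b * \<tau>}"

definition model_RHP_solution :: "nat \<Rightarrow> complex \<Rightarrow> real \<Rightarrow> (complex \<Rightarrow> complex^2^2) \<Rightarrow> bool" where
  "model_RHP_solution n \<tau> D M \<longleftrightarrow>
     \<comment> \<open>meromorphic on the domain, with no poles other than those in (2), (3)\<close>
     (\<forall>i j. (\<lambda>p. ent (M p) i j) meromorphic_on RHP_domain \<tau>) \<and>
     (\<forall>i j. (\<lambda>p. ent (M p) i j) holomorphic_on (RHP_domain \<tau> - RHP_poles \<tau> D)) \<and>
     \<comment> \<open>(1) periodicity\<close>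
     (\<forall>p \<in> RHP_domain \<tau> - RHP_poles \<tau> D.
         M (p + 1) = ((-1::real) ^ (n - 1)) *\<^sub>R M p \<and> M (p + \<tau>) = M p) \<and>
     \<comment> \<open>(2) behaviour at p = 0\<close>
     (\<lambda>p. ent (M p) 1 1 - 1 / p) \<in> O[at 0](\<lambda>_. 1) \<and>
     (\<lambda>p. ent (M p) 1 2) \<in> O[at 0](\<lambda>_. 1) \<and>
     (\<lambda>p. ent (M p) 2 1) \<in> O[at 0](\<lambda>_. 1) \<and>
     (\<lambda>p. ent (M p) 2 2 - 1 / p) \<in> O[at 0](\<lambda>_. 1) \<and>
     \<comment> \<open>(3) behaviour at p = D\<close>
     (\<forall>i. (\<lambda>p. ent (M p) i 1) \<in> O[at (complex_of_real D)](\<lambda>p. 1 / (p - complex_of_real D))) \<and>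
     (\<forall>i. (\<lambda>p. ent (M p) i 2) \<in> O[at (complex_of_real D)](\<lambda>p. p - complex_of_real D)) \<and>
     \<comment> \<open>(5) continuous boundary values with jump\<close>
     (\<forall>x. (\<exists>k::int. Im x = (of_int k + 1/2) * Im \<tau>) \<longrightarrow>
         (\<exists>Mplus Mminus. (M \<longlongrightarrow> Mplus) (at x within {p. Im p > Im x}) \<and>
                         (M \<longlongrightarrow> Mminus) (at x within {p. Im p < Im x}) \<and>
                         Mplus = Mminus ** jumpJ))"

definition model_f :: "nat \<Rightarrow> complex \<Rightarrow> real \<Rightarrow> complex \<Rightarrow> complex" where
  "model_f n \<tau> D p =
     exp (- \<i> * pi * p) * jtheta1 (p - D - \<tau>) (2*\<tau>)
       * (if even n then jtheta2 p (2*\<tau>) else jtheta3 p (2*\<tau>))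
       / (jtheta1 (p - D) (2*\<tau>) * jtheta1 p (2*\<tau>))"

definition model_h :: "nat \<Rightarrow> complex \<Rightarrow> real \<Rightarrow> complex \<Rightarrow> complex" where
  "model_h n \<tau> D p =
     exp (- \<i> * pi * p + \<i> * pi * \<tau> + 2 * \<i> * pi * D - \<i> * pi / 2)
       * jtheta1 (p - D - \<tau>) (2*\<tau>)
       * (if even n then jtheta3 p (2*\<tau>) else jtheta2 p (2*\<tau>))
       / (jtheta1 (p - D) (2*\<tau>) * jtheta4 p (2*\<tau>))"

definition model_C :: "nat \<Rightarrow> complex \<Rightarrow> real \<Rightarrow> complex^2^2" where
  "model_C n \<tau> D =
     (let k = deriv (\<lambda>p. jtheta1 p (2*\<tau>)) 0
              / (if even n then jtheta2 0 (2*\<tau>) else jtheta3 0 (2*\<tau>))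
      in mat22 (jtheta1 D (2*\<tau>) / jtheta1 (D + \<tau>) (2*\<tau>) * k) 0
               0 (jtheta1 (D + \<tau>) (2*\<tau>) / jtheta1 D (2*\<tau>) * k))"

definition model_M :: "nat \<Rightarrow> complex \<Rightarrow> real \<Rightarrow> complex \<Rightarrow> complex^2^2" where
  "model_M n \<tau> D p =
     (let m = \<lfloor>Im p / Im \<tau>\<rfloor>; q = p - of_int m * \<tau>;
          f = model_f n \<tau> D; h = model_h n \<tau> D
      in if Im q < Im \<tau> / 2
         then model_C n \<tau> D ** mat22 (f q) (f (q + \<tau>)) (h q) (h (q + \<tau>))
         else model_C n \<tau> D ** mat22 (- f (q + \<tau>)) (f q) (- h (q + \<tau>)) (h q))"

definition poles2 :: "complex \<Rightarrow> real \<Rightarrow> complex \<Rightarrow> complex set" where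
  "poles2 \<tau> D a = {p. \<exists>k l::int. p = a + of_int k + 2 * of_int l * \<tau>
                                \<or> p = complex_of_real D + of_int k + 2 * of_int l * \<tau>}"

text \<open>div(g) >= -(a) - (D) + (D + tau) on C/(Z + 2 tau Z), g(p+1) = (-1)^(n-1) g(p),
  g(p + 2 tau) = - g(p).\<close>
definition theta_conditions :: "nat \<Rightarrow> complex \<Rightarrow> real \<Rightarrow> complex \<Rightarrow> (complex \<Rightarrow> complex) \<Rightarrow> bool" where
  "theta_conditions n \<tau> D a g \<longleftrightarrow>
     g holomorphic_on (- poles2 \<tau> D a) \<and>
     (\<forall>k l::int. let w = of_int k + 2 * of_int l * \<tau> in
        g \<in> O[at (a + w)](\<lambda>p. 1 / (p - (a + w))) \<and>
        g \<in> O[at (complex_of_real D + w)](\<lambda>p. 1 / (p - (complex_of_real D + w))) \<and>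
        g (complex_of_real D + \<tau> + w) = 0) \<and>
     (\<forall>p. p \<notin> poles2 \<tau> D a \<longrightarrow>
        g (p + 1) = (-1) ^ (n - 1) * g p \<and> g (p + 2 * \<tau>) = - g p)"

end

theory Submission
  imports Defs
begin

text \<open>
  Write \<open>\<theta>\<^sub>j\<close> for the theta functions of the lattice \<open>\<int> + 2\<tau>\<int>\<close>. An entire function with the
  multipliers \<open>\<pm>1\<close> and \<open>exp (- 2\<pi>i(\<tau> + p))\<close> that vanishes at \<open>- \<tau>\<close> is zero: dividing by a Jacobi
  triple product with simple zeros on \<open>- \<tau> + \<int> + 2\<tau>\<int>\<close> leaves a bounded entire function that
  changes sign under translation by \<open>2\<tau>\<close>. This identifies the theta series with the product up to
  a nonzero constant, hence locates their zeros, and it shows that such entire functions are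
  multiples of \<open>\<theta>\<^sub>2\<close> or \<open>\<theta>\<^sub>3\<close>, which characterizes \<open>f\<close> and \<open>h\<close>.

  For a solution \<open>M\<close> of the model problem, the jump matrix exchanges the two columns up to sign, so
  the entries of each row continue one another across the lines and form a single meromorphic
  function on the doubled torus. Its divisor and multipliers are those of \<open>f\<close> (first row) or \<open>h\<close>
  (second row), and the residue at \<open>0\<close> fixes the constant.
\<close>

subsection \<open>Theta product and vanishing of quasi-periodic entire functions\<close>

text \<open>The theta series display their multipliers but hide their zeros, while the product
  displays its zeros and their multiplicity. Comparing the two needs one nonzero value of the
  series; it is \<theta>3(0), which for a purely imaginary period is a sum of positive reals.

  The exponential exp (- pi i p) in f and h balances the displacement by \<tau> between \<theta>1(p
  - D - \<tau>) and \<theta>1(p - D). The remaining numerator and denominator have opposite signs in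
  their multipliers, so f and h change sign under 2\<tau>, which matches the square of the jump
  matrix being minus the identity. The entries of C are the reciprocals of the residues of f at 0
  and of h at \<tau>.

  A solution M is unconstrained on the jump lines and at the poles. Identities for it are therefore
  proved off these points, and values on the lines are recovered as one-sided limits.\<close>

lemma qpoch_weierstrass_product:
  assumes "Q \<noteq> 0" "norm Q < 1"
  shows   "weierstrass_product (\<lambda>n. inverse Q ^ n) (\<lambda>_. 0)"
proof
  show "inverse Q ^ n \<noteq> 0" for n
    using assms by auto
  have "1 < norm (inverse Q)"
    using assms by (simp add: norm_inverse one_less_inverse)
  thus "filterlim (\<lambda>n. inverse Q ^ n) at_infinity sequentially"
    by (simp add: filterlim_realpow_sequentially_gt1 filterlim_norm_at_top_imp_at_infinity norm_power)
  have "summable (\<lambda>n. r * norm Q ^ n)" for r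
    using assms by (intro summable_mult summable_geometric) auto
  thus "summable (\<lambda>n. (r / norm (inverse Q ^ n)) ^ Suc 0)" for r
    by (simp add: norm_power norm_inverse divide_inverse flip: power_inverse)
qed

text \<open>The infinite q-Pochhammer symbol (z; Q), one half of the Jacobi triple product.\<close>

definition qpoch :: "complex \<Rightarrow> complex \<Rightarrow> complex" where
  "qpoch Q z = (\<Prod>n. 1 - Q ^ n * z)"

text \<open>The factors are Weierstrass primary factors of degree 0 for the points
  \<open>inverse Q ^ n\<close>, which tend to infinity geometrically. Convergence and holomorphy
  thus come from the general theory of Weierstrass products.\<close>

lemma qpoch_eq_weierstrass:
  assumes "Q \<noteq> 0" "norm Q < 1"
  shows "qpoch Q z = weierstrass_product.f (\<lambda>n. inverse Q ^ n) (\<lambda>_. 0) z"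
    and "convergent_prod (\<lambda>n. 1 - Q ^ n * z)"
proof -
  interpret weierstrass_product "\<lambda>n. inverse Q ^ n" "\<lambda>_. 0"
    by (rule qpoch_weierstrass_product) fact+
  have eq: "weierstrass_factor 0 (z / inverse Q ^ n) = 1 - Q ^ n * z" for n
    using assms by (simp add: weierstrass_factor_def field_simps)
  show "qpoch Q z = f z"
    by (simp only: qpoch_def f_def eq)
  show "convergent_prod (\<lambda>n. 1 - Q ^ n * z)"
    using convergent[of z] by (simp only: eq)
qed

lemma qpoch_holomorphic:
  assumes "Q \<noteq> 0" "norm Q < 1"
  shows "qpoch Q holomorphic_on A"
proof -
  interpret weierstrass_product "\<lambda>n. inverse Q ^ n" "\<lambda>_. 0"
    by (rule qpoch_weierstrass_product) fact+
  have "qpoch Q = f"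
    using qpoch_eq_weierstrass(1)[OF assms] by auto
  thus ?thesis using holomorphic by simp
qed

lemma qpoch_rec:
  assumes "Q \<noteq> 0" "norm Q < 1"
  shows "qpoch Q z = (1 - z) * qpoch Q (Q * z)"
proof -
  have "(\<lambda>n. 1 - Q ^ n * z) has_prod ((\<Prod>k<1. 1 - Q ^ k * z) * (\<Prod>k. 1 - Q ^ (k + 1) * z))"
    by (intro has_prod_ignore_initial_segment' qpoch_eq_weierstrass assms)
  thus ?thesis
    by (simp add: has_prod_iff qpoch_def mult_ac)
qed

lemma qpoch_eq_0_iff:
  assumes "Q \<noteq> 0" "norm Q < 1"
  shows "qpoch Q z = 0 \<longleftrightarrow> (\<exists>n. Q ^ n * z = 1)"
proof -
  have "(\<lambda>n. 1 - Q ^ n * z) has_prod qpoch Q z"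
    unfolding qpoch_def using qpoch_eq_weierstrass(2)[OF assms] by auto
  from has_prod_eq_0_iff[OF this] show ?thesis
    by (auto simp: eq_commute[of 1])
qed

lemma exp_2pi_ii_eq_1:
  assumes "exp (2 * \<i> * pi * z) = 1"
  obtains k :: int where "z = of_int k"
proof -
  from assms obtain k where k: "Re (2 * \<i> * pi * z) = 0" "Im (2 * \<i> * pi * z) = of_int (2 * k) * pi"
    by (auto simp only: exp_eq_1)
  hence "z = of_int k"
    by (auto simp: complex_eq_iff)
  thus ?thesis by (rule that)
qed

text \<open>With z = exp (2 pi i p) and Q = exp (2 pi i t) this is (z; Q) (Q / z; Q), the Jacobi
  triple product without its constant factor (Q; Q).\<close>

definition theta_prod :: "complex \<Rightarrow> complex \<Rightarrow> complex" where
  "theta_prod t p = qpoch (exp (2 * \<i> * pi * t)) (exp (2 * \<i> * pi * p)) *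
     qpoch (exp (2 * \<i> * pi * t)) (exp (2 * \<i> * pi * (t - p)))"

context
  fixes t :: complex
  assumes Im_t: "Im t > 0"
begin

private definition "Q = exp (2 * \<i> * pi * t)"

private lemma Q: "Q \<noteq> 0" "norm Q < 1"
  using Im_t by (auto simp: Q_def)

lemma theta_prod_holomorphic [holomorphic_intros]:
  assumes "g holomorphic_on A"
  shows "(\<lambda>p. theta_prod t (g p)) holomorphic_on A"
proof -
  have 1: "theta_prod t = (\<lambda>p. (qpoch Q \<circ> (\<lambda>p. exp (2 * \<i> * pi * p))) p *
                            (qpoch Q \<circ> (\<lambda>p. exp (2 * \<i> * pi * (t - p)))) p)"
    by (auto simp: theta_prod_def Q_def)
  have "theta_prod t holomorphic_on UNIV"
    unfolding 1
    by (intro holomorphic_intros holomorphic_on_compose qpoch_holomorphic Q)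
  from holomorphic_on_compose_gen[OF assms this] show ?thesis
    by (simp add: o_def)
qed

lemma theta_prod_plus_1: "theta_prod t (p + 1) = theta_prod t p"
proof -
  have "exp (2 * \<i> * pi * (p + 1)) = exp (2 * \<i> * pi * p)"
    "exp (2 * \<i> * pi * (t - (p + 1))) = exp (2 * \<i> * pi * (t - p))"
    by (subst exp_eq, rule exI[of _ 1] exI[of _ "-1"], simp add: algebra_simps)+
  thus ?thesis by (simp add: theta_prod_def)
qed

text \<open>Replacing z by Q z drops the factor 1 - z from the first symbol and adds 1 - 1/z to the
  second; the quotient of these two factors is - 1/z.\<close>

lemma theta_prod_plus_t: "theta_prod t (p + t) = - exp (- 2 * \<i> * pi * p) * theta_prod t p"
proof -
  define z where "z = exp (2 * \<i> * pi * p)"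
  have z: "z \<noteq> 0" by (simp add: z_def)
  have 1: "theta_prod t (p + t) = qpoch Q (Q * z) * qpoch Q (inverse z)"
    by (simp add: theta_prod_def Q_def z_def ring_distribs exp_add mult_ac flip: exp_minus)
  have 2: "theta_prod t p = qpoch Q z * qpoch Q (Q * inverse z)"
    by (simp add: theta_prod_def Q_def z_def ring_distribs exp_add mult_ac exp_diff divide_inverse)
  have "theta_prod t (p + t) = (1 - inverse z) * (qpoch Q (Q * z) * qpoch Q (Q * inverse z))"
    unfolding 1 by (subst (2) qpoch_rec) (auto simp: Q)
  also have "1 - inverse z = - inverse z * (1 - z)"
    using z by (simp add: field_simps)
  also have "\<dots> * (qpoch Q (Q * z) * qpoch Q (Q * inverse z)) = - inverse z * theta_prod t p"
    unfolding 2 by (subst (3) qpoch_rec) (auto simp: Q)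
  also have "inverse z = exp (- 2 * \<i> * pi * p)"
    by (simp add: z_def flip: exp_minus)
  finally show ?thesis .
qed

lemma theta_prod_zero_iff:
  "theta_prod t p = 0 \<longleftrightarrow> (\<exists>k l::int. p = of_int k + of_int l * t)"
proof
  assume "theta_prod t p = 0"
  then consider n where "Q ^ n * exp (2 * \<i> * pi * p) = 1" | n where "Q ^ n * exp (2 * \<i> * pi * (t - p)) = 1"
    by (auto simp: theta_prod_def Q_def[symmetric] qpoch_eq_0_iff Q)
  thus "\<exists>k l::int. p = of_int k + of_int l * t"
  proof cases
    case 1
    hence "exp (2 * \<i> * pi * (of_nat n * t + p)) = 1"
      by (simp add: Q_def exp_add ring_distribs mult_ac flip: exp_of_nat_mult)
    then obtain k where k: "of_nat n * t + p = of_int k"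
      by (rule exp_2pi_ii_eq_1)
    hence "p = of_int k + of_int (- int n) * t"
      by (simp add: algebra_simps)
    thus ?thesis by blast
  next
    case 2
    hence "exp (2 * \<i> * pi * (of_nat (Suc n) * t - p)) = 1"
      by (simp add: Q_def exp_add exp_diff ring_distribs mult_ac flip: exp_of_nat_mult)
    then obtain k where k: "of_nat (Suc n) * t - p = of_int k"
      by (rule exp_2pi_ii_eq_1)
    hence "p = of_int (- k) + of_int (int (Suc n)) * t"
      by (simp add: algebra_simps)
    thus ?thesis by blast
  qed
next
  assume "\<exists>k l::int. p = of_int k + of_int l * t"
  then obtain k l :: int where p: "p = of_int k + of_int l * t" by blast
  have e: "exp (2 * \<i> * pi * p) = exp (2 * \<i> * pi * (of_int l * t))"
    "exp (2 * \<i> * pi * (t - p)) = exp (2 * \<i> * pi * (of_int (1 - l) * t))"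
    unfolding p
    by (subst exp_eq, rule exI[of _ k] exI[of _ "-k"], simp add: algebra_simps)+
  \<comment> \<open>The second symbol carries the zeros with l \<ge> 1, the first those with l \<le>
    0.\<close>
  show "theta_prod t p = 0"
  proof (cases "l \<ge> 1")
    case True
    have "exp (2 * \<i> * pi * (of_int (1 - l) * t)) * Q ^ nat (l - 1) = 1"
      using True by (simp add: Q_def of_nat_nat flip: exp_of_nat_mult exp_add) (simp add: algebra_simps)
    hence "qpoch Q (exp (2 * \<i> * pi * (t - p))) = 0"
      unfolding e by (subst qpoch_eq_0_iff) (auto simp: Q mult.commute)
    thus ?thesis by (simp add: theta_prod_def Q_def)
  next
    case False
    have "exp (2 * \<i> * pi * (of_int l * t)) * Q ^ nat (- l) = 1"
      using False by (simp add: Q_def of_nat_nat flip: exp_of_nat_mult exp_add)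
    hence "qpoch Q (exp (2 * \<i> * pi * p)) = 0"
      unfolding e by (subst qpoch_eq_0_iff) (auto simp: Q mult.commute)
    thus ?thesis by (simp add: theta_prod_def Q_def)
  qed
qed

text \<open>At 0 only the factor 1 - exp (2 pi i p) vanishes, and it does so to first order; the
  cofactor is nonzero because no positive power of Q equals 1. The translation rules carry this to
  all other zeros.\<close>

lemma theta_prod_deriv_nonzero:
  assumes "theta_prod t w = 0"
  shows "deriv (theta_prod t) w \<noteq> 0"
proof -
  have hol: "theta_prod t holomorphic_on UNIV"
    by (intro holomorphic_intros)
  have der: "(theta_prod t has_field_derivative deriv (theta_prod t) x) (at x)" for x
    by (rule holomorphic_derivI[OF hol]) auto
  have zero: "deriv (theta_prod t) 0 \<noteq> 0"
  proof -
    define G where "G = (\<lambda>p. qpoch Q (Q * exp (2 * \<i> * pi * p)) * qpoch Q (exp (2 * \<i> * pi * (t - p))))"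
    have 1: "G = (\<lambda>p. (qpoch Q \<circ> (\<lambda>p. Q * exp (2 * \<i> * pi * p))) p *
                            (qpoch Q \<circ> (\<lambda>p. exp (2 * \<i> * pi * (t - p)))) p)"
      by (auto simp: G_def)
    have "G holomorphic_on UNIV"
      unfolding 1 by (intro holomorphic_intros holomorphic_on_compose qpoch_holomorphic Q)
    hence G: "(G has_field_derivative deriv G 0) (at 0)"
      by (rule holomorphic_derivI) auto
    have eq: "theta_prod t = (\<lambda>p. (1 - exp (2 * \<i> * pi * p)) * G p)"
      unfolding theta_prod_def Q_def[symmetric] G_def
      by (rule ext, subst qpoch_rec) (auto simp: Q)
    have "((\<lambda>p. (1 - exp (2 * \<i> * pi * p)) * G p) has_field_derivative (- 2 * \<i> * pi * G 0)) (at 0)"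
      by (rule derivative_eq_intros G refl | simp)+
    hence d: "deriv (theta_prod t) 0 = - 2 * \<i> * pi * G 0"
      unfolding eq by (rule DERIV_imp_deriv)
    have "Q ^ n * Q \<noteq> 1" for n
    proof -
      have "norm (Q ^ Suc n) < 1"
        using Q(2) by (simp only: norm_power) (intro power_Suc_less_one; simp add: Q)
      thus ?thesis by (metis norm_one order_less_irrefl power_Suc2)
    qed
    hence "G 0 \<noteq> 0"
      by (simp add: G_def qpoch_eq_0_iff Q flip: Q_def)
    thus ?thesis by (simp add: d)
  qed
  have shift1: "deriv (theta_prod t) (p + 1) = deriv (theta_prod t) p" for p
  proof -
    have "((\<lambda>p. theta_prod t (p + 1)) has_field_derivative deriv (theta_prod t) (p + 1)) (at p)"
      using der[of "p + 1"] by (simp add: DERIV_shift)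
    thus ?thesis
      using der[of p] by (simp add: theta_prod_plus_1 DERIV_unique)
  qed
  \<comment> \<open>At a zero of \<open>theta_prod t\<close> the derivative of the exponential drops
    out of the product rule, so there the derivative obeys the same translation rule as the
    function.\<close>
  have shiftt: "deriv (theta_prod t) (p + t) = - exp (- 2 * \<i> * pi * p) * deriv (theta_prod t) p"
    if "theta_prod t p = 0" for p
  proof -
    have "((\<lambda>p. theta_prod t (p + t)) has_field_derivative deriv (theta_prod t) (p + t)) (at p)"
      using der[of "p + t"] by (simp add: DERIV_shift)
    moreover have "((\<lambda>p. - exp (- 2 * \<i> * pi * p) * theta_prod t p) has_field_derivative
       (- exp (- 2 * \<i> * pi * p) * deriv (theta_prod t) p)) (at p)"
      by (rule derivative_eq_intros der refl | simp add: that)+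
    ultimately show ?thesis
      by (simp only: theta_prod_plus_t) (metis DERIV_unique)
  qed
  obtain k l :: int where w: "w = of_int k + of_int l * t"
    using assms theta_prod_zero_iff by blast
  have z: "theta_prod t (of_int k + of_int l * t) = 0" for k l
    using theta_prod_zero_iff by blast
  have "deriv (theta_prod t) (of_int l * t) \<noteq> 0" for l :: int
  proof (induction l rule: int_induct[of _ 0])
    case (step1 i)
    thus ?case using shiftt[of "of_int i * t"] z[of 0 i] by (simp add: algebra_simps)
  next
    case (step2 i)
    thus ?case using shiftt[of "of_int (i - 1) * t"] z[of 0 "i - 1"] by (simp add: algebra_simps)
  qed (use zero in auto)
  hence "deriv (theta_prod t) (of_int k + of_int l * t) \<noteq> 0" for k l :: int
  proof (induction k rule: int_induct[of _ 0])
    case (step1 i)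
    thus ?case using shift1[of "of_int i + of_int l * t"] by (simp add: algebra_simps)
  next
    case (step2 i)
    thus ?case using shift1[of "of_int (i - 1) + of_int l * t"] by (simp add: algebra_simps)
  qed auto
  thus ?thesis by (simp add: w)
qed

end

section \<open>Entire quotients and the rigidity of quasi-periodic functions\<close>

lemma entire_quotient:
  assumes G: "G holomorphic_on UNIV" and P: "P holomorphic_on UNIV"
    and zeros: "\<And>w. P w = 0 \<Longrightarrow> G w = 0 \<and> deriv P w \<noteq> 0"
  obtains F where "F holomorphic_on UNIV" "\<And>p. G p = F p * P p"
proof -
  \<comment> \<open>At a zero w of P the value is the limit of G / P. Once the factor z - w is
    removed from both, the quotient is holomorphic near w because the zero of P is simple.\<close>
  define F where "F = (\<lambda>p. if P p = 0 then deriv G p / deriv P p else G p / P p)"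
  have loc: "\<exists>r>0. F holomorphic_on ball w r" for w
  proof (cases "P w = 0")
    case False
    have "isCont P w"
      using P by (metis UNIV_I continuous_on_eq_continuous_at holomorphic_on_imp_continuous_on open_UNIV)
    then obtain r where r: "r > 0" "\<And>z. z \<in> ball w r \<Longrightarrow> P z \<noteq> 0"
      using continuous_at_avoid[of w P 0] False by (auto simp: dist_commute)
    have "(\<lambda>p. G p / P p) holomorphic_on ball w r"
      by (intro holomorphic_intros holomorphic_on_subset[OF G] holomorphic_on_subset[OF P]) (use r in auto)
    also have "?this \<longleftrightarrow> F holomorphic_on ball w r"
      by (rule holomorphic_cong) (use r in \<open>auto simp: F_def\<close>)
    finally show ?thesis using r by blast
  next
    case True
    define G1 where "G1 = (\<lambda>z. if z = w then deriv G w else (G z - G w) / (z - w))"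
    define P1 where "P1 = (\<lambda>z. if z = w then deriv P w else (P z - P w) / (z - w))"
    have G1: "G1 holomorphic_on UNIV" and P1: "P1 holomorphic_on UNIV"
      unfolding G1_def P1_def using G P by (auto intro: pole_lemma_open)
    have "isCont P1 w"
      using P1 by (metis UNIV_I continuous_on_eq_continuous_at holomorphic_on_imp_continuous_on open_UNIV)
    moreover have "P1 w \<noteq> 0" using zeros[OF True] by (simp add: P1_def)
    ultimately obtain r where r: "r > 0" "\<And>z. z \<in> ball w r \<Longrightarrow> P1 z \<noteq> 0"
      using continuous_at_avoid[of w P1 0] by (auto simp: dist_commute)
    have "(\<lambda>p. G1 p / P1 p) holomorphic_on ball w r"
      by (intro holomorphic_intros holomorphic_on_subset[OF G1] holomorphic_on_subset[OF P1]) (use r in auto)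
    also have "?this \<longleftrightarrow> F holomorphic_on ball w r"
    proof (rule holomorphic_cong)
      fix z assume "z \<in> ball w r"
      from r(2)[OF this] show "G1 z / P1 z = F z"
        using True zeros[OF True] by (auto simp: F_def P1_def G1_def)
    qed auto
    finally show ?thesis using r by blast
  qed
  have "F holomorphic_on UNIV"
    unfolding holomorphic_on_def
  proof
    fix w :: complex
    obtain r where "r > 0" "F holomorphic_on ball w r" using loc by blast
    thus "F field_differentiable (at w within UNIV)"
      by (simp add: holomorphic_on_imp_differentiable_at)
  qed
  moreover have "G p = F p * P p" for p
    using zeros[of p] by (auto simp: F_def)
  ultimately show ?thesis using that by blast
qed

lemma holomorphic_on_compose_into:
  assumes "F holomorphic_on B" "g holomorphic_on A" "\<And>p. p \<in> A \<Longrightarrow> g p \<in> B"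
  shows "(\<lambda>p. F (g p)) holomorphic_on A"
  using holomorphic_on_compose_gen[OF assms(2,1)] assms(3) by (auto simp: o_def image_subset_iff)

lemma holomorphic_entire_compose:
  assumes "F holomorphic_on UNIV" "g holomorphic_on A"
  shows "(\<lambda>p. F (g p)) holomorphic_on A"
  using assms by (rule holomorphic_on_compose_into) auto

lemma entire_eqI_open:
  assumes "f holomorphic_on UNIV" "g holomorphic_on UNIV" "open A" "A \<noteq> {}"
    and "\<And>p. p \<in> A \<Longrightarrow> f p = g p"
  shows "f p = g p"
  using analytic_continuation_open[OF assms(3) open_UNIV assms(4) connected_UNIV _ assms(1,2,5)] by auto

text \<open>Boundedness depends on moduli only, so translation factors of modulus one, such as a
  sign, do no harm in the application of Liouville's theorem.\<close>

lemma entire_norm_doubly_periodic_imp_constant: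
  assumes F: "F holomorphic_on UNIV" and t: "Im t > 0"
    and 1: "\<And>p. norm (F (p + 1)) = norm (F p)" and 2: "\<And>p. norm (F (p + t)) = norm (F p)"
  shows "F constant_on UNIV"
proof (rule Liouville_theorem[OF F])
  have 1: "norm (F (p + of_int k)) = norm (F p)" for p k
  proof (induction k rule: int_induct[of _ 0])
    case (step1 i) thus ?case using 1[of "p + of_int i"] by (simp add: add_ac)
  next
    case (step2 i) thus ?case using 1[of "p + of_int (i - 1)"] by (simp add: add_ac)
  qed auto
  have 2: "norm (F (p + of_int k * t)) = norm (F p)" for p k
  proof (induction k rule: int_induct[of _ 0])
    case (step1 i) thus ?case using 2[of "p + of_int i * t"] by (simp add: algebra_simps)
  next
    case (step2 i) thus ?case using 2[of "p + of_int (i - 1) * t"] by (simp add: algebra_simps)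
  qed auto
  define R where "R = cbox 0 (Complex 1 (Im t))"
  have "compact (F ` R)"
    unfolding R_def
    by (intro compact_continuous_image compact_cbox
         continuous_on_subset[OF holomorphic_on_imp_continuous_on[OF F]]) auto
  then obtain B where B: "\<And>p. p \<in> R \<Longrightarrow> norm (F p) \<le> B"
    using compact_imp_bounded bounded_iff by (metis imageI)
  have "norm (F p) \<le> B" for p
  proof -
    \<comment> \<open>The multiple of t is removed before the integer, because t may have a real
      part: R is a rectangle and not the period parallelogram.\<close>
    define l where "l = \<lfloor>Im p / Im t\<rfloor>"
    define k where "k = \<lfloor>Re (p - of_int l * t)\<rfloor>"
    define p' where "p' = p - of_int l * t - of_int k"
    have "of_int l * Im t \<le> Im p" "Im p \<le> (of_int l + 1) * Im t"
      using t unfolding l_def by (metis floor_divide_lower, smt (verit) floor_divide_upper)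
    hence "p' \<in> R"
      unfolding R_def by (auto simp: in_cbox_complex_iff p'_def k_def algebra_simps) linarith+
    hence "norm (F p') \<le> B" by (rule B)
    also have "norm (F p') = norm (F (p' + of_int k + of_int l * t))"
      using 1 2 by simp
    also have "p' + of_int k + of_int l * t = p" by (simp add: p'_def)
    finally show ?thesis .
  qed
  thus "bounded (range F)" unfolding bounded_iff by blast
qed

lemma theta_multiplier_vanishing:
  assumes t: "Im t > 0" and E: "E holomorphic_on UNIV" and \<alpha>: "norm \<alpha> = 1"
    and 1: "\<And>p. E (p + 1) = \<alpha> * E p"
    and 2: "\<And>p. E (p + t) = exp (- \<i> * pi * t - 2 * \<i> * pi * p) * E p"
    and z: "E (- t / 2) = 0"
  shows "E p = 0"
proof -
  \<comment> \<open>The shift by t / 2 moves the zeros to - t / 2 + Z + tZ and turns the multiplier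
    of \<open>theta_prod\<close> into exactly the negative of that of E.\<close>
  define P where "P = (\<lambda>p. theta_prod t (p + t / 2))"
  have P: "P holomorphic_on UNIV"
    unfolding P_def using t by (intro holomorphic_intros)
  have P1: "P (p + 1) = P p" for p
    using theta_prod_plus_1[OF t, of "p + t / 2"] by (simp add: P_def add_ac)
  have P2: "P (p + t) = - exp (- \<i> * pi * t - 2 * \<i> * pi * p) * P p" for p
    using theta_prod_plus_t[OF t, of "p + t / 2"] by (simp add: P_def algebra_simps)
  have Ez: "E (- t / 2 + of_int k + of_int l * t) = 0" for k l
  proof -
    have A: "E (- t / 2 + of_int k) = 0" for k
    proof (induction k rule: int_induct[of _ 0])
      case (step1 i) thus ?case using 1[of "- t / 2 + of_int i"] by (simp add: algebra_simps)
    next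
      case (step2 i) thus ?case using \<alpha> 1[of "- t / 2 + of_int (i - 1)"] by (auto simp: algebra_simps)
    qed (use z in auto)
    show ?thesis
    proof (induction l rule: int_induct[of _ 0])
      case (step1 i) thus ?case using 2[of "- t / 2 + of_int k + of_int i * t"] by (simp add: algebra_simps)
    next
      case (step2 i) thus ?case using 2[of "- t / 2 + of_int k + of_int (i - 1) * t"] by (simp add: algebra_simps)
    qed (use A in auto)
  qed
  have "E w = 0 \<and> deriv P w \<noteq> 0" if w: "P w = 0" for w
  proof
    obtain k l :: int where "w + t / 2 = of_int k + of_int l * t"
      using w theta_prod_zero_iff[OF t] unfolding P_def by blast
    hence "w = - t / 2 + of_int k + of_int l * t" by (simp add: algebra_simps)
    thus "E w = 0" using Ez by simp
    have "(theta_prod t has_field_derivative deriv (theta_prod t) (w + t / 2)) (at (w + t / 2))"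
      by (rule holomorphic_derivI[of _ UNIV]) (use t in \<open>auto intro!: holomorphic_intros\<close>)
    hence "(P has_field_derivative deriv (theta_prod t) (w + t / 2)) (at w)"
      unfolding P_def by (simp add: DERIV_shift)
    hence "deriv P w = deriv (theta_prod t) (w + t / 2)" by (rule DERIV_imp_deriv)
    thus "deriv P w \<noteq> 0"
      using theta_prod_deriv_nonzero[OF t] that by (auto simp: P_def)
  qed
  then obtain F where F: "F holomorphic_on UNIV" "\<And>p. E p = F p * P p"
    using entire_quotient[OF E P] by metis
  \<comment> \<open>A lies between two neighbouring lines of zeros of P. There P can be cancelled,
    and the resulting rules for F extend to the plane by the identity theorem.\<close>
  define A where "A = {p. 0 < Im p} \<inter> {p. Im p < Im t / 2}"
  have "Complex 0 (Im t / 4) \<in> A" using t by (simp add: A_def)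
  hence A: "open A" "A \<noteq> {}"
    unfolding A_def by (intro open_Int open_halfspace_Im_gt open_halfspace_Im_lt, blast)
  have Pnz: "P p \<noteq> 0" if "p \<in> A" for p
  proof
    assume "P p = 0"
    then obtain k l :: int where "p + t / 2 = of_int k + of_int l * t"
      using theta_prod_zero_iff[OF t] unfolding P_def by blast
    hence "Im (p + t / 2) = of_int l * Im t" by simp
    hence "Im p + Im t / 2 = of_int l * Im t" by simp
    moreover have "0 < Im p" "Im p < Im t / 2" using that by (auto simp: A_def)
    ultimately have "0 < of_int l * Im t" "0 < (1 - of_int l) * Im t"
      using t unfolding left_diff_distrib by linarith+
    hence "0 < real_of_int l" "0 < 1 - real_of_int l"
      using t zero_less_mult_pos2 by blast+
    thus False by auto
  qed
  have F1: "F (p + 1) = \<alpha> * F p" for p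
  proof (rule entire_eqI_open[of "\<lambda>p. F (p + 1)" "\<lambda>p. \<alpha> * F p", OF _ _ A])
    show "(\<lambda>p. F (p + 1)) holomorphic_on UNIV"
      by (intro holomorphic_entire_compose[OF F(1)] holomorphic_intros)
    show "F (p + 1) = \<alpha> * F p" if "p \<in> A" for p
      using 1[of p] Pnz[OF that] by (simp add: F(2) P1)
  qed (intro holomorphic_intros F)
  have F2: "F (p + t) = - F p" for p
  proof (rule entire_eqI_open[of "\<lambda>p. F (p + t)" "\<lambda>p. - F p", OF _ _ A])
    show "(\<lambda>p. F (p + t)) holomorphic_on UNIV"
      by (intro holomorphic_entire_compose[OF F(1)] holomorphic_intros)
    show "F (p + t) = - F p" if "p \<in> A" for p
    proof -
      define e where "e = exp (- \<i> * pi * t - 2 * \<i> * pi * p)"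
      have "F (p + t) * (- e * P p) = e * (F p * P p)"
        using 2[of p] unfolding F(2) P2 e_def .
      hence "e * P p * (F (p + t) + F p) = 0" by algebra
      thus ?thesis using Pnz[OF that] by (simp add: e_def add_eq_0_iff)
    qed
  qed (intro holomorphic_intros F)
  have "F constant_on UNIV"
    by (rule entire_norm_doubly_periodic_imp_constant[OF F(1) t]) (simp_all add: F1 F2 norm_mult \<alpha>)
  then obtain c where c: "\<And>p. F p = c" by (auto simp: constant_on_def)
  have "c = 0" using F2[of 0] by (simp add: c)
  thus ?thesis by (simp add: F c)
qed

subsection \<open>Theta series\<close>

text \<open>The Gaussian decay beats the linear term: once k \<ge> (2 pi R + 1) / (pi Im t), the
  real part of the exponent is at most - k. One geometric majorant then serves a whole disc, which
  gives both summability and uniform convergence.\<close>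

lemma gauss_exp_bound:
  fixes t :: complex and R :: real
  assumes t: "Im t > 0"
  shows "\<forall>\<^sub>F k in sequentially. \<forall>p. norm p \<le> R \<longrightarrow>
           norm (exp (\<i> * pi * t * (of_nat k)^2 + 2 * \<i> * pi * of_nat k * p)) \<le> exp (-1) ^ k"
proof -
  have "\<forall>\<^sub>F k in sequentially. real k \<ge> (2 * pi * R + 1) / (pi * Im t)"
    using eventually_ge_at_top[of "nat \<lceil>(2 * pi * R + 1) / (pi * Im t)\<rceil>"]
    by eventually_elim linarith
  thus ?thesis
  proof eventually_elim
    case (elim k)
    show ?case
    proof safe
      fix p :: complex assume p: "norm p \<le> R"
      have "2 * pi * R + 1 \<le> pi * Im t * real k"
        using elim t by (simp add: field_simps)
      moreover have "- Im p \<le> R" using abs_Im_le_cmod[of p] p by linarith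
      hence "2 * pi * (- Im p) \<le> 2 * pi * R" by (intro mult_left_mono) auto
      ultimately have "1 \<le> pi * Im t * real k + 2 * pi * Im p" by linarith
      hence "real k * 1 \<le> real k * (pi * Im t * real k + 2 * pi * Im p)"
        by (intro mult_left_mono) auto
      hence "- (pi * Im t * (real k)^2) - 2 * pi * real k * Im p \<le> real k * (- 1)"
        by (simp add: algebra_simps power2_eq_square)
      hence "exp (- (pi * Im t * (real k)^2) - 2 * pi * real k * Im p) \<le> exp (real k * (- 1))"
        by simp
      also have "exp (real k * (- 1)) = exp (-1) ^ k"
        by (rule exp_of_nat_mult)
      also have "- (pi * Im t * (real k)^2) - 2 * pi * real k * Im p =
                   Re (\<i> * pi * t * (of_nat k)^2 + 2 * \<i> * pi * of_nat k * p)"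
        by (simp add: power2_eq_square)
      finally show "norm (exp (\<i> * pi * t * (of_nat k)^2 + 2 * \<i> * pi * of_nat k * p)) \<le> exp (-1) ^ k"
        by simp
    qed
  qed
qed

lemma summable_exp_minus_1_power: "summable (\<lambda>k. exp (-1 :: real) ^ k)"
  by (intro summable_geometric) simp

lemma gauss_exp_summable:
  assumes t: "Im t > 0"
  shows "summable (\<lambda>k. exp (\<i> * pi * t * (of_nat k)^2 + 2 * \<i> * pi * of_nat k * p))"
  by (rule summable_comparison_test_ev[OF _ summable_exp_minus_1_power])
     (use gauss_exp_bound[OF t, of "norm p"] in \<open>auto elim: eventually_mono\<close>)

text \<open>The cosine series is the two-sided Gaussian series with the indices k and - k
  paired.\<close>

lemma jtheta3_term:
  "2 * (exp (\<i> * pi * t * (of_nat (Suc k))^2) * cos (2 * of_nat (Suc k) * of_real pi * p)) =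
   exp (\<i> * pi * t * (of_nat (Suc k))^2 + 2 * \<i> * pi * of_nat (Suc k) * p) +
   exp (\<i> * pi * t * (of_nat (Suc k))^2 + 2 * \<i> * pi * of_nat (Suc k) * (- p))"
  by (simp add: cos_exp_eq exp_add ring_distribs mult_ac)

lemma jtheta3_sums:
  assumes t: "Im t > 0"
  shows "(\<lambda>k. exp (\<i> * pi * t * (of_nat (Suc k))^2 + 2 * \<i> * pi * of_nat (Suc k) * p) +
              exp (\<i> * pi * t * (of_nat (Suc k))^2 + 2 * \<i> * pi * of_nat (Suc k) * (- p)))
         sums (jtheta3 p t - 1)"
proof -
  let ?e = "\<lambda>p k. exp (\<i> * pi * t * (of_nat k)^2 + 2 * \<i> * pi * of_nat k * p)"
  have "summable (\<lambda>k. ?e p (Suc k) + ?e (- p) (Suc k))"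
    using gauss_exp_summable[OF t] by (intro summable_add) (subst summable_Suc_iff; blast)+
  hence s: "summable (\<lambda>k. 2 * (exp (\<i> * pi * t * (of_nat (Suc k))^2) * cos (2 * of_nat (Suc k) * of_real pi * p)))"
    unfolding jtheta3_term .
  hence s': "summable (\<lambda>k. exp (\<i> * pi * t * (of_nat (Suc k))^2) * cos (2 * of_nat (Suc k) * of_real pi * p))"
    by (subst (asm) summable_cmult_iff) auto
  have "jtheta3 p t - 1 = (\<Sum>k. 2 * (exp (\<i> * pi * t * (of_nat (Suc k))^2) * cos (2 * of_nat (Suc k) * of_real pi * p)))"
    unfolding jtheta3_def by (subst suminf_mult[OF s']) simp
  thus ?thesis
    using summable_sums[OF s] unfolding jtheta3_term by simp
qed

lemma jtheta3_entire:
  assumes t: "Im t > 0"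
  shows "(\<lambda>p. jtheta3 p t) holomorphic_on UNIV"
proof -
  let ?e = "\<lambda>p k. exp (\<i> * pi * t * (of_nat k)^2 + 2 * \<i> * pi * of_nat k * p)"
  let ?S = "\<lambda>n p. \<Sum>k<n. ?e p (Suc k) + ?e (- p) (Suc k)"
  have hol: "(\<lambda>p. jtheta3 p t - 1) holomorphic_on UNIV"
  proof (rule holomorphic_uniform_sequence)
    show "?S n holomorphic_on UNIV" for n by (intro holomorphic_intros)
    fix x :: complex
    have "uniform_limit (cball x 1) ?S (\<lambda>p. \<Sum>k. ?e p (Suc k) + ?e (- p) (Suc k)) sequentially"
    proof (rule Weierstrass_m_test_ev)
      show "summable (\<lambda>k. 2 * exp (-1 :: real) ^ Suc k)"
        by (intro summable_mult) (subst summable_Suc_iff, rule summable_exp_minus_1_power)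
      have "\<forall>\<^sub>F k in sequentially. \<forall>p. norm p \<le> norm x + 1 \<longrightarrow> norm (?e p (Suc k)) \<le> exp (-1) ^ Suc k"
        using gauss_exp_bound[OF t, of "norm x + 1"] by (subst eventually_sequentially_Suc)
      thus "\<forall>\<^sub>F k in sequentially. \<forall>p\<in>cball x 1. norm (?e p (Suc k) + ?e (- p) (Suc k)) \<le> 2 * exp (-1) ^ Suc k"
      proof eventually_elim
        case (elim k)
        show ?case
        proof
          fix p assume "p \<in> cball x 1"
          hence "norm p \<le> norm x + 1"
            using norm_triangle_sub[of p x] by (simp add: dist_norm norm_minus_commute)
          hence "norm (?e p (Suc k)) \<le> exp (-1) ^ Suc k" "norm (?e (- p) (Suc k)) \<le> exp (-1) ^ Suc k"
            using elim[rule_format, of p] elim[rule_format, of "- p"] unfolding norm_minus_cancel by blast+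
          thus "norm (?e p (Suc k) + ?e (- p) (Suc k)) \<le> 2 * exp (-1) ^ Suc k"
            using norm_triangle_ineq[of "?e p (Suc k)" "?e (- p) (Suc k)"] by linarith
        qed
      qed
    qed
    moreover have "(\<lambda>p. \<Sum>k. ?e p (Suc k) + ?e (- p) (Suc k)) = (\<lambda>p. jtheta3 p t - 1)"
      using sums_unique[OF jtheta3_sums[OF t]] by auto
    ultimately show "\<exists>d>0. cball x d \<subseteq> UNIV \<and> uniform_limit (cball x d) ?S (\<lambda>p. jtheta3 p t - 1) sequentially"
      by (intro exI[of _ 1]) simp
  qed auto
  have "(\<lambda>p. (jtheta3 p t - 1) + 1) holomorphic_on UNIV"
    by (intro holomorphic_on_add hol holomorphic_on_const)
  thus ?thesis by simp
qed

lemma jtheta2_eq_jtheta3: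
  assumes t: "Im t > 0"
  shows "jtheta2 p t = exp (\<i> * pi * t / 4 + \<i> * pi * p) * jtheta3 (p + t / 2) t"
proof -
  define e where "e = (\<lambda>p k. exp (\<i> * pi * t * (of_nat k)^2 + 2 * \<i> * pi * of_nat k * p))"
  define E where "E = exp (\<i> * pi * t / 4 + \<i> * pi * p)"
  \<comment> \<open>In the two-sided series for \<theta>3 at p + t / 2, b k is the term of index k
    and c k that of index - k - 1, both scaled by E. The series for \<theta>2 pairs these two,
    whereas that for \<theta>3 pairs k with - k.\<close>
  define b where "b = (\<lambda>k. E * e (p + t / 2) k)"
  define c where "c = (\<lambda>k. E * e (- (p + t / 2)) (Suc k))"
  have bc: "2 * (exp (\<i> * pi * t * (of_nat k + 1/2)^2) * cos ((2 * of_nat k + 1) * of_real pi * p)) = b k + c k" for k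
  proof -
    have "b k = exp (\<i> * pi * t * (of_nat k + 1/2)^2 + \<i> * ((2 * of_nat k + 1) * of_real pi * p))"
      unfolding b_def E_def e_def exp_add[symmetric]
      by (rule arg_cong[of _ _ exp]) (simp add: field_simps power2_eq_square)
    moreover have "c k = exp (\<i> * pi * t * (of_nat k + 1/2)^2 - \<i> * ((2 * of_nat k + 1) * of_real pi * p))"
      unfolding c_def E_def e_def exp_add[symmetric]
      by (rule arg_cong[of _ _ exp]) (simp add: field_simps power2_eq_square)
    ultimately have "b k + c k = exp (\<i> * pi * t * (of_nat k + 1/2)^2) *
        (exp (\<i> * ((2 * of_nat k + 1) * of_real pi * p)) + exp (- (\<i> * ((2 * of_nat k + 1) * of_real pi * p))))"
      by (simp only: exp_add exp_diff exp_minus divide_inverse distrib_left)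
    thus ?thesis unfolding cos_exp_eq by algebra
  qed
  have s3: "(\<lambda>n. \<Sum>k<n. e (p + t / 2) (Suc k) + e (- (p + t / 2)) (Suc k)) \<longlonglongrightarrow> jtheta3 (p + t / 2) t - 1"
    using jtheta3_sums[OF t, of "p + t / 2"] unfolding sums_def e_def .
  have "b \<longlonglongrightarrow> E * 0"
    unfolding b_def e_def by (intro tendsto_intros summable_LIMSEQ_zero gauss_exp_summable t)
  \<comment> \<open>The symmetric partial sum runs over the indices from - n to n and the other
    pairing from - n to n - 1. They differ by b n, which tends to 0.\<close>
  hence "(\<lambda>n. E * (1 + (\<Sum>k<n. e (p + t / 2) (Suc k) + e (- (p + t / 2)) (Suc k))) - b n)
           \<longlonglongrightarrow> E * (1 + (jtheta3 (p + t / 2) t - 1)) - E * 0"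
    by (intro tendsto_intros s3)
  also have "(\<lambda>n. E * (1 + (\<Sum>k<n. e (p + t / 2) (Suc k) + e (- (p + t / 2)) (Suc k))) - b n) =
             (\<lambda>n. \<Sum>k<n. b k + c k)"
  proof
    fix n
    have b0: "b 0 = E" by (simp add: b_def e_def)
    show "E * (1 + (\<Sum>k<n. e (p + t / 2) (Suc k) + e (- (p + t / 2)) (Suc k))) - b n = (\<Sum>k<n. b k + c k)"
    proof (induction n)
      case 0
      show ?case using b0 by simp
    next
      case (Suc n)
      thus ?case by (simp add: algebra_simps b_def c_def)
    qed
  qed
  finally have s: "(\<lambda>k. b k + c k) sums (E * jtheta3 (p + t / 2) t)"
    by (simp add: sums_def)
  hence s': "summable (\<lambda>k. exp (\<i> * pi * t * (of_nat k + 1/2)^2) * cos ((2 * of_nat k + 1) * of_real pi * p))"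
    unfolding bc[symmetric] by (intro summable_mult_D[of 2, OF sums_summable]) auto
  have "jtheta2 p t = (\<Sum>k. b k + c k)"
    unfolding jtheta2_def bc[symmetric] by (rule suminf_mult[symmetric, OF s'])
  also have "\<dots> = E * jtheta3 (p + t / 2) t"
    using s by (simp add: sums_iff)
  finally show ?thesis by (simp add: E_def)
qed

lemma jtheta2_uminus: "jtheta2 (- p) t = jtheta2 p t"
  by (simp add: jtheta2_def)

lemma jtheta3_uminus: "jtheta3 (- p) t = jtheta3 p t"
  by (simp add: jtheta3_def)

lemma jtheta3_plus_1: "jtheta3 (p + 1) t = jtheta3 p t"
proof -
  have "cos (2 * of_nat (Suc k) * of_real pi * (p + 1)) = cos (2 * of_nat (Suc k) * of_real pi * p)" for k
    using cos.plus_of_nat[of "2 * of_nat (Suc k) * of_real pi * p" "Suc k"]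
    by (simp add: algebra_simps)
  thus ?thesis by (simp only: jtheta3_def)
qed

lemma jtheta4_eq_jtheta3: "jtheta4 p t = jtheta3 (p + 1 / 2) t"
proof -
  have *: "cos (2 * of_nat m * of_real pi * (p + 1 / 2)) = (-1)^m * cos (2 * of_nat m * of_real pi * p)" for m
  proof -
    have "cos (2 * of_nat m * of_real pi * (p + 1 / 2)) = cos (2 * of_nat m * of_real pi * p + of_nat m * of_real pi)"
      by (simp add: algebra_simps)
    also have "\<dots> = (-1)^m * cos (2 * of_nat m * of_real pi * p)"
      by (induction m) (auto simp: cos_add algebra_simps)
    finally show ?thesis .
  qed
  show ?thesis unfolding jtheta4_def jtheta3_def * by (simp only: mult_ac)
qed

lemma jtheta1_eq_jtheta2: "jtheta1 p t = jtheta2 (p - 1 / 2) t"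
proof -
  have "cos ((2 * of_nat k + 1) * of_real pi * (p - 1 / 2)) = (-1)^k * sin ((2 * of_nat k + 1) * of_real pi * p)" for k
  proof -
    have "cos (x - of_nat k * of_real pi - of_real pi / 2) = (-1)^k * sin x" for x :: complex
    proof (induction k)
      case (Suc k)
      have "cos (x - of_nat (Suc k) * of_real pi - of_real pi / 2) =
            cos ((x - of_nat k * of_real pi - of_real pi / 2) - of_real pi)"
        by (simp add: algebra_simps)
      also have "\<dots> = - cos (x - of_nat k * of_real pi - of_real pi / 2)"
        by (subst cos_diff) simp
      finally show ?case by (simp add: Suc)
    qed (simp add: cos_diff)
    from this[of "(2 * of_nat k + 1) * of_real pi * p"] show ?thesis
      by (simp add: algebra_simps)
  qed
  thus ?thesis by (simp add: jtheta1_def jtheta2_def mult_ac)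
qed

subsection \<open>Zeros of the theta functions\<close>

lemma exp_half_pi_ii: "exp (\<i> * of_real pi / 2) = \<i>"
  using cis_pi_half by (simp add: cis_conv_exp)

context
  fixes t :: complex
  assumes t: "Im t > 0"
begin

lemma jtheta_holomorphic [holomorphic_intros]:
  assumes "g holomorphic_on A"
  shows "(\<lambda>p. jtheta1 (g p) t) holomorphic_on A" "(\<lambda>p. jtheta2 (g p) t) holomorphic_on A"
    "(\<lambda>p. jtheta3 (g p) t) holomorphic_on A" "(\<lambda>p. jtheta4 (g p) t) holomorphic_on A"
  unfolding jtheta1_eq_jtheta2 jtheta2_eq_jtheta3[OF t] jtheta4_eq_jtheta3
  by (intro holomorphic_entire_compose[OF jtheta3_entire[OF t]] holomorphic_intros assms; simp)+

lemma jtheta2_plus_1: "jtheta2 (p + 1) t = - jtheta2 p t"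
proof -
  have "exp (\<i> * pi * t / 4 + \<i> * pi * (p + 1)) = - exp (\<i> * pi * t / 4 + \<i> * pi * p)"
    by (simp add: exp_add ring_distribs mult_ac)
  thus ?thesis
    using jtheta3_plus_1[of "p + t / 2" t] by (simp add: jtheta2_eq_jtheta3[OF t] add_ac)
qed

lemma jtheta1_plus_1: "jtheta1 (p + 1) t = - jtheta1 p t"
  using jtheta2_plus_1[of "p - 1 / 2"] by (simp add: jtheta1_eq_jtheta2 algebra_simps)

lemma jtheta4_plus_1: "jtheta4 (p + 1) t = jtheta4 p t"
  using jtheta3_plus_1[of "p + 1 / 2"] by (simp add: jtheta4_eq_jtheta3 algebra_simps)

lemma jtheta1_uminus: "jtheta1 (- p) t = - jtheta1 p t"
proof -
  have "jtheta1 (- p) t = jtheta2 (- (p + 1 / 2)) t"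
    by (simp add: jtheta1_eq_jtheta2 algebra_simps)
  also have "\<dots> = jtheta2 ((p - 1 / 2) + 1) t"
    by (simp only: jtheta2_uminus) (simp add: algebra_simps)
  also have "\<dots> = - jtheta1 p t"
    by (simp only: jtheta2_plus_1 jtheta1_eq_jtheta2)
  finally show ?thesis .
qed

lemma jtheta3_plus_half_t: "jtheta3 (p + t / 2) t = exp (- \<i> * pi * t / 4 - \<i> * pi * p) * jtheta2 p t"
  by (simp add: jtheta2_eq_jtheta3[OF t] flip: exp_add)

text \<open>Since \<theta>2 is even, the argument may be replaced by - p - t / 2, and the
  half-period shift in \<open>jtheta2_eq_jtheta3\<close> then lands on \<theta>3 at - p.\<close>

lemma jtheta2_plus_half_t: "jtheta2 (p + t / 2) t = exp (- \<i> * pi * t / 4 - \<i> * pi * p) * jtheta3 p t"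
proof -
  have "jtheta2 (p + t / 2) t = jtheta2 (- p - t / 2) t"
    using jtheta2_uminus[of "p + t / 2" t] by (simp add: algebra_simps)
  also have "\<dots> = exp (\<i> * pi * t / 4 + \<i> * pi * (- p - t / 2)) * jtheta3 p t"
    using jtheta3_uminus[of p t] by (simp add: jtheta2_eq_jtheta3[OF t])
  also have "\<i> * pi * t / 4 + \<i> * pi * (- p - t / 2) = - \<i> * pi * t / 4 - \<i> * pi * p"
    by (simp add: field_simps)
  finally show ?thesis .
qed

lemma jtheta4_plus_half_t: "jtheta4 (p + t / 2) t = \<i> * exp (- \<i> * pi * t / 4 - \<i> * pi * p) * jtheta1 p t"
proof -
  have e: "exp (- \<i> * pi * t / 4 - \<i> * pi * (p + 1 / 2)) = - \<i> * exp (- \<i> * pi * t / 4 - \<i> * pi * p)"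
    by (simp add: exp_diff ring_distribs exp_minus exp_add exp_half_pi_ii) (simp add: field_simps)
  have "jtheta4 (p + t / 2) t = jtheta3 ((p + 1 / 2) + t / 2) t"
    by (simp add: jtheta4_eq_jtheta3 add_ac)
  also have "\<dots> = - \<i> * exp (- \<i> * pi * t / 4 - \<i> * pi * p) * jtheta2 ((p - 1 / 2) + 1) t"
    unfolding jtheta3_plus_half_t e by (simp add: algebra_simps)
  finally show ?thesis
    by (simp only: jtheta2_plus_1 jtheta1_eq_jtheta2) simp
qed

text \<open>A full period is two half periods, and these exchange \<theta>3 with \<theta>2 and
  back.\<close>

lemma jtheta3_plus_t: "jtheta3 (p + t) t = exp (- \<i> * pi * t - 2 * \<i> * pi * p) * jtheta3 p t"
proof -
  have "jtheta3 (p + t) t = jtheta3 ((p + t / 2) + t / 2) t" by (simp add: add.assoc)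
  also have "\<dots> = exp (- \<i> * pi * t / 4 - \<i> * pi * (p + t / 2)) * exp (- \<i> * pi * t / 4 - \<i> * pi * p) * jtheta3 p t"
    by (simp only: jtheta3_plus_half_t jtheta2_plus_half_t mult.assoc)
  also have "exp (- \<i> * pi * t / 4 - \<i> * pi * (p + t / 2)) * exp (- \<i> * pi * t / 4 - \<i> * pi * p) =
             exp (- \<i> * pi * t - 2 * \<i> * pi * p)"
    unfolding exp_add[symmetric] by (rule arg_cong[of _ _ exp]) (simp add: field_simps)
  finally show ?thesis .
qed

lemma jtheta2_plus_t: "jtheta2 (p + t) t = exp (- \<i> * pi * t - 2 * \<i> * pi * p) * jtheta2 p t"
proof -
  have "jtheta2 (p + t) t = jtheta2 ((p + t / 2) + t / 2) t" by (simp add: add.assoc)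
  also have "\<dots> = exp (- \<i> * pi * t / 4 - \<i> * pi * (p + t / 2)) * exp (- \<i> * pi * t / 4 - \<i> * pi * p) * jtheta2 p t"
    by (simp only: jtheta3_plus_half_t jtheta2_plus_half_t mult.assoc)
  also have "exp (- \<i> * pi * t / 4 - \<i> * pi * (p + t / 2)) * exp (- \<i> * pi * t / 4 - \<i> * pi * p) =
             exp (- \<i> * pi * t - 2 * \<i> * pi * p)"
    unfolding exp_add[symmetric] by (rule arg_cong[of _ _ exp]) (simp add: field_simps)
  finally show ?thesis .
qed

lemma jtheta1_plus_t: "jtheta1 (p + t) t = - exp (- \<i> * pi * t - 2 * \<i> * pi * p) * jtheta1 p t"
proof -
  have "jtheta1 (p + t) t = jtheta2 ((p - 1 / 2) + t) t"
    by (simp add: jtheta1_eq_jtheta2 algebra_simps)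
  also have "\<dots> = exp (- \<i> * pi * t - 2 * \<i> * pi * (p - 1 / 2)) * jtheta1 p t"
    by (simp only: jtheta2_plus_t jtheta1_eq_jtheta2)
  also have "exp (- \<i> * pi * t - 2 * \<i> * pi * (p - 1 / 2)) = - exp (- \<i> * pi * t - 2 * \<i> * pi * p)"
    by (simp add: ring_distribs exp_add exp_diff mult_ac)
  finally show ?thesis .
qed

lemma jtheta4_plus_t: "jtheta4 (p + t) t = - exp (- \<i> * pi * t - 2 * \<i> * pi * p) * jtheta4 p t"
proof -
  have "jtheta4 (p + t) t = jtheta3 ((p + 1 / 2) + t) t"
    by (simp add: jtheta4_eq_jtheta3 algebra_simps)
  also have "\<dots> = exp (- \<i> * pi * t - 2 * \<i> * pi * (p + 1 / 2)) * jtheta4 p t"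
    by (simp only: jtheta3_plus_t jtheta4_eq_jtheta3)
  also have "exp (- \<i> * pi * t - 2 * \<i> * pi * (p + 1 / 2)) = - exp (- \<i> * pi * t - 2 * \<i> * pi * p)"
    by (simp add: ring_distribs exp_add exp_diff mult_ac)
  finally show ?thesis .
qed

end

text \<open>For purely imaginary t every term of the series at 0 is a positive real, so the real
  part is at least 1. This one value is what makes the constant in \<open>jtheta2_theta_prod\<close>
  nonzero.\<close>

lemma jtheta3_0_nonzero:
  assumes t: "Im t > 0" "Re t = 0"
  shows "jtheta3 0 t \<noteq> 0"
proof -
  let ?e = "\<lambda>k. exp (- (pi * Im t * (real (Suc k))^2))"
  have it: "\<i> * t = complex_of_real (- Im t)"
    using t by (simp add: complex_eq_iff)
  have "exp (\<i> * pi * t * (of_nat (Suc k))^2) = complex_of_real (?e k)" for k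
  proof -
    have "\<i> * pi * t * (of_nat (Suc k))^2 = (\<i> * t) * pi * (of_nat (Suc k))^2"
      by (simp only: mult_ac)
    also have "\<dots> = complex_of_real (- (pi * Im t * (real (Suc k))^2))"
      unfolding it by simp
    finally show ?thesis by (simp only: exp_of_real)
  qed
  hence s: "(\<lambda>k. complex_of_real (2 * ?e k)) sums (jtheta3 0 t - 1)"
    using jtheta3_sums[OF t(1), of 0] by simp
  hence "(\<lambda>k. 2 * ?e k) sums (Re (jtheta3 0 t - 1))"
    using sums_Re[OF s] by simp
  hence "0 \<le> Re (jtheta3 0 t - 1)"
    by (rule sums_le[OF _ sums_zero, rotated]) simp
  thus ?thesis by auto
qed

context
  fixes t :: complex
  assumes t: "Im t > 0" "Re t = 0"
begin

text \<open>Both sides have the same multipliers, and c is chosen to make their difference vanish at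
  - t / 2, so \<open>theta_multiplier_vanishing\<close> applies. By evenness \<theta>2(- t / 2) =
  \<theta>2(t / 2), a nonzero multiple of \<theta>3(0), hence c is nonzero.\<close>

lemma jtheta2_theta_prod:
  "\<exists>c. c \<noteq> 0 \<and> (\<forall>p. jtheta2 p t = c * exp (- \<i> * pi * p) * theta_prod t (p + 1 / 2))"
proof -
  define R where "R = (\<lambda>p. exp (- \<i> * pi * p) * theta_prod t (p + 1 / 2))"
  have R: "R holomorphic_on UNIV"
    unfolding R_def using t(1) by (intro holomorphic_intros)
  have R1: "R (p + 1) = - 1 * R p" for p
    using theta_prod_plus_1[OF t(1), of "p + 1 / 2"]
    by (simp add: R_def algebra_simps exp_diff exp_add exp_minus)
  have R2: "R (p + t) = exp (- \<i> * pi * t - 2 * \<i> * pi * p) * R p" for p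
  proof -
    have "R (p + t) = exp (- \<i> * pi * (p + t)) * (- exp (- 2 * \<i> * pi * (p + 1 / 2)) * theta_prod t (p + 1 / 2))"
      using theta_prod_plus_t[OF t(1), of "p + 1 / 2"] by (simp add: R_def add_ac)
    also have "- exp (- 2 * \<i> * pi * (p + 1 / 2)) = exp (- 2 * \<i> * pi * p)"
      by (simp add: ring_distribs exp_diff mult_ac)
    finally have "R (p + t) = (exp (- \<i> * pi * (p + t)) * exp (- 2 * \<i> * pi * p)) * theta_prod t (p + 1 / 2)"
      by (simp only: mult.assoc)
    also have "exp (- \<i> * pi * (p + t)) * exp (- 2 * \<i> * pi * p) =
               exp (- \<i> * pi * t - 2 * \<i> * pi * p) * exp (- \<i> * pi * p)"
      unfolding exp_add[symmetric] by (rule arg_cong[of _ _ exp]) (simp add: algebra_simps)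
    finally show ?thesis by (simp only: R_def mult.assoc)
  qed
  have "R (- t / 2) \<noteq> 0"
  proof
    assume "R (- t / 2) = 0"
    hence "theta_prod t (- t / 2 + 1 / 2) = 0" by (simp add: R_def)
    then obtain k l :: int where "- t / 2 + 1 / 2 = of_int k + of_int l * t"
      using theta_prod_zero_iff[OF t(1)] by blast
    hence "Re (- t / 2 + 1 / 2) = Re (of_int k + of_int l * t)" by (rule arg_cong)
    hence "real_of_int (2 * k) = 1" using t by simp
    hence "2 * k = 1" by linarith
    thus False by presburger
  qed
  define c where "c = jtheta2 (- t / 2) t / R (- t / 2)"
  have "jtheta2 (- t / 2) t = jtheta2 (0 + t / 2) t"
    using jtheta2_uminus[of "t / 2" t] by simp
  also have "\<dots> \<noteq> 0"
    unfolding jtheta2_plus_half_t[OF t(1)] using jtheta3_0_nonzero[OF t] by simp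
  finally have "c \<noteq> 0" using \<open>R (- t / 2) \<noteq> 0\<close> by (simp add: c_def)
  moreover have "jtheta2 p t - c * R p = 0" for p
  proof (rule theta_multiplier_vanishing[OF t(1), where \<alpha> = "- 1" and E = "\<lambda>p. jtheta2 p t - c * R p"])
    show "(\<lambda>p. jtheta2 p t - c * R p) holomorphic_on UNIV"
      using t(1) by (intro holomorphic_intros R)
    show "jtheta2 (- t / 2) t - c * R (- t / 2) = 0"
      using \<open>R (- t / 2) \<noteq> 0\<close> by (simp add: c_def)
  qed (use t in \<open>auto simp add: R1 R2 jtheta2_plus_1 jtheta2_plus_t right_diff_distrib simp del: minus_mult_left[symmetric]\<close>)
  hence "jtheta2 p t = c * exp (- \<i> * pi * p) * theta_prod t (p + 1 / 2)" for p
    by (simp add: R_def mult.assoc)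
  ultimately show ?thesis by blast
qed

lemma jtheta1_theta_prod:
  "\<exists>c. c \<noteq> 0 \<and> (\<forall>p. jtheta1 p t = c * exp (- \<i> * pi * p) * theta_prod t p)"
proof -
  obtain c where c: "c \<noteq> 0" "\<And>p. jtheta2 p t = c * exp (- \<i> * pi * p) * theta_prod t (p + 1 / 2)"
    using jtheta2_theta_prod by auto
  have "jtheta1 p t = c * \<i> * exp (- \<i> * pi * p) * theta_prod t p" for p
  proof -
    have "exp (- \<i> * pi * (p - 1 / 2)) = exp (- \<i> * pi * p) * exp (\<i> * pi / 2)"
      unfolding exp_add[symmetric] by (rule arg_cong[of _ _ exp]) (simp add: field_simps)
    thus ?thesis by (simp add: jtheta1_eq_jtheta2 c(2) exp_half_pi_ii)
  qed
  thus ?thesis using c(1) by (intro exI[of _ "c * \<i>"]) simp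
qed

lemma jtheta1_zero_iff: "jtheta1 p t = 0 \<longleftrightarrow> (\<exists>k l::int. p = of_int k + of_int l * t)"
proof -
  obtain c where c: "c \<noteq> 0" "\<And>p. jtheta1 p t = c * exp (- \<i> * pi * p) * theta_prod t p"
    using jtheta1_theta_prod by auto
  have "jtheta1 p t = 0 \<longleftrightarrow> theta_prod t p = 0" using c(1) by (simp add: c(2))
  thus ?thesis by (simp only: theta_prod_zero_iff[OF t(1)])
qed

lemma jtheta1_deriv_nonzero:
  assumes "jtheta1 w t = 0"
  shows "deriv (\<lambda>p. jtheta1 p t) w \<noteq> 0"
proof -
  obtain c where c: "c \<noteq> 0" "\<And>p. jtheta1 p t = c * exp (- \<i> * pi * p) * theta_prod t p"
    using jtheta1_theta_prod by auto
  have z: "theta_prod t w = 0" using assms c by simp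
  have d: "(theta_prod t has_field_derivative deriv (theta_prod t) w) (at w)"
    by (rule holomorphic_derivI[of _ UNIV]) (use t in \<open>auto intro!: holomorphic_intros\<close>)
  have "((\<lambda>p. c * exp (- \<i> * pi * p) * theta_prod t p) has_field_derivative
          c * exp (- \<i> * pi * w) * deriv (theta_prod t) w) (at w)"
    by (rule derivative_eq_intros d refl | simp add: z)+
  hence "deriv (\<lambda>p. jtheta1 p t) w = c * exp (- \<i> * pi * w) * deriv (theta_prod t) w"
    unfolding c(2) by (rule DERIV_imp_deriv)
  thus ?thesis using c(1) theta_prod_deriv_nonzero[OF t(1) z] by simp
qed

lemma jtheta4_zero_iff: "jtheta4 p t = 0 \<longleftrightarrow> (\<exists>k l::int. p = t / 2 + of_int k + of_int l * t)"
proof -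
  have "jtheta4 p t = 0 \<longleftrightarrow> jtheta1 (p - t / 2) t = 0"
    using jtheta4_plus_half_t[OF t(1), of "p - t / 2"] by simp
  also have "\<dots> \<longleftrightarrow> (\<exists>k l::int. p = t / 2 + of_int k + of_int l * t)"
    unfolding jtheta1_zero_iff by (simp add: algebra_simps)
  finally show ?thesis .
qed

lemma jtheta2_0_nonzero: "jtheta2 0 t \<noteq> 0"
proof
  assume "jtheta2 0 t = 0"
  hence "jtheta1 (1 / 2) t = 0" by (simp add: jtheta1_eq_jtheta2)
  then obtain k l :: int where "1 / 2 = of_int k + of_int l * t"
    using jtheta1_zero_iff by blast
  hence "Re (1 / 2) = Re (of_int k + of_int l * t)" by (rule arg_cong)
  hence "real_of_int (2 * k) = 1" using t by simp
  hence "2 * k = 1" by linarith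
  thus False by presburger
qed

end

subsection \<open>Removable singularities and the pole lattice\<close>

lemma tendsto_difference_quotient:
  assumes "V holomorphic_on A" "open A" "s \<in> A"
  shows "((\<lambda>p. (V p - V s) / (p - s)) \<longlongrightarrow> deriv V s) (at s)"
proof -
  have "(V has_field_derivative deriv V s) (at s)"
    using assms by (intro holomorphic_derivI)
  thus ?thesis by (simp add: has_field_derivative_iff)
qed

lemma bigo_at_zero:
  assumes "V holomorphic_on A" "open A" "s \<in> A" "V s = 0"
  shows "V \<in> O[at s](\<lambda>p. p - s)"
  by (rule bigoI_tendsto[OF tendsto_difference_quotient[OF assms(1-3), unfolded assms(4), simplified]])
     (auto simp: eventually_at_filter)

lemma inverse_bigo_at_simple_zero:
  assumes "V holomorphic_on A" "open A" "s \<in> A" "V s = 0" "deriv V s \<noteq> 0"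
  shows "(\<lambda>p. 1 / V p) \<in> O[at s](\<lambda>p. 1 / (p - s))"
proof (rule bigoI_tendsto)
  have "((\<lambda>p. inverse ((V p - V s) / (p - s))) \<longlongrightarrow> inverse (deriv V s)) (at s)"
    by (intro tendsto_inverse tendsto_difference_quotient[OF assms(1-3)] assms)
  thus "((\<lambda>p. 1 / V p / (1 / (p - s))) \<longlongrightarrow> inverse (deriv V s)) (at s)"
    by (simp add: assms(4) field_simps)
qed (auto simp: eventually_at_filter)

lemma isCont_imp_bigo_1:
  fixes V :: "complex \<Rightarrow> complex"
  assumes "isCont V s"
  shows "V \<in> O[at s](\<lambda>_. 1)"
  by (rule bigoI_tendsto[where c = "V s"]) (use assms in \<open>auto simp: isCont_def\<close>)

lemma holomorphic_imp_isCont: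
  assumes "V holomorphic_on A" "open A" "s \<in> A"
  shows "isCont V s"
  using assms continuous_on_eq_continuous_at holomorphic_on_imp_continuous_on by blast

lemma bigo_cancel_at: "(\<lambda>p. (1 / (p - s)) * (p - s)) \<in> O[at s](\<lambda>_. 1 :: complex)"
  by (rule bigoI[where c = 1]) (auto simp: eventually_at_filter)

lemma eventually_at_nonzero_entire:
  assumes "Z holomorphic_on UNIV" "Z \<beta> \<noteq> 0"
  shows "\<forall>\<^sub>F p in at s. Z p \<noteq> 0"
  using non_zero_neighbour_alt[OF assms(1) open_UNIV connected_UNIV UNIV_I UNIV_I assms(2), of s] by simp

text \<open>The point \<beta> rules out that Z vanishes identically, so the zeros of Z are isolated
  and Riemann's theorem on removable singularities applies at each of them.\<close>

lemma removable_off_zeros: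
  assumes Z: "Z holomorphic_on UNIV" "Z \<beta> \<noteq> 0"
    and K: "K holomorphic_on {p. Z p \<noteq> 0}"
    and bdd: "\<And>s. Z s = 0 \<Longrightarrow> K \<in> O[at s](\<lambda>_. 1)"
  obtains E where "E holomorphic_on UNIV" "\<And>p. Z p \<noteq> 0 \<Longrightarrow> E p = K p"
proof -
  \<comment> \<open>Taking the punctured limit everywhere makes the local extensions agree without
    any choice, and it ignores the arbitrary values of K at the zeros of Z.\<close>
  define E where "E = (\<lambda>p. Lim (at p) K)"
  have op: "open {p. Z p \<noteq> 0}"
    by (intro open_Collect_neq holomorphic_on_imp_continuous_on Z continuous_on_const)
  have EK: "E p = K p" if "Z p \<noteq> 0" for p
    using holomorphic_imp_isCont[OF K op, of p] that
    unfolding E_def isCont_def by (intro tendsto_Lim) auto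
  have "E field_differentiable (at s)" for s
  proof -
    obtain r where r: "r > 0" "\<And>p. p \<in> ball s r - {s} \<Longrightarrow> Z p \<noteq> 0"
      using eventually_at_nonzero_entire[OF Z, of s]
      by (auto simp: eventually_at dist_commute)
    have K': "K holomorphic_on ball s r - {s}"
      by (rule holomorphic_on_subset[OF K]) (use r in auto)
    have "K \<in> O[at s](\<lambda>_. 1)"
    proof (cases "Z s = 0")
      case False
      thus ?thesis using holomorphic_imp_isCont[OF K op, of s] by (intro isCont_imp_bigo_1) auto
    qed (use bdd in auto)
    from holomorphic_on_extend[OF K' _ this] r(1)
    obtain g where g: "g holomorphic_on ball s r" "\<And>p. p \<in> ball s r - {s} \<Longrightarrow> g p = K p"
      by auto
    have "E p = g p" if p: "p \<in> ball s r" for p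
    proof -
      have "isCont g p" using holomorphic_imp_isCont[OF g(1)] p by auto
      hence "(g \<longlongrightarrow> g p) (at p)" by (simp add: isCont_def)
      moreover have "\<forall>\<^sub>F q in at p. q \<in> ball s r - {s}"
      proof (cases "p = s")
        case True
        have "\<forall>\<^sub>F q in at s. q \<in> ball s r" by (rule eventually_at_in_open') (use r in auto)
        moreover have "\<forall>\<^sub>F q in at s. q \<noteq> s" by (simp add: eventually_at_filter)
        ultimately show ?thesis unfolding True by eventually_elim auto
      next
        case False
        show ?thesis by (rule eventually_at_in_open') (use p False in auto)
      qed
      hence "\<forall>\<^sub>F q in at p. g q = K q" by (rule eventually_mono) (use g in auto)
      ultimately have "(K \<longlongrightarrow> g p) (at p)" by (rule Lim_transform_eventually)
      thus ?thesis unfolding E_def by (intro tendsto_Lim) auto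
    qed
    hence "E holomorphic_on ball s r"
      using g(1) holomorphic_cong by blast
    thus ?thesis using r(1) by (intro holomorphic_on_imp_differentiable_at[of E "ball s r"]) auto
  qed
  hence "E holomorphic_on UNIV" by (simp add: holomorphic_on_def)
  thus ?thesis using that EK by blast
qed

lemma int_parity_mult_neq:
  fixes y :: real and l m :: int
  assumes "y \<noteq> 0"
  shows "y + 2 * of_int l * y \<noteq> 2 * of_int m * y"
proof
  assume "y + 2 * of_int l * y = 2 * of_int m * y"
  hence "of_int (1 + 2 * l) * y = of_int (2 * m) * y" by (simp add: algebra_simps)
  hence "1 + 2 * l = 2 * m" using assms by (metis mult_right_cancel of_int_eq_iff)
  thus False by presburger
qed

section \<open>The lattice of the doubled torus and the pole set\<close>

locale model_problem =
  fixes \<tau> :: complex and D :: real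
  assumes Re_\<tau>: "Re \<tau> = 0" and Im_\<tau>: "Im \<tau> > 0" and D: "0 < D" "D < 1"
begin

abbreviation "th1 p \<equiv> jtheta1 p (2 * \<tau>)"
abbreviation "th2 p \<equiv> jtheta2 p (2 * \<tau>)"
abbreviation "th3 p \<equiv> jtheta3 p (2 * \<tau>)"
abbreviation "th4 p \<equiv> jtheta4 p (2 * \<tau>)"

definition lat :: "complex set" where
  "lat = {of_int k + 2 * of_int l * \<tau> | k l :: int. True}"

lemma t: "Im (2 * \<tau>) > 0" "Re (2 * \<tau>) = 0"
  using Re_\<tau> Im_\<tau> by simp_all

lemma latI: "of_int k + 2 * of_int l * \<tau> \<in> lat"
  unfolding lat_def by blast

lemma in_lat_iff: "p \<in> lat \<longleftrightarrow> (\<exists>k l :: int. Re p = of_int k \<and> Im p = 2 * of_int l * Im \<tau>)"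
  using Re_\<tau> by (auto simp: lat_def complex_eq_iff)

lemma lat_add: "v \<in> lat \<Longrightarrow> w \<in> lat \<Longrightarrow> v + w \<in> lat"
proof -
  assume "v \<in> lat" "w \<in> lat"
  then obtain k l k' l' :: int where "v = of_int k + 2 * of_int l * \<tau>" "w = of_int k' + 2 * of_int l' * \<tau>"
    by (auto simp: lat_def)
  hence "v + w = of_int (k + k') + 2 * of_int (l + l') * \<tau>" by (simp add: algebra_simps)
  thus ?thesis using latI by metis
qed

lemma lat_uminus: "w \<in> lat \<Longrightarrow> - w \<in> lat"
proof -
  assume "w \<in> lat"
  then obtain k l :: int where "w = of_int k + 2 * of_int l * \<tau>"
    by (auto simp: lat_def)
  hence "- w = of_int (- k) + 2 * of_int (- l) * \<tau>" by simp
  thus ?thesis using latI by metis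
qed

lemma lat_add_iff: "w \<in> lat \<Longrightarrow> v + w \<in> lat \<longleftrightarrow> v \<in> lat"
  using lat_add[of v w] lat_add[OF _ lat_uminus, of "v + w" w] by auto

lemma lat_diff_iff: "w \<in> lat \<Longrightarrow> v - w \<in> lat \<longleftrightarrow> v \<in> lat"
  using lat_add_iff[of "- w" v] lat_uminus by auto

lemma two_tau_in_lat: "2 * \<tau> \<in> lat" and zero_in_lat: "0 \<in> lat"
  using latI[of 0 1] latI[of 0 0] by simp_all

lemma tau_notin_lat: "\<tau> \<notin> lat"
  using int_parity_mult_neq[of "Im \<tau>" 0] Im_\<tau> by (auto simp: in_lat_iff)

lemma D_not_int: "D \<noteq> of_int k"
proof
  assume "D = of_int k"
  hence "0 < k" "k < 1" using D by simp_all
  thus False by simp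
qed

text \<open>As \<tau> is purely imaginary, each of these points has real part D or - D, while points
  of \<open>lat\<close> have integer real part.\<close>

lemma D_notin_lat: "of_real D \<notin> lat" "- of_real D \<notin> lat"
  "of_real D + \<tau> \<notin> lat" "\<tau> - of_real D \<notin> lat" "- of_real D - \<tau> \<notin> lat"
  using D_not_int D_not_int[of "- _"] Re_\<tau> by (auto simp: in_lat_iff minus_equation_iff[of D])

lemma th1_zero_iff: "th1 p = 0 \<longleftrightarrow> p \<in> lat"
  by (subst jtheta1_zero_iff[OF t]) (auto simp: lat_def mult_ac)

lemma th4_zero_iff: "th4 p = 0 \<longleftrightarrow> p - \<tau> \<in> lat"
  by (subst jtheta4_zero_iff[OF t]) (auto simp: lat_def algebra_simps)

lemma th_holomorphic [holomorphic_intros]: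
  assumes "g holomorphic_on A"
  shows "(\<lambda>p. th1 (g p)) holomorphic_on A" "(\<lambda>p. th2 (g p)) holomorphic_on A"
    "(\<lambda>p. th3 (g p)) holomorphic_on A" "(\<lambda>p. th4 (g p)) holomorphic_on A"
  using jtheta_holomorphic[OF t(1) assms] by auto

text \<open>\<open>lat\<close> has index two in the lattice Z + \<tau>Z, so each of the two pole
  classes splits into two cosets, according to the parity of the coefficient of \<tau>.\<close>

lemma RHP_poles_iff: "p \<in> RHP_poles \<tau> D \<longleftrightarrow>
  p \<in> lat \<or> p - \<tau> \<in> lat \<or> p - of_real D \<in> lat \<or> p - of_real D - \<tau> \<in> lat"
proof -
  have *: "(\<exists>a b::int. p = of_int a + of_int b * \<tau>) \<longleftrightarrow> p \<in> lat \<or> p - \<tau> \<in> lat" for p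
  proof
    assume "\<exists>a b::int. p = of_int a + of_int b * \<tau>"
    then obtain a b :: int where p: "p = of_int a + of_int b * \<tau>" by blast
    show "p \<in> lat \<or> p - \<tau> \<in> lat"
    proof (cases "even b")
      case True
      then obtain l where "b = 2 * l" by (elim evenE)
      hence "p = of_int a + 2 * of_int l * \<tau>" by (simp add: p)
      thus ?thesis using latI by metis
    next
      case False
      then obtain l where "b = 2 * l + 1" by (elim oddE)
      hence "p - \<tau> = of_int a + 2 * of_int l * \<tau>" by (simp add: p algebra_simps)
      thus ?thesis using latI by metis
    qed
  next
    assume "p \<in> lat \<or> p - \<tau> \<in> lat"
    then obtain a l :: int where "p = of_int a + 2 * of_int l * \<tau> \<or> p - \<tau> = of_int a + 2 * of_int l * \<tau>"
      by (auto simp: lat_def)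
    hence "p = of_int a + of_int (2 * l) * \<tau> \<or> p = of_int a + of_int (2 * l + 1) * \<tau>"
      by (auto simp: algebra_simps)
    thus "\<exists>a b::int. p = of_int a + of_int b * \<tau>" by blast
  qed
  have "p \<in> RHP_poles \<tau> D \<longleftrightarrow> (\<exists>a b::int. p = of_int a + of_int b * \<tau>) \<or>
          (\<exists>a b::int. p - of_real D = of_int a + of_int b * \<tau>)"
    unfolding RHP_poles_def by (auto simp: algebra_simps)
  thus ?thesis by (simp add: *)
qed

lemma RHP_poles_shift: "p + 1 \<in> RHP_poles \<tau> D \<longleftrightarrow> p \<in> RHP_poles \<tau> D"
  "p + \<tau> \<in> RHP_poles \<tau> D \<longleftrightarrow> p \<in> RHP_poles \<tau> D"
  "p + of_int k * \<tau> \<in> RHP_poles \<tau> D \<longleftrightarrow> p \<in> RHP_poles \<tau> D"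
proof -
  have *: "p + of_int k + of_int l * \<tau> \<in> RHP_poles \<tau> D" if p: "p \<in> RHP_poles \<tau> D" for p and k l :: int
  proof -
    obtain a b :: int where "p = of_int a + of_int b * \<tau> \<or> p = of_real D + of_int a + of_int b * \<tau>"
      using p unfolding RHP_poles_def by blast
    hence "p + of_int k + of_int l * \<tau> = of_int (a + k) + of_int (b + l) * \<tau> \<or>
           p + of_int k + of_int l * \<tau> = of_real D + of_int (a + k) + of_int (b + l) * \<tau>"
      by (auto simp: algebra_simps)
    thus ?thesis unfolding RHP_poles_def by blast
  qed
  show "p + of_int k * \<tau> \<in> RHP_poles \<tau> D \<longleftrightarrow> p \<in> RHP_poles \<tau> D"
    using *[of p 0 k] *[of "p + of_int k * \<tau>" 0 "- k"] by auto
  show "p + 1 \<in> RHP_poles \<tau> D \<longleftrightarrow> p \<in> RHP_poles \<tau> D"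
    using *[of p 1 0] *[of "p + 1" "- 1" 0] by auto
  show "p + \<tau> \<in> RHP_poles \<tau> D \<longleftrightarrow> p \<in> RHP_poles \<tau> D"
    using *[of p 0 1] *[of "p + \<tau>" 0 "- 1"] by auto
qed

text \<open>An entire function that vanishes exactly on the pole set. That the complement is open,
  that the poles are isolated and that singularities on the set can be removed all follow from this
  one function.\<close>

definition pole_fun :: "complex \<Rightarrow> complex" where
  "pole_fun p = th1 p * th4 p * th1 (p - D) * th1 (p - D - \<tau>)"

lemma pole_fun_zero_iff: "pole_fun p = 0 \<longleftrightarrow> p \<in> RHP_poles \<tau> D"
  by (auto simp: pole_fun_def RHP_poles_iff th1_zero_iff th4_zero_iff)

lemma pole_fun_holomorphic: "pole_fun holomorphic_on UNIV"
  unfolding pole_fun_def by (intro holomorphic_intros)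

lemma RHP_poles_Im:
  assumes "p \<in> RHP_poles \<tau> D"
  obtains m :: int where "Im p = of_int m * Im \<tau>"
  using assms that unfolding RHP_poles_def by force

lemma strip_not_pole:
  assumes "0 < Im p" "Im p < Im \<tau> / 2"
  shows "p \<notin> RHP_poles \<tau> D"
proof
  assume "p \<in> RHP_poles \<tau> D"
  then obtain m :: int where m: "Im p = of_int m * Im \<tau>" by (rule RHP_poles_Im)
  have "0 < of_int m * Im \<tau>" "0 < (1 - of_int m) * Im \<tau>"
    using assms m Im_\<tau> unfolding left_diff_distrib by linarith+
  hence "0 < real_of_int m" "0 < 1 - real_of_int m"
    using Im_\<tau> zero_less_mult_pos2 by blast+
  thus False by auto
qed

lemma pole_fun_nontrivial: "pole_fun (\<tau> / 4) \<noteq> 0"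
  unfolding pole_fun_zero_iff by (rule strip_not_pole) (use Im_\<tau> in auto)

lemma open_compl_poles: "open (- RHP_poles \<tau> D)"
proof -
  have "open {p. pole_fun p \<noteq> 0}"
    by (intro open_Collect_neq holomorphic_on_imp_continuous_on pole_fun_holomorphic continuous_on_const)
  also have "{p. pole_fun p \<noteq> 0} = - RHP_poles \<tau> D"
    using pole_fun_zero_iff by auto
  finally show ?thesis .
qed

lemma eventually_not_pole: "\<forall>\<^sub>F p in at s. p \<notin> RHP_poles \<tau> D"
  using eventually_at_nonzero_entire[OF pole_fun_holomorphic pole_fun_nontrivial] by (simp add: pole_fun_zero_iff)

lemma th1_bigo_at_lat:
  assumes "s - x \<in> lat"
  shows "(\<lambda>p. th1 (p - x)) \<in> O[at s](\<lambda>p. p - s)"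
    "(\<lambda>p. 1 / th1 (p - x)) \<in> O[at s](\<lambda>p. 1 / (p - s))"
proof -
  have hol: "(\<lambda>p. th1 (p - x)) holomorphic_on UNIV" by (intro holomorphic_intros)
  have z: "th1 (s - x) = 0" using assms by (simp add: th1_zero_iff)
  show "(\<lambda>p. th1 (p - x)) \<in> O[at s](\<lambda>p. p - s)"
    by (rule bigo_at_zero[OF hol]) (use z in auto)
  have "((\<lambda>p. th1 p) has_field_derivative deriv (\<lambda>p. th1 p) (s - x)) (at (s - x))"
    by (rule holomorphic_derivI[of _ UNIV]) (auto intro!: holomorphic_intros)
  hence "((\<lambda>p. th1 (p - x)) has_field_derivative deriv (\<lambda>p. th1 p) (s - x)) (at s)"
    using DERIV_shift[of "\<lambda>p. th1 p" _ s "- x"] by simp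
  hence "deriv (\<lambda>p. th1 (p - x)) s = deriv (\<lambda>p. th1 p) (s - x)" by (rule DERIV_imp_deriv)
  hence "deriv (\<lambda>p. th1 (p - x)) s \<noteq> 0" using jtheta1_deriv_nonzero[OF t z] by simp
  thus "(\<lambda>p. 1 / th1 (p - x)) \<in> O[at s](\<lambda>p. 1 / (p - s))"
    by (intro inverse_bigo_at_simple_zero[OF hol]) (use z in auto)
qed

lemma th1_bigo_at_non_lat:
  assumes "s - x \<notin> lat"
  shows "(\<lambda>p. 1 / th1 (p - x)) \<in> O[at s](\<lambda>_. 1)"
proof -
  have "isCont (\<lambda>p. th1 (p - x)) s"
    by (rule holomorphic_imp_isCont[of _ UNIV]) (auto intro!: holomorphic_intros)
  hence "isCont (\<lambda>p. 1 / th1 (p - x)) s"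
    using assms by (intro continuous_intros) (auto simp: th1_zero_iff)
  thus ?thesis by (rule isCont_imp_bigo_1)
qed

text \<open>The exponentials depending on p cancel in the quotient; only the offset by \<tau>
  between the two arguments leaves a constant.\<close>

lemma th1_shift_ratio:
  "th1 (p + 2 * \<tau> - D) / th1 (p + 2 * \<tau> - D - \<tau>) = exp (- 2 * \<i> * pi * \<tau>) * (th1 (p - D) / th1 (p - D - \<tau>))"
proof -
  have "th1 (p + 2 * \<tau> - D) = - exp (- \<i> * pi * (2 * \<tau>) - 2 * \<i> * pi * (p - D)) * th1 (p - D)"
    "th1 (p + 2 * \<tau> - D - \<tau>) = - exp (- \<i> * pi * (2 * \<tau>) - 2 * \<i> * pi * (p - D - \<tau>)) * th1 (p - D - \<tau>)"
    using jtheta1_plus_t[OF t(1), of "p - D"] jtheta1_plus_t[OF t(1), of "p - D - \<tau>"]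
    by (simp_all add: algebra_simps)
  moreover have "exp (- \<i> * pi * (2 * \<tau>) - 2 * \<i> * pi * (p - D)) =
      exp (- 2 * \<i> * pi * \<tau>) * exp (- \<i> * pi * (2 * \<tau>) - 2 * \<i> * pi * (p - D - \<tau>))"
    unfolding exp_add[symmetric] by (rule arg_cong[of _ _ exp]) (simp add: algebra_simps)
  ultimately show ?thesis by simp
qed

lemma th1_shift_ratio_1:
  fixes p :: complex
  shows "th1 (p + 1 - D) / th1 (p + 1 - D - \<tau>) = th1 (p - D) / th1 (p - D - \<tau>)"
  using jtheta1_plus_1[OF t(1), of "p - D"] jtheta1_plus_1[OF t(1), of "p - D - \<tau>"]
  by (simp add: algebra_simps)

end

subsection \<open>Functions with prescribed divisor on the doubled torus\<close>

lemma isCont_eq_eventually: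
  fixes u v :: "complex \<Rightarrow> complex"
  assumes "isCont u p" "isCont v p" "\<forall>\<^sub>F q in at p. u q = v q"
  shows "u p = v p"
proof -
  have "(v \<longlongrightarrow> u p) (at p)"
    using assms(1,3) unfolding isCont_def by (blast intro: Lim_transform_eventually)
  thus ?thesis using assms(2) unfolding isCont_def by (intro tendsto_unique[OF _ _ , of "at p" v]) auto
qed

text \<open>A common frame for f and h: W is the denominator factor that vanishes on a +
  \<open>lat\<close> (\<theta>1 for f, \<theta>4 for h), N the remaining numerator, and \<epsilon>,
  \<nu> their signs under p + 1. The minus sign in \<nu> = - \<alpha> * \<epsilon> compensates that
  of exp (- pi i p). The point - \<tau> is minus half of the period 2\<tau>, where
  \<open>theta_multiplier_vanishing\<close> tests for zero.\<close>

locale theta_quotient = model_problem +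
  fixes W N :: "complex \<Rightarrow> complex" and a \<alpha> \<epsilon> \<nu> \<kappa> :: complex
  assumes W: "W holomorphic_on UNIV" "\<And>p. W p = 0 \<longleftrightarrow> p - a \<in> lat"
      "\<And>p. W (p + 1) = \<epsilon> * W p"
      "\<And>p. W (p + 2 * \<tau>) = - exp (- \<i> * pi * (2 * \<tau>) - 2 * \<i> * pi * p) * W p"
      "\<And>s. s - a \<in> lat \<Longrightarrow> (\<lambda>p. 1 / W p) \<in> O[at s](\<lambda>p. 1 / (p - s))"
    and N: "N holomorphic_on UNIV" "N (- \<tau>) \<noteq> 0"
      "\<And>p. N (p + 1) = \<nu> * N p"
      "\<And>p. N (p + 2 * \<tau>) = exp (- \<i> * pi * (2 * \<tau>) - 2 * \<i> * pi * p) * N p"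
    and \<nu>: "norm \<nu> = 1" "\<nu> = - \<alpha> * \<epsilon>"
    and a_cases: "a = 0 \<or> a = \<tau>"
    and \<kappa>: "\<kappa> \<noteq> 0"
begin

definition G :: "complex \<Rightarrow> complex" where
  "G p = \<kappa> * (exp (- \<i> * pi * p) * th1 (p - D - \<tau>) * N p / (th1 (p - D) * W p))"

lemma lat_shift_iff: "p + 2 * \<tau> \<in> lat \<longleftrightarrow> p \<in> lat" "p - 2 * \<tau> \<in> lat \<longleftrightarrow> p \<in> lat"
  using lat_add_iff[OF two_tau_in_lat] lat_diff_iff[OF two_tau_in_lat] by auto

text \<open>The pole set is covered by the cosets of a, a + \<tau>, D and D + \<tau> modulo
  \<open>lat\<close>, and these four are pairwise disjoint, whichever value a has.\<close>

lemma a: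
  "\<And>s. s \<in> RHP_poles \<tau> D \<Longrightarrow> s - a \<in> lat \<or> s - of_real D \<in> lat \<or> s - of_real D - \<tau> \<in> lat \<or> s - a - \<tau> \<in> lat"
  "\<And>s. s - a \<in> lat \<Longrightarrow> s - of_real D - \<tau> \<notin> lat"
  "\<And>s. s - a - \<tau> \<in> lat \<Longrightarrow> s - of_real D - \<tau> \<notin> lat"
  "\<And>s. s - a \<in> lat \<Longrightarrow> s \<in> RHP_poles \<tau> D"
  "\<And>s. s - a \<in> lat \<Longrightarrow> s - of_real D \<notin> lat"
  "\<And>s. s - of_real D - \<tau> \<in> lat \<Longrightarrow> s - of_real D \<notin> lat"
  "\<And>s. s - a - \<tau> \<in> lat \<Longrightarrow> s - a \<notin> lat"
  "\<And>s. s - a - \<tau> \<in> lat \<Longrightarrow> s - of_real D \<notin> lat"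
proof -
  have *: "v - w \<in> lat" if "v \<in> lat" "w \<in> lat" for v w
    using that lat_diff_iff by blast
  have D': "of_real D - \<tau> \<notin> lat"
    using D_notin_lat(4) lat_uminus[of "of_real D - \<tau>"] by auto
  fix s
  show "s \<in> RHP_poles \<tau> D \<Longrightarrow> s - a \<in> lat \<or> s - of_real D \<in> lat \<or> s - of_real D - \<tau> \<in> lat \<or> s - a - \<tau> \<in> lat"
    using a_cases lat_shift_iff(2)[of s] by (auto simp: RHP_poles_iff)
  show "s \<in> RHP_poles \<tau> D" if "s - a \<in> lat"
    using that a_cases by (auto simp: RHP_poles_iff)
  show "s - of_real D - \<tau> \<notin> lat" if "s - a \<in> lat"
    using *[OF that, of "s - of_real D - \<tau>"] a_cases D_notin_lat by auto
  show "s - of_real D - \<tau> \<notin> lat" if "s - a - \<tau> \<in> lat"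
    using *[OF that, of "s - of_real D - \<tau>"] a_cases D_notin_lat D' by auto
  show "s - of_real D \<notin> lat" if "s - a \<in> lat"
    using *[OF that, of "s - of_real D"] a_cases D_notin_lat D' by auto
  show "s - of_real D \<notin> lat" if "s - of_real D - \<tau> \<in> lat"
    using *[OF _ that, of "s - of_real D"] tau_notin_lat by auto
  show "s - a \<notin> lat" if "s - a - \<tau> \<in> lat"
    using *[OF _ that, of "s - a"] tau_notin_lat by auto
  show "s - of_real D \<notin> lat" if "s - a - \<tau> \<in> lat"
    using *[OF that, of "s - of_real D"] a_cases D_notin_lat D' lat_shift_iff(2)[of "of_real D"]
    by (auto simp: algebra_simps)
qed

lemma poles2_iff: "p \<in> poles2 \<tau> D a \<longleftrightarrow> p - a \<in> lat \<or> p - of_real D \<in> lat"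
proof -
  have "p \<in> poles2 \<tau> D a \<longleftrightarrow> (\<exists>k l::int. p - a = of_int k + 2 * of_int l * \<tau>) \<or>
          (\<exists>k l::int. p - of_real D = of_int k + 2 * of_int l * \<tau>)"
    unfolding poles2_def by (auto simp: algebra_simps)
  thus ?thesis by (auto simp: lat_def)
qed

lemma poles2_subset: "poles2 \<tau> D a \<subseteq> RHP_poles \<tau> D"
  using a(4) poles2_iff RHP_poles_iff by blast

lemma poles2_zero_iff: "th1 (p - of_real D) * W p = 0 \<longleftrightarrow> p \<in> poles2 \<tau> D a"
  by (auto simp: poles2_iff th1_zero_iff W(2))

lemma open_compl_poles2: "open (- poles2 \<tau> D a)"
proof -
  have "(\<lambda>p. th1 (p - D) * W p) holomorphic_on UNIV" by (intro holomorphic_intros W)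
  hence "open {p::complex. th1 (p - D) * W p \<noteq> 0}"
    by (intro open_Collect_neq holomorphic_on_imp_continuous_on continuous_on_const)
  also have "{p::complex. th1 (p - D) * W p \<noteq> 0} = - poles2 \<tau> D a"
    using poles2_zero_iff by blast
  finally show ?thesis .
qed

lemma G_plus_1: "G (p + 1) = \<alpha> * G p"
proof -
  have "\<epsilon> \<noteq> 0" using \<nu> by auto
  have "exp (- \<i> * pi * (p + 1)) = - exp (- \<i> * pi * p)"
    by (simp add: ring_distribs exp_diff)
  moreover have "th1 (p + 1 - D) = - th1 (p - D)" "th1 (p + 1 - D - \<tau>) = - th1 (p - D - \<tau>)"
    using jtheta1_plus_1[OF t(1), of "p - D"] jtheta1_plus_1[OF t(1), of "p - D - \<tau>"]
    by (simp_all add: algebra_simps)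
  ultimately show ?thesis
    unfolding G_def W(3) N(3) \<nu>(2) using \<open>\<epsilon> \<noteq> 0\<close> by simp
qed

text \<open>The factor x from the exponential cancels against the one from the quotient of \<theta>1
  values. What is left is the quotient of the multipliers of N and W, which is - 1.\<close>

lemma G_plus_2tau: "G (p + 2 * \<tau>) = - G p"
proof -
  define e where "e = exp (- \<i> * pi * (2 * \<tau>) - 2 * \<i> * pi * p)"
  define x where "x = exp (- 2 * \<i> * pi * \<tau>)"
  have nz: "e \<noteq> 0" "x \<noteq> 0" by (simp_all add: e_def x_def)
  have "G (p + 2 * \<tau>) = \<kappa> * exp (- \<i> * pi * (p + 2 * \<tau>)) * N (p + 2 * \<tau>) / W (p + 2 * \<tau>) /
          (th1 (p + 2 * \<tau> - D) / th1 (p + 2 * \<tau> - D - \<tau>))"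
    by (simp add: G_def mult_ac)
  also have "exp (- \<i> * pi * (p + 2 * \<tau>)) = exp (- \<i> * pi * p) * x"
    unfolding x_def exp_add[symmetric] by (rule arg_cong[of _ _ exp]) (simp add: algebra_simps)
  finally show ?thesis
    unfolding th1_shift_ratio W(4) N(4) e_def[symmetric] x_def[symmetric] G_def
    using nz by (simp add: mult_ac)
qed

lemma G_holomorphic: "G holomorphic_on - poles2 \<tau> D a"
  unfolding G_def using poles2_zero_iff
  by (intro holomorphic_intros holomorphic_on_subset[OF W(1)] holomorphic_on_subset[OF N(1)]) auto

lemma G_meromorphic: "G meromorphic_on UNIV"
proof -
  have 1: "u meromorphic_on UNIV" if "u holomorphic_on UNIV" for u
    using that by (intro analytic_on_imp_meromorphic_on) (simp add: analytic_on_open)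
  have "(\<lambda>p. (\<kappa> * (exp (- \<i> * pi * p) * th1 (p - D - \<tau>) * N p)) / (th1 (p - D) * W p)) meromorphic_on UNIV"
    by (rule meromorphic_on_divide; rule 1; intro holomorphic_intros W N)
  thus ?thesis by (simp add: G_def[abs_def])
qed

lemma G_zero:
  assumes "s - of_real D - \<tau> \<in> lat"
  shows "G s = 0"
  using assms by (simp add: G_def th1_zero_iff)

lemma G_bigo_pole:
  assumes "s - a \<in> lat \<or> s - of_real D \<in> lat"
  shows "G \<in> O[at s](\<lambda>p. 1 / (p - s))"
proof -
  have cont: "isCont (\<lambda>p. \<kappa> * (exp (- \<i> * pi * p) * th1 (p - D - \<tau>) * N p)) s"
    by (rule holomorphic_imp_isCont[of _ UNIV]; (intro holomorphic_intros N)?; simp)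
  have G_eq: "G = (\<lambda>p. \<kappa> * (exp (- \<i> * pi * p) * th1 (p - D - \<tau>) * N p) * (1 / th1 (p - D)) * (1 / W p))"
    by (auto simp: G_def)
  show ?thesis
  proof (cases "s - a \<in> lat")
    case True
    have "G \<in> O[at s](\<lambda>p. 1 * 1 * (1 / (p - s)))"
      unfolding G_eq
      by (intro landau_o.big.mult[OF landau_o.big.mult[OF isCont_imp_bigo_1[OF cont] th1_bigo_at_non_lat] W(5)] a(5) True)
    thus ?thesis by simp
  next
    case False
    have "isCont W s" by (rule holomorphic_imp_isCont[OF W(1)]) auto
    hence "isCont (\<lambda>p. 1 / W p) s"
      using False by (intro continuous_intros) (auto simp: W(2))
    hence "(\<lambda>p. 1 / W p) \<in> O[at s](\<lambda>_. 1)" by (rule isCont_imp_bigo_1)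
    hence "G \<in> O[at s](\<lambda>p. 1 * (1 / (p - s)) * 1)"
      unfolding G_eq using assms False
      by (intro landau_o.big.mult[OF landau_o.big.mult[OF isCont_imp_bigo_1[OF cont] th1_bigo_at_lat(2)]]) auto
    thus ?thesis by simp
  qed
qed

lemma G_theta_conditions:
  assumes "\<alpha> = (-1) ^ (n - 1)"
  shows "theta_conditions n \<tau> D a G"
  unfolding theta_conditions_def Let_def
  using G_holomorphic G_plus_1 G_plus_2tau assms latI
  by (auto intro!: G_bigo_pole G_zero)

text \<open>Multiplying \<open>g\<close> by the denominator of the model function and dividing by
  \<open>\<theta>\<^sub>1 (p - D - \<tau>)\<close> gives an entire function with the multipliers of the remaining numerator \<open>N\<close>.\<close>
lemma unique_off_RHP_poles:
  assumes g: "g holomorphic_on - RHP_poles \<tau> D"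
      "\<And>s. s - a \<in> lat \<Longrightarrow> g \<in> O[at s](\<lambda>p. 1 / (p - s))"
      "\<And>s. s - of_real D \<in> lat \<Longrightarrow> g \<in> O[at s](\<lambda>p. 1 / (p - s))"
      "\<And>s. s - of_real D - \<tau> \<in> lat \<Longrightarrow> g \<in> O[at s](\<lambda>p. p - s)"
      "\<And>s. s - a - \<tau> \<in> lat \<Longrightarrow> g \<in> O[at s](\<lambda>_. 1)"
      "\<And>p. 0 < Im p \<Longrightarrow> Im p < Im \<tau> / 2 \<Longrightarrow> g (p + 1) = \<alpha> * g p"
      "\<And>p. 0 < Im p \<Longrightarrow> Im p < Im \<tau> / 2 \<Longrightarrow> g (p + 2 * \<tau>) = - g p"
  shows "\<exists>c. \<forall>p. p \<notin> RHP_poles \<tau> D \<longrightarrow> g p = c * G p"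
proof -
  define B where "B = (\<lambda>p. 1 / th1 (p - (of_real D + \<tau>)))"
  define K where "K = (\<lambda>p. g p * (exp (\<i> * pi * p) * th1 (p - D) * W p) * B p)"
  have B_eq: "B p = 1 / th1 (p - D - \<tau>)" for p
    unfolding B_def by (simp add: algebra_simps)
  have cont: "isCont (\<lambda>p. exp (\<i> * pi * p) * W p) s" "isCont (\<lambda>p. exp (\<i> * pi * p) * th1 (p - D)) s"
     "isCont (\<lambda>p. exp (\<i> * pi * p) * th1 (p - D) * W p) s" for s
    by (rule holomorphic_imp_isCont[of _ UNIV]; (intro holomorphic_intros W)?; simp)+
  have W0: "W \<in> O[at s](\<lambda>p. p - s)" if "s - a \<in> lat" for s
    by (rule bigo_at_zero[OF W(1)]) (use that W(2) in auto)
  \<comment> \<open>Near a and D the simple pole of g meets a zero of \<theta>1(p - D) or W. Near D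
    + \<tau> the zero of g meets the pole of B. Near a + \<tau> every factor is bounded.\<close>
  have K_bdd: "K \<in> O[at s](\<lambda>_. 1)" if s: "pole_fun s = 0" for s
  proof -
    have "K \<in> O[at s](\<lambda>_. (1 * 1) * 1)" if *: "s - a \<in> lat \<or> s - of_real D \<in> lat"
    proof -
      have Dt: "s - (of_real D + \<tau>) \<notin> lat"
      proof
        assume "s - (of_real D + \<tau>) \<in> lat"
        hence 1: "s - of_real D - \<tau> \<in> lat" by (simp add: algebra_simps)
        hence "s - of_real D \<in> lat" using * a(2) by blast
        from lat_diff_iff[OF 1, of "s - of_real D"] this have "\<tau> \<in> lat" by simp
        thus False using tau_notin_lat by blast
      qed
      have V: "(\<lambda>p. exp (\<i> * pi * p) * th1 (p - D) * W p) \<in> O[at s](\<lambda>p. 1 * (p - s))"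
      proof (cases "s - a \<in> lat")
        case True
        have "(\<lambda>p. (exp (\<i> * pi * p) * th1 (p - D)) * W p) \<in> O[at s](\<lambda>p. 1 * (p - s))"
          by (intro landau_o.big.mult isCont_imp_bigo_1 cont W0 True)
        thus ?thesis by simp
      next
        case False
        hence "s - of_real D \<in> lat" using * by blast
        hence "(\<lambda>p. (exp (\<i> * pi * p) * W p) * th1 (p - D)) \<in> O[at s](\<lambda>p. 1 * (p - s))"
          by (intro landau_o.big.mult isCont_imp_bigo_1 cont th1_bigo_at_lat)
        thus ?thesis by (simp add: mult_ac)
      qed
      have "g \<in> O[at s](\<lambda>p. 1 / (p - s))" using * g(2,3) by blast
      from landau_o.big.mult[OF this V]
      have "(\<lambda>p. g p * (exp (\<i> * pi * p) * th1 (p - D) * W p)) \<in> O[at s](\<lambda>p. (1 / (p - s)) * (1 * (p - s)))" .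
      also have "(\<lambda>p. (1 / (p - s)) * (1 * (p - s))) \<in> O[at s](\<lambda>_. 1 * 1)"
        using bigo_cancel_at by simp
      finally show ?thesis unfolding K_def B_def
        by (rule landau_o.big.mult[OF _ th1_bigo_at_non_lat[OF Dt]])
    qed
    moreover have "K \<in> O[at s](\<lambda>p. (p - s) * 1 * (1 / (p - s)))" if "s - of_real D - \<tau> \<in> lat"
      unfolding K_def B_def using that
      by (intro landau_o.big.mult isCont_imp_bigo_1 cont th1_bigo_at_lat g(4)) (simp_all add: algebra_simps)
    hence "K \<in> O[at s](\<lambda>_. 1)" if "s - of_real D - \<tau> \<in> lat"
      using that landau_o.big.trans[OF _ bigo_cancel_at] by (simp add: mult_ac)
    moreover have "K \<in> O[at s](\<lambda>p. 1 * 1 * 1)" if "s - a - \<tau> \<in> lat"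
    proof -
      have "s - (of_real D + \<tau>) \<notin> lat" using a(3)[OF that] by (simp add: algebra_simps)
      thus ?thesis unfolding K_def B_def using that
        by (intro landau_o.big.mult isCont_imp_bigo_1 cont th1_bigo_at_non_lat g(5))
    qed
    ultimately show ?thesis using a(1) s by (auto simp: pole_fun_zero_iff)
  qed
  have "(\<lambda>p. g p * (exp (\<i> * pi * p) * th1 (p - D) * W p) * (1 / th1 (p - D - \<tau>))) holomorphic_on - RHP_poles \<tau> D"
    by (intro holomorphic_intros g holomorphic_on_subset[OF W(1)]) (auto simp: RHP_poles_iff th1_zero_iff)
  hence K_hol: "K holomorphic_on {p. pole_fun p \<noteq> 0}"
    unfolding K_def B_eq by (simp add: pole_fun_zero_iff Compl_eq)
  obtain E where E: "E holomorphic_on UNIV" "\<And>p. pole_fun p \<noteq> 0 \<Longrightarrow> E p = K p"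
    using removable_off_zeros[OF pole_fun_holomorphic pole_fun_nontrivial K_hol K_bdd] by blast
  \<comment> \<open>This strip is free of poles and is where the two translation rules for g are
    assumed; they pass to E on the whole plane by the identity theorem.\<close>
  define A where "A = {p. 0 < Im p} \<inter> {p. Im p < Im \<tau> / 2}"
  have "\<tau> / 4 \<in> A" using Im_\<tau> by (simp add: A_def)
  hence A: "open A" "A \<noteq> {}"
    unfolding A_def by (intro open_Int open_halfspace_Im_gt open_halfspace_Im_lt, blast)
  have shift: "p + 2 * \<tau> \<notin> RHP_poles \<tau> D" "p + 1 \<notin> RHP_poles \<tau> D" if "p \<notin> RHP_poles \<tau> D" for p
    using that RHP_poles_shift(1)[of p] RHP_poles_shift(2)[of p] RHP_poles_shift(2)[of "p + \<tau>"]
    by (simp_all add: add.assoc)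
  have EK: "E p = K p" "E (p + 1) = K (p + 1)" "E (p + 2 * \<tau>) = K (p + 2 * \<tau>)" if "p \<in> A" for p
    using E(2)[of p] E(2)[of "p + 1"] E(2)[of "p + 2 * \<tau>"] strip_not_pole[of p] that shift[of p]
    by (auto simp: A_def pole_fun_zero_iff)
  have E1: "E (p + 1) = \<nu> * E p" for p
  proof (rule entire_eqI_open[of "\<lambda>p. E (p + 1)" "\<lambda>p. \<nu> * E p", OF _ _ A])
    show "(\<lambda>p. E (p + 1)) holomorphic_on UNIV"
      by (intro holomorphic_entire_compose[OF E(1)] holomorphic_intros)
    fix p assume p: "p \<in> A"
    have "K (p + 1) = g (p + 1) * exp (\<i> * pi * (p + 1)) * W (p + 1) * (th1 (p + 1 - D) / th1 (p + 1 - D - \<tau>))"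
      by (simp add: K_def B_eq)
    also have "exp (\<i> * pi * (p + 1)) = - exp (\<i> * pi * p)"
      by (simp add: ring_distribs exp_add)
    finally have "K (p + 1) = \<nu> * K p"
      using g(6) p unfolding th1_shift_ratio_1 W(3)
      by (simp add: A_def K_def B_eq \<nu>(2))
    thus "E (p + 1) = \<nu> * E p" by (simp only: EK[OF p])
  qed (intro holomorphic_intros E)
  have E2: "E (p + 2 * \<tau>) = exp (- \<i> * pi * (2 * \<tau>) - 2 * \<i> * pi * p) * E p" for p
  proof (rule entire_eqI_open[of "\<lambda>p. E (p + 2 * \<tau>)" "\<lambda>p. exp (- \<i> * pi * (2 * \<tau>) - 2 * \<i> * pi * p) * E p", OF _ _ A])
    show "(\<lambda>p. E (p + 2 * \<tau>)) holomorphic_on UNIV"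
      by (intro holomorphic_entire_compose[OF E(1)] holomorphic_intros)
    fix p assume p: "p \<in> A"
    have "K (p + 2 * \<tau>) = g (p + 2 * \<tau>) * exp (\<i> * pi * (p + 2 * \<tau>)) * W (p + 2 * \<tau>) *
             (th1 (p + 2 * \<tau> - D) / th1 (p + 2 * \<tau> - D - \<tau>))"
      by (simp add: K_def B_eq)
    also have "exp (\<i> * pi * (p + 2 * \<tau>)) = exp (\<i> * pi * p) / exp (- 2 * \<i> * pi * \<tau>)"
      unfolding exp_diff[symmetric] by (rule arg_cong[of _ _ exp]) (simp add: algebra_simps)
    finally have "K (p + 2 * \<tau>) = exp (- \<i> * pi * (2 * \<tau>) - 2 * \<i> * pi * p) * K p"
      using g(7) p unfolding th1_shift_ratio W(4)
      by (simp add: A_def K_def B_eq)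
    thus "E (p + 2 * \<tau>) = exp (- \<i> * pi * (2 * \<tau>) - 2 * \<i> * pi * p) * E p"
      by (simp only: EK[OF p])
  qed (intro holomorphic_intros E)
  \<comment> \<open>With this c the function E - c N vanishes at - \<tau>, so its multipliers force
    it to vanish identically.\<close>
  define c where "c = E (- \<tau>) / N (- \<tau>)"
  have EN: "E p - c * N p = 0" for p
  proof (rule theta_multiplier_vanishing[OF t(1), where \<alpha> = \<nu> and E = "\<lambda>p. E p - c * N p"])
    show "(\<lambda>p. E p - c * N p) holomorphic_on UNIV"
      by (intro holomorphic_intros E N)
    show "E (- (2 * \<tau>) / 2) - c * N (- (2 * \<tau>) / 2) = 0"
      using N(2) by (simp add: c_def)
    show "E (p + 1) - c * N (p + 1) = \<nu> * (E p - c * N p)" for p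
      unfolding E1 N(3) by (simp add: algebra_simps)
    show "E (p + 2 * \<tau>) - c * N (p + 2 * \<tau>) =
        exp (- \<i> * pi * (2 * \<tau>) - 2 * \<i> * pi * p) * (E p - c * N p)" for p
      unfolding E2 N(4) by (simp add: algebra_simps)
  qed (use \<nu> in auto)
  show ?thesis
  proof (rule exI[of _ "c / \<kappa>"], safe)
    fix p assume p: "p \<notin> RHP_poles \<tau> D"
    have nz: "th1 (p - D) \<noteq> 0" "th1 (p - D - \<tau>) \<noteq> 0"
      using p by (auto simp: RHP_poles_iff th1_zero_iff)
    have "W p \<noteq> 0" using a(4) p W(2) by blast
    have "c * N p = g p * (exp (\<i> * pi * p) * th1 (p - D) * W p) * (1 / th1 (p - D - \<tau>))"
      using EN[of p] E(2)[of p] p by (simp add: pole_fun_zero_iff K_def B_eq)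
    moreover have "exp (- \<i> * pi * p) * exp (\<i> * pi * p) = 1"
      by (simp flip: exp_add)
    ultimately show "g p = c / \<kappa> * G p"
      unfolding G_def using nz \<open>W p \<noteq> 0\<close> \<kappa> by (simp add: field_simps exp_minus)
  qed
qed

text \<open>At D + \<tau> the function g is holomorphic, so its prescribed value 0 becomes the bound
  O(p - s). The identity is obtained off \<open>RHP_poles\<close>, which also contains the regular
  classes of a + \<tau> and D + \<tau>; continuity fills these in.\<close>

lemma theta_conditions_unique:
  assumes g: "theta_conditions n \<tau> D a g" and \<alpha>: "\<alpha> = (-1) ^ (n - 1)"
  shows "\<exists>c. \<forall>p. p \<notin> poles2 \<tau> D a \<longrightarrow> g p = c * G p"
proof -
  have hol: "g holomorphic_on - poles2 \<tau> D a"
    using g by (simp add: theta_conditions_def)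
  have at: "g \<in> O[at (a + w)](\<lambda>p. 1 / (p - (a + w)))"
    "g \<in> O[at (of_real D + w)](\<lambda>p. 1 / (p - (of_real D + w)))"
    "g (of_real D + \<tau> + w) = 0" if "w \<in> lat" for w
    using g that unfolding theta_conditions_def Let_def lat_def by blast+
  have per: "g (p + 1) = \<alpha> * g p" "g (p + 2 * \<tau>) = - g p" if "p \<notin> poles2 \<tau> D a" for p
    using g that unfolding theta_conditions_def \<alpha> by blast+
  have "\<exists>c. \<forall>p. p \<notin> RHP_poles \<tau> D \<longrightarrow> g p = c * G p"
  proof (rule unique_off_RHP_poles)
    show "g holomorphic_on - RHP_poles \<tau> D"
      by (rule holomorphic_on_subset[OF hol]) (use poles2_subset in auto)
    show "g \<in> O[at s](\<lambda>p. 1 / (p - s))" if "s - a \<in> lat" for s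
      using at(1)[OF that] by simp
    show "g \<in> O[at s](\<lambda>p. 1 / (p - s))" if "s - of_real D \<in> lat" for s
      using at(2)[OF that] by simp
    show "g \<in> O[at s](\<lambda>p. p - s)" if "s - of_real D - \<tau> \<in> lat" for s
    proof (rule bigo_at_zero[OF hol open_compl_poles2])
      show "s \<in> - poles2 \<tau> D a" using that a(2,6) by (auto simp: poles2_iff)
      show "g s = 0" using at(3)[OF that] by simp
    qed
    show "g \<in> O[at s](\<lambda>_. 1)" if "s - a - \<tau> \<in> lat" for s
      using a(7,8)[OF that]
      by (intro isCont_imp_bigo_1 holomorphic_imp_isCont[OF hol open_compl_poles2]) (auto simp: poles2_iff)
    fix p assume "0 < Im p" "Im p < Im \<tau> / 2"
    hence "p \<notin> poles2 \<tau> D a" using strip_not_pole poles2_subset by blast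
    thus "g (p + 1) = \<alpha> * g p" "g (p + 2 * \<tau>) = - g p" using per by auto
  qed
  then obtain c where c: "\<And>p. p \<notin> RHP_poles \<tau> D \<Longrightarrow> g p = c * G p" by blast
  have "g p = c * G p" if "p \<notin> poles2 \<tau> D a" for p
  proof (rule isCont_eq_eventually[where u = g and v = "\<lambda>p. c * G p"])
    show "isCont g p" "isCont (\<lambda>p. c * G p) p"
      using that by (intro continuous_intros holomorphic_imp_isCont[OF _ open_compl_poles2] hol G_holomorphic; simp)+
    show "\<forall>\<^sub>F q in at p. g q = c * G q"
      using eventually_not_pole by eventually_elim (rule c)
  qed
  thus ?thesis by blast
qed

end

section \<open>The functions f and h as theta quotients\<close>

context model_problem
begin

lemma th4_inverse_bigo:
  assumes "s - \<tau> \<in> lat"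
  shows "(\<lambda>p. 1 / th4 p) \<in> O[at s](\<lambda>p. 1 / (p - s))"
proof -
  define e where "e = (\<lambda>p. \<i> * exp (- \<i> * pi * (2 * \<tau>) / 4 - \<i> * pi * (p - \<tau>)))"
  have eq: "th4 p = e p * th1 (p - \<tau>)" for p
    using jtheta4_plus_half_t[OF t(1), of "p - \<tau>"] by (simp add: e_def)
  have "isCont (\<lambda>p. 1 / e p) s" by (auto simp: e_def intro!: continuous_intros)
  hence "(\<lambda>p. (1 / e p) * (1 / th1 (p - \<tau>))) \<in> O[at s](\<lambda>p. 1 * (1 / (p - s)))"
    by (intro landau_o.big.mult isCont_imp_bigo_1 th1_bigo_at_lat assms)
  thus ?thesis by (simp add: eq)
qed

lemma th2_minus_tau: "th2 (- \<tau>) \<noteq> 0" and th3_minus_tau: "th3 (- \<tau>) \<noteq> 0"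
proof -
  have "th2 (- \<tau>) = th2 (0 + 2 * \<tau> / 2)" "th3 (- \<tau>) = th3 (0 + 2 * \<tau> / 2)"
    using jtheta2_uminus[of \<tau>] jtheta3_uminus[of \<tau>] by simp_all
  thus "th2 (- \<tau>) \<noteq> 0" "th3 (- \<tau>) \<noteq> 0"
    unfolding jtheta2_plus_half_t[OF t(1)] jtheta3_plus_half_t[OF t(1)]
    using jtheta2_0_nonzero[OF t] jtheta3_0_nonzero[OF t] by simp_all
qed

definition num_f :: "nat \<Rightarrow> complex \<Rightarrow> complex" where
  "num_f n p = (if even n then th2 p else th3 p)"

definition num_h :: "nat \<Rightarrow> complex \<Rightarrow> complex" where
  "num_h n p = (if even n then th3 p else th2 p)"

lemma num_holomorphic [holomorphic_intros]:
  assumes "g holomorphic_on A"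
  shows "(\<lambda>p. num_f n (g p)) holomorphic_on A" "(\<lambda>p. num_h n (g p)) holomorphic_on A"
  by (cases "even n"; simp add: num_f_def num_h_def th_holomorphic assms)+

definition \<kappa>h :: complex where "\<kappa>h = exp (\<i> * pi * \<tau> + 2 * \<i> * pi * D - \<i> * pi / 2)"

lemma minus_one_power_diff_1: "n \<ge> 1 \<Longrightarrow> (-1 :: 'a :: ring_1) ^ (n - 1) = (if even n then - 1 else 1)"
  by (cases n) auto

lemma theta_quotient_f:
  assumes "n \<ge> 1"
  shows "theta_quotient \<tau> D (\<lambda>p. th1 p) (num_f n) 0 ((-1) ^ (n - 1)) (- 1) (if even n then - 1 else 1) 1"
proof
  show "(\<lambda>p. th1 p) holomorphic_on UNIV" "num_f n holomorphic_on UNIV"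
    using num_holomorphic(1)[of "\<lambda>p. p" UNIV n] by (auto intro!: holomorphic_intros)
  show "(\<lambda>p. 1 / th1 p) \<in> O[at s](\<lambda>p. 1 / (p - s))" if "s - 0 \<in> lat" for s
    using th1_bigo_at_lat(2)[OF that] by simp
  show "num_f n (- \<tau>) \<noteq> 0" using th2_minus_tau th3_minus_tau by (simp add: num_f_def)
qed (use assms in \<open>auto simp: th1_zero_iff jtheta1_plus_1[OF t(1)] jtheta1_plus_t[OF t(1)] num_f_def
       jtheta2_plus_1[OF t(1)] jtheta2_plus_t[OF t(1)] jtheta3_plus_1 jtheta3_plus_t[OF t(1)] minus_one_power_diff_1\<close>)

lemma theta_quotient_h:
  assumes "n \<ge> 1"
  shows "theta_quotient \<tau> D (\<lambda>p. th4 p) (num_h n) \<tau> ((-1) ^ (n - 1)) 1 (if even n then 1 else - 1) \<kappa>h"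
proof
  show "(\<lambda>p. th4 p) holomorphic_on UNIV" "num_h n holomorphic_on UNIV"
    using num_holomorphic(2)[of "\<lambda>p. p" UNIV n] by (auto intro!: holomorphic_intros)
  show "num_h n (- \<tau>) \<noteq> 0" using th2_minus_tau th3_minus_tau by (simp add: num_h_def)
qed (use assms in \<open>auto simp: th4_zero_iff th4_inverse_bigo jtheta4_plus_1[OF t(1)] jtheta4_plus_t[OF t(1)] num_h_def \<kappa>h_def
       jtheta2_plus_1[OF t(1)] jtheta2_plus_t[OF t(1)] jtheta3_plus_1 jtheta3_plus_t[OF t(1)] minus_one_power_diff_1\<close>)

end

locale model_problem_n = model_problem +
  fixes n :: nat
  assumes n: "n \<ge> 1"
begin

sublocale f: theta_quotient \<tau> D "\<lambda>p. th1 p" "num_f n" 0 "(-1) ^ (n - 1)" "- 1" "if even n then - 1 else 1" 1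
  by (rule theta_quotient_f[OF n])

sublocale h: theta_quotient \<tau> D "\<lambda>p. th4 p" "num_h n" \<tau> "(-1) ^ (n - 1)" 1 "if even n then 1 else - 1" \<kappa>h
  by (rule theta_quotient_h[OF n])

lemma model_f_eq: "model_f n \<tau> D = f.G"
  by (auto simp: model_f_def f.G_def num_f_def)

lemma model_h_eq: "model_h n \<tau> D = h.G"
proof
  fix p
  have "exp (- \<i> * pi * p + \<i> * pi * \<tau> + 2 * \<i> * pi * D - \<i> * pi / 2) = \<kappa>h * exp (- \<i> * pi * p)"
    unfolding \<kappa>h_def exp_add[symmetric] by (rule arg_cong[of _ _ exp]) simp
  thus "model_h n \<tau> D p = h.G p"
    unfolding model_h_def h.G_def num_h_def by simp
qed

end

subsection \<open>Existence\<close>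

lemma ent_mat22 [simp]:
  "ent (mat22 a b c d) 1 1 = a" "ent (mat22 a b c d) 1 2 = b"
  "ent (mat22 a b c d) 2 1 = c" "ent (mat22 a b c d) 2 2 = d"
  by (simp_all add: ent_def mat22_def)

lemma mat_eq_iff_ent: "A = B \<longleftrightarrow> (\<forall>i j. ent A i j = ent B i j)"
  by (simp add: vec_eq_iff ent_def)

lemma ent_mult: "ent (A ** B) i j = ent A i 1 * ent B 1 j + ent A i 2 * ent B 2 j"
  by (simp add: ent_def matrix_matrix_mult_def sum_2)

lemma ent_scaleR: "ent (r *\<^sub>R A) i j = of_real r * ent A i j"
  unfolding ent_def vector_scaleR_component by (rule scaleR_conv_of_real)

lemma tendsto_ent: "(M \<longlongrightarrow> A) F \<Longrightarrow> ((\<lambda>p. ent (M p) i j) \<longlongrightarrow> ent A i j) F"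
  unfolding ent_def by (intro tendsto_vec_nth)

lemma tendsto_entI:
  assumes "\<And>i j. ((\<lambda>p. ent (M p) i j) \<longlongrightarrow> ent A i j) F"
  shows "(M \<longlongrightarrow> A) F"
  using assms unfolding ent_def by (intro vec_tendstoI)

text \<open>Write T p = p V p. The difference is then (c A - V) / T, where the condition on c makes
  the numerator vanish at 0 and the zero of T at 0 is simple.\<close>

lemma simple_pole_bigo:
  assumes A: "A holomorphic_on U" and T: "T holomorphic_on U" and U: "open U" "0 \<in> U"
    and z: "T 0 = 0" "deriv T 0 \<noteq> 0" and c: "c * A 0 = deriv T 0"
  shows "(\<lambda>p. c * (A p / T p) - 1 / p) \<in> O[at 0](\<lambda>_. 1 :: complex)"
proof -
  define V where "V = (\<lambda>p. if p = 0 then deriv T 0 else (T p - T 0) / (p - 0))"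
  have V: "V holomorphic_on U"
    unfolding V_def by (rule pole_lemma_open[OF T U(1)])
  have Y: "(\<lambda>p. c * A p - V p) \<in> O[at 0](\<lambda>p. p - 0)"
  proof (rule bigo_at_zero[OF _ U])
    show "(\<lambda>p. c * A p - V p) holomorphic_on U" by (intro holomorphic_intros A V)
    show "c * A 0 - V 0 = 0" by (simp add: c V_def)
  qed
  have ev: "\<forall>\<^sub>F p in at 0. (1 / T p) * (c * A p - V p) = c * (A p / T p) - 1 / p"
  proof -
    have "isCont V 0" by (rule holomorphic_imp_isCont[OF V U])
    hence "\<forall>\<^sub>F p in at 0. V p \<noteq> 0"
      using z by (intro tendsto_imp_eventually_ne[of V "V 0"]) (auto simp: isCont_def V_def)
    moreover have "\<forall>\<^sub>F p in at 0. p \<noteq> (0 :: complex)" by (simp add: eventually_at_filter)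
    ultimately show ?thesis
      by eventually_elim (auto simp: V_def z field_simps)
  qed
  have "(\<lambda>p. (1 / T p) * (c * A p - V p)) \<in> O[at 0](\<lambda>p. (1 / (p - 0)) * (p - 0))"
    by (intro landau_o.big.mult Y inverse_bigo_at_simple_zero[OF T U] z)
  hence "(\<lambda>p. (1 / T p) * (c * A p - V p)) \<in> O[at 0](\<lambda>_. 1)"
    by (rule landau_o.big.trans[OF _ bigo_cancel_at])
  thus ?thesis by (simp only: landau_o.big.in_cong[OF ev])
qed

section \<open>The strips between the jump lines\<close>

context model_problem
begin

definition strip :: "int \<Rightarrow> complex set" where
  "strip k = {p. (of_int k - 1/2) * Im \<tau> < Im p} \<inter> {p. Im p < (of_int k + 1/2) * Im \<tau>}"

lemma open_strip: "open (strip k)"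
  unfolding strip_def by (intro open_Int open_halfspace_Im_gt open_halfspace_Im_lt)

lemma RHP_domain_eq: "RHP_domain \<tau> = (\<Union>k. strip k)"
proof (intro equalityI subsetI)
  fix p assume p: "p \<in> RHP_domain \<tau>"
  define k where "k = \<lfloor>Im p / Im \<tau> + 1/2\<rfloor>"
  have "of_int k \<le> Im p / Im \<tau> + 1/2" "Im p / Im \<tau> + 1/2 < of_int k + 1"
    unfolding k_def by linarith+
  hence "(of_int k - 1/2) * Im \<tau> \<le> Im p" "Im p < (of_int k + 1/2) * Im \<tau>"
    using Im_\<tau> by (simp_all add: field_simps)
  moreover have "Im p \<noteq> (of_int (k - 1) + 1/2) * Im \<tau>"
    using p unfolding RHP_domain_def by blast
  hence "(of_int k - 1/2) * Im \<tau> \<noteq> Im p" by (simp add: algebra_simps)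
  ultimately have "p \<in> strip k" by (simp add: strip_def order_less_le)
  thus "p \<in> (\<Union>k. strip k)" by blast
next
  fix p assume "p \<in> (\<Union>k. strip k)"
  then obtain k where k: "(of_int k - 1/2) * Im \<tau> < Im p" "Im p < (of_int k + 1/2) * Im \<tau>"
    by (auto simp: strip_def)
  show "p \<in> RHP_domain \<tau>"
    unfolding RHP_domain_def
  proof safe
    fix m :: int assume "Im p = (of_int m + 1/2) * Im \<tau>"
    hence "real_of_int k - 1/2 < of_int m + 1/2" "real_of_int m + 1/2 < of_int k + 1/2"
      using k Im_\<tau> by simp_all
    hence "real_of_int m < of_int k" "real_of_int k < of_int (m + 1)" by simp_all
    thus False unfolding of_int_less_iff by simp
  qed
qed

lemma strip_plus_1: "p + 1 \<in> strip k \<longleftrightarrow> p \<in> strip k"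
  by (simp add: strip_def)

lemma strip_plus_tau: "p + \<tau> \<in> strip (k + 1) \<longleftrightarrow> p \<in> strip k"
proof -
  have "(of_int (k + 1) - 1/2) * Im \<tau> = (of_int k - 1/2) * Im \<tau> + Im \<tau>"
    "(of_int (k + 1) + 1/2) * Im \<tau> = (of_int k + 1/2) * Im \<tau> + Im \<tau>"
    by (simp_all add: algebra_simps)
  thus ?thesis unfolding strip_def by simp
qed

lemma zero_in_strip: "0 \<in> strip 0" and D_in_strip: "of_real D \<in> strip 0"
  using Im_\<tau> by (simp_all add: strip_def)

lemma half_line_not_pole:
  assumes "Im x = (of_int k + 1/2) * Im \<tau>"
  shows "x \<notin> RHP_poles \<tau> D"
proof
  assume "x \<in> RHP_poles \<tau> D"
  then obtain m :: int where "Im x = of_int m * Im \<tau>" by (rule RHP_poles_Im)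
  hence "real_of_int m = of_int k + 1/2" using assms Im_\<tau> by simp
  hence "real_of_int (2 * m) = of_int (2 * k + 1)" by simp
  hence "2 * m = 2 * k + 1" by (simp only: of_int_eq_iff)
  thus False by presburger
qed

lemma eventually_in_strip_below:
  assumes x: "Im x = (of_int k + 1/2) * Im \<tau>"
  shows "\<forall>\<^sub>F p in at x within {p. Im p < Im x}. p \<in> strip k"
proof -
  have "(of_int k - 1/2) * Im \<tau> = Im x - Im \<tau>" unfolding x by (simp add: algebra_simps)
  hence "strip k = {p. Im x - Im \<tau> < Im p} \<inter> {p. Im p < Im x}" by (simp add: strip_def x)
  thus ?thesis
    unfolding eventually_at_topological
    using Im_\<tau> by (intro exI[of _ "{p. Im x - Im \<tau> < Im p}"]) (auto intro: open_halfspace_Im_gt)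
qed

lemma eventually_in_strip_above:
  assumes x: "Im x = (of_int k + 1/2) * Im \<tau>"
  shows "\<forall>\<^sub>F p in at x within {p. Im p > Im x}. p \<in> strip (k + 1)"
proof -
  have "(of_int (k + 1) - 1/2) * Im \<tau> = Im x" "(of_int (k + 1) + 1/2) * Im \<tau> = Im x + Im \<tau>"
    unfolding x by (simp_all add: algebra_simps)
  hence "strip (k + 1) = {p. Im x < Im p} \<inter> {p. Im p < Im x + Im \<tau>}" unfolding strip_def by simp
  thus ?thesis
    unfolding eventually_at_topological
    using Im_\<tau> by (intro exI[of _ "{p. Im p < Im x + Im \<tau>}"]) (auto intro: open_halfspace_Im_lt)
qed

lemma eventually_in_strip: "p \<in> strip k \<Longrightarrow> \<forall>\<^sub>F q in at p. q \<in> strip k"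
  by (rule eventually_at_in_open'[OF open_strip])

end

context model_problem_n
begin

definition C1 :: complex where
  "C1 = th1 D / th1 (D + \<tau>) * (deriv (\<lambda>p. th1 p) 0 / num_f n 0)"

definition C2 :: complex where
  "C2 = th1 (D + \<tau>) / th1 D * (deriv (\<lambda>p. th1 p) 0 / num_f n 0)"

lemma model_C_eq: "model_C n \<tau> D = mat22 C1 0 0 C2"
  unfolding model_C_def C1_def C2_def num_f_def Let_def ..

text \<open>The two entries in a row of \<open>model_M\<close> are translates of this single
  function, the second by \<tau>; \<open>off\<close> records the translation.\<close>

definition row :: "2 \<Rightarrow> complex \<Rightarrow> complex" where
  "row i p = (if i = 1 then C1 * f.G p else C2 * h.G p)"

definition off :: "2 \<Rightarrow> complex" where
  "off j = (if j = 1 then 0 else \<tau>)"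

lemma row_plus_1: "row i (p + 1) = (-1) ^ (n - 1) * row i p"
  by (simp add: row_def f.G_plus_1 h.G_plus_1)

lemma row_plus_2tau: "row i (p + 2 * \<tau>) = - row i p"
  by (simp add: row_def f.G_plus_2tau h.G_plus_2tau)

lemma row_holomorphic: "row i holomorphic_on - RHP_poles \<tau> D"
proof -
  have "f.G holomorphic_on - RHP_poles \<tau> D" "h.G holomorphic_on - RHP_poles \<tau> D"
    using f.poles2_subset h.poles2_subset
    by (auto intro!: holomorphic_on_subset[OF f.G_holomorphic] holomorphic_on_subset[OF h.G_holomorphic])
  thus ?thesis
    by (cases "i = 1") (auto simp: row_def[abs_def] intro!: holomorphic_intros)
qed

lemma row_meromorphic: "row i meromorphic_on UNIV"
  by (cases "i = 1") (auto simp: row_def[abs_def] intro!: meromorphic_intros f.G_meromorphic h.G_meromorphic)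

text \<open>The definition of \<open>model_M\<close> cuts the plane at multiples of Im \<tau>, while
  the jumps sit halfway between them. Antiperiodicity under 2\<tau> merges the two formulas
  adjoining such a cut into one formula on the whole strip.\<close>

lemma model_M_strip:
  assumes p: "p \<in> strip k"
  shows "ent (model_M n \<tau> D p) i j = row i (p - of_int k * \<tau> + off j)"
proof -
  have r: "(of_int k - 1/2) * Im \<tau> < Im p" "Im p < (of_int k + 1/2) * Im \<tau>"
    using p by (auto simp: strip_def)
  show ?thesis
  proof (cases "of_int k * Im \<tau> \<le> Im p")
    case True
    have "\<lfloor>Im p / Im \<tau>\<rfloor> = k"
      using True r Im_\<tau> by (intro floor_unique) (auto simp: field_simps)
    moreover have "Im (p - of_int k * \<tau>) < Im \<tau> / 2"
      using r by (simp add: algebra_simps)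
    ultimately have "model_M n \<tau> D p = model_C n \<tau> D ** mat22 (f.G (p - of_int k * \<tau>)) (f.G (p - of_int k * \<tau> + \<tau>))
        (h.G (p - of_int k * \<tau>)) (h.G (p - of_int k * \<tau> + \<tau>))"
      by (simp add: model_M_def Let_def model_f_eq model_h_eq)
    thus ?thesis
      using exhaust_2[of i] exhaust_2[of j] by (auto simp: model_C_eq ent_mult row_def off_def)
  next
    case False
    define q where "q = p - of_int k * \<tau>"
    \<comment> \<open>The lower half of strip k is the upper half of cell k - 1 in the definition of
      \<open>model_M\<close>, whose second formula is evaluated at q + \<tau>.\<close>
    have "\<lfloor>Im p / Im \<tau>\<rfloor> = k - 1"
      using False r Im_\<tau> by (intro floor_unique) (auto simp: field_simps)
    moreover have "p - of_int (k - 1) * \<tau> = q + \<tau>" by (simp add: q_def algebra_simps)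
    moreover have "\<not> Im (q + \<tau>) < Im \<tau> / 2"
      using r by (simp add: q_def algebra_simps)
    ultimately have "model_M n \<tau> D p = model_C n \<tau> D ** mat22 (- f.G (q + \<tau> + \<tau>)) (f.G (q + \<tau>))
        (- h.G (q + \<tau> + \<tau>)) (h.G (q + \<tau>))"
      unfolding model_M_def Let_def model_f_eq model_h_eq by simp
    moreover have "q + \<tau> + \<tau> = q + 2 * \<tau>" by simp
    ultimately have "model_M n \<tau> D p = model_C n \<tau> D ** mat22 (f.G q) (f.G (q + \<tau>)) (h.G q) (h.G (q + \<tau>))"
      by (simp only: f.G_plus_2tau h.G_plus_2tau minus_minus)
    thus ?thesis
      unfolding q_def[symmetric]
      using exhaust_2[of i] exhaust_2[of j] by (auto simp: model_C_eq ent_mult row_def off_def)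
  qed
qed

lemma shifted_not_pole: "p - of_int k * \<tau> + off j \<in> RHP_poles \<tau> D \<longleftrightarrow> p \<in> RHP_poles \<tau> D"
proof -
  have "p - of_int k * \<tau> \<in> RHP_poles \<tau> D \<longleftrightarrow> p \<in> RHP_poles \<tau> D"
    using RHP_poles_shift(3)[of p "- k"] by simp
  thus ?thesis
    using RHP_poles_shift(2)[of "p - of_int k * \<tau>"] by (simp add: off_def)
qed

lemma row_shift_holomorphic:
  "(\<lambda>p. row i (p - of_int k * \<tau> + off j)) holomorphic_on - RHP_poles \<tau> D"
  by (rule holomorphic_on_compose_into[OF row_holomorphic]) (auto simp: shifted_not_pole intro!: holomorphic_intros)

lemma th1_D_nonzero: "th1 D \<noteq> 0" "th1 (D + \<tau>) \<noteq> 0" "th1 (- of_real D) \<noteq> 0" "th1 (\<tau> - D) \<noteq> 0"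
  using D_notin_lat by (simp_all add: th1_zero_iff)

lemma num_f_0_nonzero: "num_f n 0 \<noteq> 0"
  using jtheta2_0_nonzero[OF t] jtheta3_0_nonzero[OF t] by (simp add: num_f_def)

lemma th1_deriv_0_nonzero: "deriv (\<lambda>p. th1 p) 0 \<noteq> 0" and th1_0: "th1 0 = 0"
proof -
  show "th1 0 = 0" using zero_in_lat by (simp add: th1_zero_iff)
  thus "deriv (\<lambda>p. th1 p) 0 \<noteq> 0" by (rule jtheta1_deriv_nonzero[OF t])
qed

lemma open_th1_nonzero: "open {p. th1 (p - x) \<noteq> 0}"
  by (intro open_Collect_neq holomorphic_on_imp_continuous_on continuous_on_const holomorphic_intros)

text \<open>C1 is the reciprocal of the residue of f at 0; the two signs from \<theta>1 being odd
  cancel.\<close>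

lemma f_residue: "(\<lambda>p. C1 * f.G p - 1 / p) \<in> O[at 0](\<lambda>_. 1)"
proof -
  define A where "A = (\<lambda>p. exp (- \<i> * pi * p) * th1 (p - D - \<tau>) * num_f n p / th1 (p - D))"
  have "th1 (- of_real D - \<tau>) = - th1 (D + \<tau>)" "th1 (- of_real D) = - th1 D"
    using jtheta1_uminus[OF t(1), of "D + \<tau>"] jtheta1_uminus[OF t(1), of D] by simp_all
  hence A0: "C1 * A 0 = deriv (\<lambda>p. th1 p) 0"
    using th1_D_nonzero num_f_0_nonzero by (simp add: A_def C1_def)
  have "(\<lambda>p. C1 * (A p / th1 p) - 1 / p) \<in> O[at 0](\<lambda>_. 1)"
  proof (rule simple_pole_bigo[where A = A and T = "\<lambda>p. th1 p" and c = C1, OF _ _ open_th1_nonzero[of "of_real D"]])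
    show "A holomorphic_on {p. th1 (p - of_real D) \<noteq> 0}"
      unfolding A_def by (intro holomorphic_intros) auto
  qed (use th1_D_nonzero A0 th1_0 th1_deriv_0_nonzero in \<open>auto intro!: holomorphic_intros\<close>)
  moreover have "A p / th1 p = f.G p" for p
    by (simp add: A_def f.G_def)
  ultimately show ?thesis by simp
qed

text \<open>Translation by \<tau> turns \<theta>4 into \<theta>1 and the numerator of h into that of
  f with a common exponential, which cancels. The phase in \<open>\<kappa>h\<close> absorbs the
  remaining factor \<i> and the e in \<theta>1(\<tau> - D) = e \<theta>1(D + \<tau>), so that only
  \<theta>1(D) / \<theta>1(D + \<tau>) and the values at 0 survive.\<close>

lemma h_residue: "(\<lambda>p. C2 * h.G (p + \<tau>) - 1 / p) \<in> O[at 0](\<lambda>_. 1)"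
proof -
  define A where "A = (\<lambda>p::complex. \<kappa>h * exp (- \<i> * pi * (p + \<tau>)) * th1 (p - D) * num_f n p / (\<i> * th1 (p - (D - \<tau>))))"
  define e where "e = exp (2 * \<i> * pi * D)"
  have e: "e \<noteq> 0" by (simp add: e_def)
  have k: "\<kappa>h * exp (- \<i> * pi * \<tau>) = - \<i> * e"
  proof -
    have "\<kappa>h * exp (- \<i> * pi * \<tau>) = e / exp (\<i> * pi / 2)"
      unfolding \<kappa>h_def e_def exp_add[symmetric] exp_diff[symmetric] by (rule arg_cong[of _ _ exp]) simp
    thus ?thesis by (simp add: exp_half_pi_ii)
  qed
  have "th1 (\<tau> - D) = e * th1 (D + \<tau>)"
  proof -
    have "th1 (D + \<tau>) = th1 ((D - \<tau>) + 2 * \<tau>)" by (simp add: algebra_simps)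
    also have "\<dots> = - exp (- \<i> * pi * (2 * \<tau>) - 2 * \<i> * pi * (D - \<tau>)) * th1 (- (\<tau> - D))"
      unfolding jtheta1_plus_t[OF t(1)] by simp
    also have "exp (- \<i> * pi * (2 * \<tau>) - 2 * \<i> * pi * (D - \<tau>)) = inverse e"
      unfolding e_def exp_minus[symmetric] by (rule arg_cong[of _ _ exp]) (simp add: algebra_simps)
    finally show ?thesis using e unfolding jtheta1_uminus[OF t(1)] by (simp add: field_simps)
  qed
  hence A0: "C2 * A 0 = deriv (\<lambda>p. th1 p) 0"
    using th1_D_nonzero num_f_0_nonzero k e jtheta1_uminus[OF t(1), of D]
    by (simp add: A_def C2_def)
  have "(\<lambda>p::complex. C2 * (A p / th1 p) - 1 / p) \<in> O[at 0](\<lambda>_. 1)"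
  proof (rule simple_pole_bigo[where A = A and T = "\<lambda>p. th1 p" and c = C2, OF _ _ open_th1_nonzero[of "D - \<tau>"]])
    show "A holomorphic_on {p. th1 (p - (of_real D - \<tau>)) \<noteq> 0}"
      unfolding A_def by (intro holomorphic_intros) auto
  qed (use th1_D_nonzero A0 th1_0 th1_deriv_0_nonzero in \<open>auto intro!: holomorphic_intros\<close>)
  moreover have "A p / th1 p = h.G (p + \<tau>)" for p :: complex
  proof -
    define x where "x = exp (- \<i> * pi * (2 * \<tau>) / 4 - \<i> * pi * p)"
    have e: "th4 (p + \<tau>) = \<i> * x * th1 p" "num_h n (p + \<tau>) = x * num_f n p"
      using jtheta4_plus_half_t[OF t(1), of p] jtheta3_plus_half_t[OF t(1), of p] jtheta2_plus_half_t[OF t(1), of p]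
      by (auto simp: x_def num_h_def num_f_def)
    have d: "p + \<tau> - D = p - (D - \<tau>)" "p - (D - \<tau>) - \<tau> = p - D" by simp_all
    have "x \<noteq> 0" by (simp add: x_def)
    thus ?thesis
      unfolding A_def h.G_def e d by (simp add: mult_ac)
  qed
  ultimately show ?thesis by simp
qed

lemma strip0_bigo:
  assumes "p0 \<in> strip 0"
    "(\<lambda>p. row i (p + off j) - g p) \<in> O[at p0](u)"
  shows "(\<lambda>p. ent (model_M n \<tau> D p) i j - g p) \<in> O[at p0](u)"
proof -
  have "\<forall>\<^sub>F p in at p0. ent (model_M n \<tau> D p) i j - g p = row i (p + off j) - g p"
    using eventually_in_strip[OF assms(1)] by eventually_elim (simp add: model_M_strip)
  from landau_o.big.in_cong[OF this] show ?thesis using assms(2) by simp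
qed

lemma G_tau_holomorphic:
  "(\<lambda>p. f.G (p + \<tau>)) holomorphic_on (\<lambda>p. p + \<tau>) -` (- poles2 \<tau> D 0)"
  "(\<lambda>p. h.G (p + \<tau>)) holomorphic_on (\<lambda>p. p + \<tau>) -` (- poles2 \<tau> D \<tau>)"
  "open ((\<lambda>p. p + \<tau>) -` (- poles2 \<tau> D 0))" "open ((\<lambda>p. p + \<tau>) -` (- poles2 \<tau> D \<tau>))"
  by (rule holomorphic_on_compose_into[OF f.G_holomorphic] holomorphic_on_compose_into[OF h.G_holomorphic];
      auto intro!: holomorphic_intros)+
    (auto intro!: open_vimage f.open_compl_poles2 h.open_compl_poles2 continuous_intros)

theorem model_M_solution: "model_RHP_solution n \<tau> D (model_M n \<tau> D)"
  unfolding model_RHP_solution_def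
proof (intro conjI allI ballI impI)
  let ?M = "model_M n \<tau> D"
  fix i j :: 2
  show "(\<lambda>p. ent (?M p) i j) meromorphic_on RHP_domain \<tau>"
    unfolding RHP_domain_eq
  proof (rule meromorphic_on_Union, safe)
    fix k
    have "(\<lambda>p. row i (p - of_int k * \<tau> + off j)) meromorphic_on strip k"
      by (rule meromorphic_on_compose[OF row_meromorphic]) (auto intro!: analytic_intros)
    also have "?this \<longleftrightarrow> (\<lambda>p. ent (?M p) i j) meromorphic_on strip k"
    proof (rule meromorphic_on_cong)
      fix p assume "p \<in> strip k"
      from eventually_in_strip[OF this]
      show "\<forall>\<^sub>F w in at p. row i (w - of_int k * \<tau> + off j) = ent (?M w) i j"
        by eventually_elim (simp add: model_M_strip)
    qed auto
    finally show "(\<lambda>p. ent (?M p) i j) meromorphic_on strip k" .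
  qed
  have "(\<lambda>p. ent (?M p) i j) holomorphic_on (\<Union>k\<in>UNIV. strip k - RHP_poles \<tau> D)"
  proof (rule holomorphic_on_UN_open)
    fix k
    show "open (strip k - RHP_poles \<tau> D)"
      using open_Int[OF open_strip open_compl_poles] by (simp add: Diff_eq)
    have "(\<lambda>p. row i (p - of_int k * \<tau> + off j)) holomorphic_on strip k - RHP_poles \<tau> D"
      by (rule holomorphic_on_subset[OF row_shift_holomorphic]) auto
    also have "?this \<longleftrightarrow> (\<lambda>p. ent (?M p) i j) holomorphic_on strip k - RHP_poles \<tau> D"
      by (rule holomorphic_cong) (auto simp: model_M_strip)
    finally show "(\<lambda>p. ent (?M p) i j) holomorphic_on strip k - RHP_poles \<tau> D" .
  qed
  also have "(\<Union>k\<in>UNIV. strip k - RHP_poles \<tau> D) = RHP_domain \<tau> - RHP_poles \<tau> D"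
    unfolding RHP_domain_eq by auto
  finally show "(\<lambda>p. ent (?M p) i j) holomorphic_on RHP_domain \<tau> - RHP_poles \<tau> D" .
next
  let ?M = "model_M n \<tau> D"
  fix p assume "p \<in> RHP_domain \<tau> - RHP_poles \<tau> D"
  then obtain k where k: "p \<in> strip k" by (auto simp: RHP_domain_eq)
  hence k1: "p + 1 \<in> strip k" and kt: "p + \<tau> \<in> strip (k + 1)"
    by (simp_all add: strip_plus_1 strip_plus_tau)
  have "ent (?M (p + 1)) i j = ent ((-1) ^ (n - 1) *\<^sub>R ?M p) i j" for i j
    using row_plus_1[of i "p - of_int k * \<tau> + off j"]
    unfolding ent_scaleR model_M_strip[OF k] model_M_strip[OF k1] by (simp add: algebra_simps)
  thus "?M (p + 1) = (-1) ^ (n - 1) *\<^sub>R ?M p" by (simp add: mat_eq_iff_ent)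
  have "ent (?M (p + \<tau>)) i j = ent (?M p) i j" for i j
    unfolding model_M_strip[OF k] model_M_strip[OF kt] by (simp add: algebra_simps)
  thus "?M (p + \<tau>) = ?M p" by (simp add: mat_eq_iff_ent)
next
  let ?M = "model_M n \<tau> D"
  note z = zero_in_strip and d = D_in_strip
  show "(\<lambda>p. ent (?M p) 1 1 - 1 / p) \<in> O[at 0](\<lambda>_. 1)"
    by (rule strip0_bigo[OF z]) (use f_residue in \<open>simp add: row_def off_def\<close>)
  show "(\<lambda>p. ent (?M p) 2 2 - 1 / p) \<in> O[at 0](\<lambda>_. 1)"
    by (rule strip0_bigo[OF z]) (use h_residue in \<open>simp add: row_def off_def\<close>)
  \<comment> \<open>The off-diagonal entries are bounded at 0 because f is regular at \<tau> and h
    at 0.\<close>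
  have "isCont (\<lambda>p. f.G (p + \<tau>)) 0"
    by (rule holomorphic_imp_isCont[OF G_tau_holomorphic(1,3)])
       (use tau_notin_lat D_notin_lat in \<open>auto simp: f.poles2_iff\<close>)
  hence "(\<lambda>p. C1 * f.G (p + \<tau>)) \<in> O[at 0](\<lambda>_. 1)"
    by (intro isCont_imp_bigo_1 continuous_intros)
  thus "(\<lambda>p. ent (?M p) 1 2) \<in> O[at 0](\<lambda>_. 1)"
    using strip0_bigo[OF z, of 1 2 "\<lambda>_. 0"] by (simp add: row_def off_def)
  have "isCont h.G 0"
    by (rule holomorphic_imp_isCont[OF h.G_holomorphic h.open_compl_poles2])
       (use tau_notin_lat lat_uminus[of "- \<tau>"] D_notin_lat in \<open>auto simp: h.poles2_iff\<close>)
  hence "(\<lambda>p. C2 * h.G p) \<in> O[at 0](\<lambda>_. 1)"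
    by (intro isCont_imp_bigo_1 continuous_intros)
  thus "(\<lambda>p. ent (?M p) 2 1) \<in> O[at 0](\<lambda>_. 1)"
    using strip0_bigo[OF z, of 2 1 "\<lambda>_. 0"] by (simp add: row_def off_def)
  fix i :: 2
  have "row i \<in> O[at (of_real D)](\<lambda>p. 1 / (p - of_real D))"
    using f.G_bigo_pole[of "of_real D"] h.G_bigo_pole[of "of_real D"] zero_in_lat
    by (cases "i = 1") (auto simp: row_def[abs_def])
  thus "(\<lambda>p. ent (?M p) i 1) \<in> O[at (of_real D)](\<lambda>p. 1 / (p - of_real D))"
    using strip0_bigo[OF d, of i 1 "\<lambda>_. 0"] by (simp add: off_def)
  have "(\<lambda>p. f.G (p + \<tau>)) \<in> O[at (of_real D)](\<lambda>p. p - of_real D)"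
    by (rule bigo_at_zero[OF G_tau_holomorphic(1,3)])
       (use tau_notin_lat D_notin_lat zero_in_lat in \<open>auto simp: f.poles2_iff f.G_zero\<close>)
  moreover have "(\<lambda>p. h.G (p + \<tau>)) \<in> O[at (of_real D)](\<lambda>p. p - of_real D)"
    by (rule bigo_at_zero[OF G_tau_holomorphic(2,4)])
       (use tau_notin_lat D_notin_lat zero_in_lat in \<open>auto simp: h.poles2_iff h.G_zero\<close>)
  ultimately have "(\<lambda>p. row i (p + \<tau>)) \<in> O[at (of_real D)](\<lambda>p. p - of_real D)"
    by (cases "i = 1") (auto simp: row_def[abs_def])
  thus "(\<lambda>p. ent (?M p) i 2) \<in> O[at (of_real D)](\<lambda>p. p - of_real D)"
    using strip0_bigo[OF d, of i 2 "\<lambda>_. 0"] by (simp add: off_def)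
next
  let ?M = "model_M n \<tau> D"
  fix x assume "\<exists>k::int. Im x = (of_int k + 1/2) * Im \<tau>"
  then obtain k :: int where k: "Im x = (of_int k + 1/2) * Im \<tau>" by blast
  note k0 = k
  \<comment> \<open>L k is the value at x of the formula valid on strip k, which extends
    continuously across its boundary lines because these carry no poles.\<close>
  define L where "L = (\<lambda>k. mat22 (row 1 (x - of_int k * \<tau>)) (row 1 (x - of_int k * \<tau> + \<tau>))
                              (row 2 (x - of_int k * \<tau>)) (row 2 (x - of_int k * \<tau> + \<tau>)))"
  have L: "ent (L k) i j = row i (x - of_int k * \<tau> + off j)" for i j k
    using exhaust_2[of i] exhaust_2[of j] by (auto simp: L_def off_def)
  have lim: "((\<lambda>p. row i (p - of_int k * \<tau> + off j)) \<longlongrightarrow> ent (L k) i j) (at x within A)" for i j k A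
  proof -
    have "isCont (\<lambda>p. row i (p - of_int k * \<tau> + off j)) x"
      by (rule holomorphic_imp_isCont[OF row_shift_holomorphic open_compl_poles])
         (use half_line_not_pole[OF k0] in simp)
    thus ?thesis unfolding L isCont_def by (rule Lim_at_imp_Lim_at_within)
  qed
  have "(?M \<longlongrightarrow> L (k + 1)) (at x within {p. Im p > Im x})"
  proof (rule tendsto_entI)
    fix i j
    show "((\<lambda>p. ent (?M p) i j) \<longlongrightarrow> ent (L (k + 1)) i j) (at x within {p. Im p > Im x})"
      by (rule Lim_transform_eventually[OF lim])
         (use eventually_in_strip_above[OF k] in eventually_elim, simp add: model_M_strip)
  qed
  moreover have "(?M \<longlongrightarrow> L k) (at x within {p. Im p < Im x})"
  proof (rule tendsto_entI)
    fix i j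
    show "((\<lambda>p. ent (?M p) i j) \<longlongrightarrow> ent (L k) i j) (at x within {p. Im p < Im x})"
      by (rule Lim_transform_eventually[OF lim])
         (use eventually_in_strip_below[OF k] in eventually_elim, simp add: model_M_strip)
  qed
  \<comment> \<open>Passing from strip k to strip k + 1 translates the argument by - \<tau>: the old
    first column becomes the second, and the new first column is minus the old second one by
    antiperiodicity.\<close>
  moreover have "L (k + 1) = L k ** jumpJ"
  proof -
    have r: "row i (x - of_int k * \<tau> + \<tau>) = - row i (x - of_int (k + 1) * \<tau>)" for i
      using row_plus_2tau[of i "x - of_int (k + 1) * \<tau>"] by (simp add: algebra_simps)
    have x: "x - of_int (k + 1) * \<tau> + \<tau> = x - of_int k * \<tau>" by (simp add: algebra_simps)
    show ?thesis
      unfolding L_def mat_eq_iff_ent forall_2 ent_mult jumpJ_def ent_mat22 r x by simp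
  qed
  ultimately show "\<exists>Mplus Mminus. (?M \<longlongrightarrow> Mplus) (at x within {p. Im p > Im x}) \<and>
      (?M \<longlongrightarrow> Mminus) (at x within {p. Im p < Im x}) \<and> Mplus = Mminus ** jumpJ"
    by blast
qed

end

subsection \<open>Uniqueness\<close>

lemma at_within_Im_less_nontrivial: "at x within {q. Im q < Im x} \<noteq> bot"
  unfolding trivial_limit_within[symmetric]
proof (simp add: trivial_limit_within islimpt_approachable, intro allI impI)
  fix e :: real assume "e > 0"
  thus "\<exists>y. Im y < Im x \<and> y \<noteq> x \<and> dist y x < e"
    by (intro exI[of _ "x - \<i> * of_real (e / 2)"]) (auto simp: dist_norm norm_mult complex_eq_iff)
qed

lemma inverse_not_bigo_1: "(\<lambda>p::complex. 1 / p) \<notin> O[at 0](\<lambda>_. 1)"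
proof
  assume "(\<lambda>p::complex. 1 / p) \<in> O[at 0](\<lambda>_. 1)"
  then obtain C where "C > 0" and C: "\<forall>\<^sub>F p in at (0::complex). norm (1 / p) \<le> C * norm (1::complex)"
    by (rule landau_o.bigE)
  from C obtain d where d: "d > 0" "\<And>p::complex. p \<noteq> 0 \<Longrightarrow> dist p 0 < d \<Longrightarrow> norm (1 / p) \<le> C"
    unfolding eventually_at by auto
  define r where "r = min (d / 2) (1 / (2 * C))"
  have r: "r > 0" "r < d" "r \<le> 1 / (2 * C)" using d \<open>C > 0\<close> by (auto simp: r_def)
  have "norm (1 / complex_of_real r) \<le> C" using r by (intro d) auto
  hence "1 / r \<le> C" using r by (simp add: norm_divide)
  moreover have "2 * C \<le> 1 / r" using r \<open>C > 0\<close> by (simp add: field_simps)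
  ultimately show False using \<open>C > 0\<close> by linarith
qed

text \<open>If c and c' differed, subtraction would make g bounded near 0, and then 1 / p as
  well.\<close>

lemma residue_normalization_unique:
  fixes g :: "complex \<Rightarrow> complex"
  assumes "(\<lambda>p. c * g p - 1 / p) \<in> O[at 0](\<lambda>_. 1)" "(\<lambda>p. c' * g p - 1 / p) \<in> O[at 0](\<lambda>_. 1)"
  shows "c = c'"
proof (rule ccontr)
  assume ne: "c \<noteq> c'"
  have "(\<lambda>p. (c * g p - 1 / p) - (c' * g p - 1 / p)) \<in> O[at 0](\<lambda>_. 1)"
    by (rule sum_in_bigo[OF assms])
  hence "(\<lambda>p. (c - c') * g p) \<in> O[at 0](\<lambda>_. 1)" by (simp add: algebra_simps)
  hence "g \<in> O[at 0](\<lambda>_. 1)" using ne by simp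
  hence "(\<lambda>p. c * g p) \<in> O[at 0](\<lambda>_. 1)" by simp
  hence "(\<lambda>p. c * g p - (c * g p - 1 / p)) \<in> O[at 0](\<lambda>_. 1)"
    using assms(1) by (rule sum_in_bigo)
  thus False using inverse_not_bigo_1 by simp
qed

context model_problem
begin

lemma strip_plus_int_tau: "p + of_int b * \<tau> \<in> strip (k + b) \<longleftrightarrow> p \<in> strip k"
proof -
  have "(of_int (k + b) - 1/2) * Im \<tau> = (of_int k - 1/2) * Im \<tau> + of_int b * Im \<tau>"
    "(of_int (k + b) + 1/2) * Im \<tau> = (of_int k + 1/2) * Im \<tau> + of_int b * Im \<tau>"
    by (simp_all add: algebra_simps)
  thus ?thesis unfolding strip_def by simp
qed

lemma strip_index_unique:
  assumes "p \<in> strip k" "p \<in> strip m"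
  shows "k = m"
proof -
  have "(of_int k - 1/2) * Im \<tau> < (of_int m + 1/2) * Im \<tau>" "(of_int m - 1/2) * Im \<tau> < (of_int k + 1/2) * Im \<tau>"
    using assms by (auto simp: strip_def)
  hence "real_of_int k - 1/2 < of_int m + 1/2" "real_of_int m - 1/2 < of_int k + 1/2"
    using Im_\<tau> by simp_all
  thus ?thesis by linarith
qed

definition col :: "int \<Rightarrow> 2" where "col k = (if even k then 1 else 2)"

text \<open>The signs are +, +, -, - for k = 0, 1, 2, 3. Crossing two lines multiplies by the square
  of the jump matrix, which is minus the identity.\<close>

definition sgn_strip :: "int \<Rightarrow> complex" where
  "sgn_strip k = (if even (k div 2) then 1 else - 1)"

definition stripidx :: "complex \<Rightarrow> int" where
  "stripidx p = (THE k. p \<in> strip k)"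

lemma stripidx_eq: "p \<in> strip k \<Longrightarrow> stripidx p = k"
  unfolding stripidx_def using strip_index_unique by blast

text \<open>Across each line the jump matrix exchanges the two columns of a row up to sign, so the
  entries, taken alternately from the first and the second column, continue one another with
  signs of period four in the strip index.\<close>
definition glue_off :: "(complex \<Rightarrow> complex^2^2) \<Rightarrow> 2 \<Rightarrow> complex \<Rightarrow> complex" where
  "glue_off M i p = sgn_strip (stripidx p) * ent (M p) i (col (stripidx p))"

text \<open>On a jump line the values of M are arbitrary, so the value there is the common one-sided
  limit that \<open>line_limits\<close> provides for a solution.\<close>

definition glue :: "(complex \<Rightarrow> complex^2^2) \<Rightarrow> 2 \<Rightarrow> complex \<Rightarrow> complex" where
  "glue M i p = (if p \<in> RHP_domain \<tau> then glue_off M i p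
     else (SOME l. (glue_off M i \<longlongrightarrow> l) (at p within {q. Im q > Im p}) \<and>
                   (glue_off M i \<longlongrightarrow> l) (at p within {q. Im q < Im p})))"

lemma glue_off_strip: "p \<in> strip k \<Longrightarrow> glue_off M i p = sgn_strip k * ent (M p) i (col k)"
  by (simp add: glue_off_def stripidx_eq)

lemma glue_strip: "p \<in> strip k \<Longrightarrow> glue M i p = sgn_strip k * ent (M p) i (col k)"
  by (auto simp: glue_def glue_off_strip RHP_domain_eq)

lemma norm_sgn_strip [simp]: "norm (sgn_strip k) = 1"
  by (simp add: sgn_strip_def)

end

section \<open>Gluing the strips of a given solution into one function\<close>

locale model_solution = model_problem_n +
  fixes M :: "complex \<Rightarrow> complex^2^2"
  assumes M: "model_RHP_solution n \<tau> D M"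
begin

lemma M_hol: "(\<lambda>p. ent (M p) i j) holomorphic_on RHP_domain \<tau> - RHP_poles \<tau> D"
  using M by (simp add: model_RHP_solution_def)

lemma M_per:
  assumes "p \<in> strip k" "p \<notin> RHP_poles \<tau> D"
  shows "M (p + 1) = ((-1::real) ^ (n - 1)) *\<^sub>R M p" "M (p + \<tau>) = M p"
proof -
  have "p \<in> RHP_domain \<tau> - RHP_poles \<tau> D" using assms by (auto simp: RHP_domain_eq)
  thus "M (p + 1) = ((-1::real) ^ (n - 1)) *\<^sub>R M p" "M (p + \<tau>) = M p"
    using M by (auto simp: model_RHP_solution_def)
qed

lemma M_per_int_tau:
  assumes "p \<in> strip k" "p \<notin> RHP_poles \<tau> D"
  shows "M (p + of_int b * \<tau>) = M p"
proof (induction b rule: int_induct[of _ 0])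
  case (step1 b)
  have "p + of_int b * \<tau> \<in> strip (k + b)" "p + of_int b * \<tau> \<notin> RHP_poles \<tau> D"
    using assms by (simp_all add: strip_plus_int_tau RHP_poles_shift)
  from M_per(2)[OF this] step1 show ?case by (simp add: algebra_simps)
next
  case (step2 b)
  have "p + of_int (b - 1) * \<tau> \<in> strip (k + (b - 1))" "p + of_int (b - 1) * \<tau> \<notin> RHP_poles \<tau> D"
    using assms by (simp_all only: strip_plus_int_tau RHP_poles_shift not_False_eq_True)
  from M_per(2)[OF this] step2 show ?case by (simp add: algebra_simps)
qed simp

text \<open>The sign under integer translations is invisible to growth estimates, so moduli are
  enough to transport conditions (2) and (3).\<close>

lemma M_per_int_norm:
  assumes "p \<in> strip k" "p \<notin> RHP_poles \<tau> D"
  shows "norm (ent (M (p + of_int a)) i j) = norm (ent (M p) i j)"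
proof -
  have *: "p + of_int a \<in> strip k \<and> p + of_int a \<notin> RHP_poles \<tau> D" for a
  proof (induction a rule: int_induct[of _ 0])
    case (step1 a)
    thus ?case using strip_plus_1[of "p + of_int a" k] RHP_poles_shift(1)[of "p + of_int a"]
      by (simp add: algebra_simps)
  next
    case (step2 a)
    thus ?case using strip_plus_1[of "p + of_int (a - 1)" k] RHP_poles_shift(1)[of "p + of_int (a - 1)"]
      by (simp add: algebra_simps)
  qed (use assms in auto)
  have step: "norm (ent (M (p + of_int (a + 1))) i j) = norm (ent (M (p + of_int a)) i j)" for a
    using M_per(1)[of "p + of_int a" k] *[of a]
    by (simp add: add.assoc[symmetric] ent_scaleR norm_mult norm_power)
  show ?thesis
  proof (induction a rule: int_induct[of _ 0])
    case (step1 a) thus ?case using step[of a] by simp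
  next
    case (step2 a) thus ?case using step[of "a - 1"] by simp
  qed simp
qed

lemma line_limits:
  assumes x: "Im x = (of_int k + 1/2) * Im \<tau>"
  obtains l where "(glue_off M i \<longlongrightarrow> l) (at x within {q. Im q > Im x})"
    "(glue_off M i \<longlongrightarrow> l) (at x within {q. Im q < Im x})"
proof -
  obtain Mp Mm where lim: "(M \<longlongrightarrow> Mp) (at x within {p. Im p > Im x})"
      "(M \<longlongrightarrow> Mm) (at x within {p. Im p < Im x})" and J: "Mp = Mm ** jumpJ"
    using M x unfolding model_RHP_solution_def by blast
  have "((\<lambda>p. sgn_strip k * ent (M p) i (col k)) \<longlongrightarrow> sgn_strip k * ent Mm i (col k)) (at x within {q. Im q < Im x})"
    by (intro tendsto_intros tendsto_ent lim)
  moreover have "\<forall>\<^sub>F p in at x within {q. Im q < Im x}. sgn_strip k * ent (M p) i (col k) = glue_off M i p"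
    using eventually_in_strip_below[OF x] by eventually_elim (simp add: glue_off_strip)
  ultimately have 1: "(glue_off M i \<longlongrightarrow> sgn_strip k * ent Mm i (col k)) (at x within {q. Im q < Im x})"
    by (rule Lim_transform_eventually)
  have "((\<lambda>p. sgn_strip (k + 1) * ent (M p) i (col (k + 1))) \<longlongrightarrow> sgn_strip (k + 1) * ent Mp i (col (k + 1)))
          (at x within {q. Im q > Im x})"
    by (intro tendsto_intros tendsto_ent lim)
  moreover have "\<forall>\<^sub>F p in at x within {q. Im q > Im x}. sgn_strip (k + 1) * ent (M p) i (col (k + 1)) = glue_off M i p"
    using eventually_in_strip_above[OF x] by eventually_elim (simp add: glue_off_strip)
  ultimately have "(glue_off M i \<longlongrightarrow> sgn_strip (k + 1) * ent Mp i (col (k + 1))) (at x within {q. Im q > Im x})"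
    by (rule Lim_transform_eventually)
  moreover have "sgn_strip (k + 1) * ent Mp i (col (k + 1)) = sgn_strip k * ent Mm i (col k)"
  \<comment> \<open>For even k the second column above the line equals the first below it. For odd k
    the first column above is minus the second below, and the change of \<open>sgn_strip\<close>
    compensates this.\<close>
  proof (cases "even k")
    case True
    hence "(k + 1) div 2 = k div 2" by presburger
    thus ?thesis using True by (simp add: sgn_strip_def col_def J ent_mult jumpJ_def)
  next
    case False
    hence "(k + 1) div 2 = k div 2 + 1" by presburger
    thus ?thesis using False by (simp add: sgn_strip_def col_def J ent_mult jumpJ_def)
  qed
  ultimately show ?thesis using that 1 by simp
qed

lemma glue_line_limit:
  assumes x: "Im x = (of_int k + 1/2) * Im \<tau>"
  shows "(glue_off M i \<longlongrightarrow> glue M i x) (at x within {q. Im q \<noteq> Im x})"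
proof -
  have "x \<notin> RHP_domain \<tau>" using x by (auto simp: RHP_domain_def)
  hence g: "glue M i x = (SOME l. (glue_off M i \<longlongrightarrow> l) (at x within {q. Im q > Im x}) \<and>
                   (glue_off M i \<longlongrightarrow> l) (at x within {q. Im q < Im x}))"
    by (simp add: glue_def)
  have "(glue_off M i \<longlongrightarrow> glue M i x) (at x within {q. Im q > Im x}) \<and>
        (glue_off M i \<longlongrightarrow> glue M i x) (at x within {q. Im q < Im x})"
    unfolding g by (rule someI_ex) (use line_limits[OF x, of i] in blast)
  hence "(glue_off M i \<longlongrightarrow> glue M i x) (at x within ({q. Im q > Im x} \<union> {q. Im q < Im x}))"
    by (intro Lim_Un) auto
  also have "{q. Im q > Im x} \<union> {q. Im q < Im x} = {q. Im q \<noteq> Im x}" by auto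
  finally show ?thesis .
qed

text \<open>Two neighbouring strips together with the line between them. The bands are open and
  cover the plane, so holomorphy can be checked across one line at a time.\<close>

definition band :: "int \<Rightarrow> complex set" where
  "band k = {p. (of_int k - 1/2) * Im \<tau> < Im p} \<inter> {p. Im p < (of_int k + 3/2) * Im \<tau>}"

lemma open_band: "open (band k)"
  unfolding band_def by (intro open_Int open_halfspace_Im_gt open_halfspace_Im_lt)

lemma band_cases:
  assumes "p \<in> band k"
  shows "p \<in> strip k \<and> Im p < (of_int k + 1/2) * Im \<tau> \<or> Im p = (of_int k + 1/2) * Im \<tau> \<or>
         p \<in> strip (k + 1) \<and> Im p > (of_int k + 1/2) * Im \<tau>"
proof -
  have e: "(of_int (k + 1) - 1/2) * Im \<tau> = (of_int k + 1/2) * Im \<tau>" "(of_int (k + 1) + 1/2) * Im \<tau> = (of_int k + 3/2) * Im \<tau>"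
    by (simp_all add: algebra_simps)
  show ?thesis using assms unfolding band_def strip_def e by auto
qed

lemma glue_hol_strip: "glue M i holomorphic_on strip k - RHP_poles \<tau> D"
proof -
  have "(\<lambda>p. sgn_strip k * ent (M p) i (col k)) holomorphic_on strip k - RHP_poles \<tau> D"
    by (intro holomorphic_intros holomorphic_on_subset[OF M_hol]) (auto simp: RHP_domain_eq)
  also have "?this \<longleftrightarrow> glue M i holomorphic_on strip k - RHP_poles \<tau> D"
    by (rule holomorphic_cong) (auto simp: glue_strip)
  finally show ?thesis .
qed

lemma open_strip_minus_poles: "open (strip k - RHP_poles \<tau> D)"
  using open_Int[OF open_strip open_compl_poles] by (simp add: Diff_eq)

lemma glue_isCont_line:
  assumes x: "Im x = (of_int k + 1/2) * Im \<tau>"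
  shows "isCont (glue M i) x"
  unfolding isCont_def
proof (rule tendstoI)
  fix e :: real assume e: "e > 0"
  have "\<forall>\<^sub>F q in at x within {q. Im q \<noteq> Im x}. dist (glue_off M i q) (glue M i x) < e / 2"
    using glue_line_limit[OF x] e by (intro tendstoD) auto
  then obtain d where d: "d > 0"
     "\<And>q. Im q \<noteq> Im x \<Longrightarrow> dist q x < d \<Longrightarrow> dist (glue_off M i q) (glue M i x) < e / 2"
    unfolding eventually_at by force
  have "\<forall>\<^sub>F q in at x. q \<in> ball x d \<inter> band k"
    using d(1) x Im_\<tau> by (intro eventually_at_in_open' open_Int open_band) (auto simp: band_def)
  thus "\<forall>\<^sub>F q in at x. dist (glue M i q) (glue M i x) < e"
  proof eventually_elim
    case (elim q)
    hence q: "dist q x < d" "q \<in> band k" by (auto simp: dist_commute)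
    show ?case
    proof (cases "Im q = Im x")
      case False
      hence "q \<in> RHP_domain \<tau>" using band_cases[OF q(2)] x by (auto simp: RHP_domain_eq)
      hence "glue M i q = glue_off M i q" by (simp add: glue_def)
      thus ?thesis using d(2)[OF False q(1)] e by simp
    next
      case True
      \<comment> \<open>Here q is itself on the line, where \<open>glue\<close> is only a limit of
        nearby values; the bound e / 2 survives the passage to the limit from below.\<close>
      have lim: "(glue_off M i \<longlongrightarrow> glue M i q) (at q within {r. Im r < Im q})"
        by (rule tendsto_within_subset[OF glue_line_limit]) (use True x in auto)
      have "\<forall>\<^sub>F r in at q within {r. Im r < Im q}. dist (glue M i x) (glue_off M i r) \<le> e / 2"
      proof -
        have "\<forall>\<^sub>F r in at q within {r. Im r < Im q}. r \<in> ball x d \<and> Im r < Im q"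
          unfolding eventually_at_topological
          by (rule exI[of _ "ball x d"]) (use q in \<open>auto simp: dist_commute\<close>)
        thus ?thesis
          by eventually_elim (use d(2) True in \<open>auto simp: dist_commute less_imp_le\<close>)
      qed
      hence "dist (glue M i x) (glue M i q) \<le> e / 2"
        using Lim_dist_ubound[OF at_within_Im_less_nontrivial lim] by blast
      thus ?thesis using e by (simp add: dist_commute)
    qed
  qed
qed

lemma glue_hol_band: "glue M i holomorphic_on band k - RHP_poles \<tau> D"
proof (rule holomorphic_on_paste_across_line[where d = \<i> and k = "(of_int k + 1/2) * Im \<tau>"])
  have ii: "\<i> \<bullet> z = Im z" for z by (simp add: inner_complex_def)
  show "open (band k - RHP_poles \<tau> D)"
    using open_Int[OF open_band open_compl_poles] by (simp add: Diff_eq)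
  show "glue M i holomorphic_on (band k - RHP_poles \<tau> D) \<inter> {z. \<i> \<bullet> z < (of_int k + 1/2) * Im \<tau>}"
    by (rule holomorphic_on_subset[OF glue_hol_strip[of i k]]) (use band_cases in \<open>fastforce simp: ii\<close>)
  show "glue M i holomorphic_on (band k - RHP_poles \<tau> D) \<inter> {z. (of_int k + 1/2) * Im \<tau> < \<i> \<bullet> z}"
    by (rule holomorphic_on_subset[OF glue_hol_strip[of i "k + 1"]]) (use band_cases in \<open>fastforce simp: ii\<close>)
  show "continuous_on (band k - RHP_poles \<tau> D) (glue M i)"
  proof (intro continuous_at_imp_continuous_on ballI)
    fix p assume p: "p \<in> band k - RHP_poles \<tau> D"
    hence "p \<in> strip k \<or> Im p = (of_int k + 1/2) * Im \<tau> \<or> p \<in> strip (k + 1)"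
      using band_cases by blast
    thus "isCont (glue M i) p"
      using p glue_isCont_line holomorphic_imp_isCont[OF glue_hol_strip open_strip_minus_poles] by auto
  qed
qed auto

lemma glue_hol: "glue M i holomorphic_on - RHP_poles \<tau> D"
proof -
  have "glue M i holomorphic_on (\<Union>k\<in>UNIV. band k - RHP_poles \<tau> D)"
    using open_Int[OF open_band open_compl_poles]
    by (intro holomorphic_on_UN_open glue_hol_band) (simp add: Diff_eq)
  also have "(\<Union>k\<in>UNIV. band k - RHP_poles \<tau> D) = - RHP_poles \<tau> D"
  proof -
    have "\<exists>k. p \<in> band k" for p
    proof -
      define k where "k = \<lfloor>Im p / Im \<tau>\<rfloor>"
      have "of_int k \<le> Im p / Im \<tau>" "Im p / Im \<tau> < of_int k + 1" unfolding k_def by linarith+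
      hence "of_int k * Im \<tau> \<le> Im p" "Im p < (of_int k + 1) * Im \<tau>" using Im_\<tau> by (simp_all add: field_simps)
      hence "p \<in> band k" using Im_\<tau> by (simp add: band_def algebra_simps)
      thus ?thesis by blast
    qed
    thus ?thesis by blast
  qed
  finally show ?thesis .
qed

text \<open>The conditions on M are imposed only at 0 and D. Periodicity carries them to every
  translate, and in strip m the glued function reads column \<open>col m\<close>; the bound v is
  translated along from x to s.\<close>

lemma glue_bigo:
  assumes x: "x \<in> strip 0" and M: "(\<lambda>p. ent (M p) i (col m)) \<in> O[at x](v)"
    and s: "s = x + of_int a + of_int m * \<tau>"
  shows "glue M i \<in> O[at s](\<lambda>p. v (p - s + x))"
proof -
  obtain c where "c > 0" and c: "\<forall>\<^sub>F p in at x. norm (ent (M p) i (col m)) \<le> c * norm (v p)"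
    using M by (rule landau_o.bigE)
  have "\<forall>\<^sub>F p in at x. norm (glue M i (p + (s - x))) \<le> c * norm (v p)"
    using c eventually_in_strip[OF x] eventually_not_pole
  proof eventually_elim
    case (elim p)
    have p': "p + of_int m * \<tau> \<in> strip m" "p + of_int m * \<tau> \<notin> RHP_poles \<tau> D"
      using elim strip_plus_int_tau[of p m 0] RHP_poles_shift(3)[of p m] by auto
    have eq: "p + (s - x) = p + of_int m * \<tau> + of_int a" by (simp add: s)
    have "p + (s - x) \<in> strip m" using p' unfolding eq strip_def by simp
    hence "norm (glue M i (p + (s - x))) = norm (ent (M (p + (s - x))) i (col m))"
      by (simp add: glue_strip norm_mult)
    also have "\<dots> = norm (ent (M p) i (col m))"
      unfolding eq M_per_int_norm[OF p'] using M_per_int_tau[of p 0] elim by simp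
    finally show ?case using elim by simp
  qed
  hence "\<forall>\<^sub>F p in filtermap (\<lambda>p. p - (x - s)) (at x). norm (glue M i p) \<le> c * norm (v (p - s + x))"
    unfolding eventually_filtermap by (simp add: algebra_simps)
  hence "\<forall>\<^sub>F p in at s. norm (glue M i p) \<le> c * norm (v (p - s + x))"
    unfolding filtermap_at_shift by simp
  thus ?thesis by (rule bigoI)
qed

lemma col_simps [simp]: "col (2 * l) = 1" "col (2 * l + 1) = 2" "col 0 = 1" "col 1 = 2" "col 2 = 1"
  by (simp_all add: col_def)

lemma sgn_strip_simps [simp]: "sgn_strip 0 = 1" "sgn_strip 1 = 1" "sgn_strip 2 = - 1"
  by (simp_all add: sgn_strip_def)

lemma glue_per:
  assumes "0 < Im p" "Im p < Im \<tau> / 2"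
  shows "glue M i (p + 1) = (-1) ^ (n - 1) * glue M i p" "glue M i (p + 2 * \<tau>) = - glue M i p"
proof -
  have np: "p \<notin> RHP_poles \<tau> D" by (rule strip_not_pole[OF assms])
  have p: "p \<in> strip 0" using assms Im_\<tau> by (simp add: strip_def)
  hence p1: "p + 1 \<in> strip 0" by (simp add: strip_plus_1)
  have p2: "p + of_int 2 * \<tau> \<in> strip (0 + 2)" using p by (simp only: strip_plus_int_tau)
  show "glue M i (p + 1) = (-1) ^ (n - 1) * glue M i p"
    unfolding glue_strip[OF p] glue_strip[OF p1] M_per(1)[OF p np] ent_scaleR by simp
  show "glue M i (p + 2 * \<tau>) = - glue M i p"
    using glue_strip[OF p2, of M i] M_per_int_tau[OF p np, of 2] by (simp add: glue_strip[OF p])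
qed

lemma lat_cases:
  assumes "s - x \<in> lat"
  obtains a l :: int where "s = x + of_int a + of_int (2 * l) * \<tau>"
proof -
  obtain a l :: int where "s - x = of_int a + 2 * of_int l * \<tau>"
    using assms by (auto simp: lat_def)
  hence "s = x + of_int a + of_int (2 * l) * \<tau>" by (simp add: algebra_simps)
  thus ?thesis by (rule that)
qed

text \<open>Even multiples of \<tau> meet the first column and odd ones the second. This is how
  conditions on two columns over one torus become a divisor on the doubled torus, with a pole at D
  and a zero at D + \<tau>.\<close>

lemma glue_bigo_lat:
  assumes x: "x \<in> strip 0"
  shows "(\<lambda>p. ent (M p) i 1) \<in> O[at x](v) \<Longrightarrow> s - x \<in> lat \<Longrightarrow> glue M i \<in> O[at s](\<lambda>p. v (p - s + x))"
    "(\<lambda>p. ent (M p) i 2) \<in> O[at x](v) \<Longrightarrow> s - x - \<tau> \<in> lat \<Longrightarrow> glue M i \<in> O[at s](\<lambda>p. v (p - s + x))"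
proof -
  assume *: "(\<lambda>p. ent (M p) i 1) \<in> O[at x](v)" "s - x \<in> lat"
  obtain a l where "s = x + of_int a + of_int (2 * l) * \<tau>" using *(2) by (rule lat_cases)
  thus "glue M i \<in> O[at s](\<lambda>p. v (p - s + x))"
    using *(1) by (intro glue_bigo[OF x, of i "2 * l"]) simp_all
next
  assume *: "(\<lambda>p. ent (M p) i 2) \<in> O[at x](v)" "s - x - \<tau> \<in> lat"
  hence "s - (x + \<tau>) \<in> lat" by (simp add: algebra_simps)
  then obtain a l where "s = x + \<tau> + of_int a + of_int (2 * l) * \<tau>" by (rule lat_cases)
  hence "s = x + of_int a + of_int (2 * l + 1) * \<tau>" by (simp add: algebra_simps)
  thus "glue M i \<in> O[at s](\<lambda>p. v (p - s + x))"
    using *(1) by (intro glue_bigo[OF x, of i "2 * l + 1"]) simp_all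
qed

lemma M_bigo:
  "(\<lambda>p. ent (M p) 1 1 - 1 / p) \<in> O[at 0](\<lambda>_. 1)" "(\<lambda>p. ent (M p) 1 2) \<in> O[at 0](\<lambda>_. 1)"
  "(\<lambda>p. ent (M p) 2 1) \<in> O[at 0](\<lambda>_. 1)" "(\<lambda>p. ent (M p) 2 2 - 1 / p) \<in> O[at 0](\<lambda>_. 1)"
  "(\<lambda>p. ent (M p) i 1) \<in> O[at (complex_of_real D)](\<lambda>p. 1 / (p - complex_of_real D))"
  "(\<lambda>p. ent (M p) i 2) \<in> O[at (complex_of_real D)](\<lambda>p. p - complex_of_real D)"
  using M by (simp_all add: model_RHP_solution_def)

lemma bigo_pole_part:
  fixes g :: "complex \<Rightarrow> complex"
  assumes "(\<lambda>p. g p - 1 / p) \<in> O[at 0](\<lambda>_. 1)"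
  shows "g \<in> O[at 0](\<lambda>p. 1 / p)"
proof -
  have "(\<lambda>_. 1) \<in> O[at (0::complex)](\<lambda>p::complex. 1 / p)"
    by (rule bigoI_tendsto[where c = 0]) (auto simp: eventually_at_filter intro!: tendsto_eq_intros)
  hence "(\<lambda>p. g p - 1 / p) \<in> O[at 0](\<lambda>p. 1 / p)"
    using assms landau_o.big.trans by blast
  hence "(\<lambda>p. (g p - 1 / p) + 1 / p) \<in> O[at 0](\<lambda>p. 1 / p)"
    by (rule sum_in_bigo) simp
  thus ?thesis by simp
qed

lemma glue_bigo_D:
  "s - of_real D \<in> lat \<Longrightarrow> glue M i \<in> O[at s](\<lambda>p. 1 / (p - s))"
  "s - of_real D - \<tau> \<in> lat \<Longrightarrow> glue M i \<in> O[at s](\<lambda>p. p - s)"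
  using glue_bigo_lat(1)[OF D_in_strip M_bigo(5), of s i] glue_bigo_lat(2)[OF D_in_strip M_bigo(6), of s i]
  by simp_all

lemma glue_row_1: "\<exists>c. \<forall>p. p \<notin> RHP_poles \<tau> D \<longrightarrow> glue M 1 p = c * f.G p"
proof (rule f.unique_off_RHP_poles[OF glue_hol _ glue_bigo_D _ glue_per])
  show "glue M 1 \<in> O[at s](\<lambda>p. 1 / (p - s))" if "s - 0 \<in> lat" for s
    using glue_bigo_lat(1)[OF zero_in_strip bigo_pole_part[OF M_bigo(1)] that] by simp
  show "glue M 1 \<in> O[at s](\<lambda>_. 1)" if "s - 0 - \<tau> \<in> lat" for s
    using glue_bigo_lat(2)[OF zero_in_strip M_bigo(2) that] by simp
qed

text \<open>The pole of the second row at 0 sits in the second column, hence at \<tau> on the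
  doubled torus. The bounded entry sits at \<tau> + \<tau>, which is 0 modulo
  \<open>lat\<close>.\<close>

lemma glue_row_2: "\<exists>c. \<forall>p. p \<notin> RHP_poles \<tau> D \<longrightarrow> glue M 2 p = c * h.G p"
proof (rule h.unique_off_RHP_poles[OF glue_hol _ glue_bigo_D _ glue_per])
  show "glue M 2 \<in> O[at s](\<lambda>p. 1 / (p - s))" if "s - \<tau> \<in> lat" for s
    using glue_bigo_lat(2)[OF zero_in_strip bigo_pole_part[OF M_bigo(4)], of s] that by simp
  show "glue M 2 \<in> O[at s](\<lambda>_. 1)" if "s - \<tau> - \<tau> \<in> lat" for s
    using glue_bigo_lat(1)[OF zero_in_strip M_bigo(3), of s] that f.lat_shift_iff(2)[of s] by simp
qed

lemma M_eq_glue: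
  assumes "p \<in> strip 0" "p \<notin> RHP_poles \<tau> D"
  shows "ent (M p) i 1 = glue M i p" "ent (M p) i 2 = glue M i (p + \<tau>)"
proof -
  show "ent (M p) i 1 = glue M i p" using glue_strip[OF assms(1), of M i] by simp
  have "p + \<tau> \<in> strip (0 + 1)" using assms(1) by (simp only: strip_plus_tau)
  from glue_strip[OF this, of M i] show "ent (M p) i 2 = glue M i (p + \<tau>)"
    using M_per(2)[OF assms] by simp
qed

lemma M_strip_0:
  assumes p: "p \<in> strip 0" "p \<notin> RHP_poles \<tau> D"
  shows "ent (M p) i j = row i (p + off j)"
proof -
  obtain c1 c2 where c1: "\<And>p. p \<notin> RHP_poles \<tau> D \<Longrightarrow> glue M 1 p = c1 * f.G p"
      and c2: "\<And>p. p \<notin> RHP_poles \<tau> D \<Longrightarrow> glue M 2 p = c2 * h.G p"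
    using glue_row_1 glue_row_2 by auto
  have 1: "ent (M p) 1 1 = c1 * f.G p" "ent (M p) 1 2 = c1 * f.G (p + \<tau>)"
     "ent (M p) 2 1 = c2 * h.G p" "ent (M p) 2 2 = c2 * h.G (p + \<tau>)"
    if "p \<in> strip 0" "p \<notin> RHP_poles \<tau> D" for p
    using M_eq_glue[OF that] c1 c2 that(2) by (simp_all add: RHP_poles_shift)
  have ev: "\<forall>\<^sub>F p in at 0. p \<in> strip 0 \<and> p \<notin> RHP_poles \<tau> D"
    using eventually_in_strip[OF zero_in_strip] eventually_not_pole by (rule eventually_conj)
  have "\<forall>\<^sub>F p in at 0. ent (M p) 1 1 - 1 / p = c1 * f.G p - 1 / p"
    using ev by eventually_elim (simp add: 1)
  from landau_o.big.in_cong[OF this] M_bigo(1)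
  have "(\<lambda>p. c1 * f.G p - 1 / p) \<in> O[at 0](\<lambda>_. 1)" by simp
  hence "c1 = C1" using f_residue by (rule residue_normalization_unique)
  \<comment> \<open>The constant of the second row is read off from its second entry, the translate
    of h whose pole lies at 0.\<close>
  have "\<forall>\<^sub>F p in at 0. ent (M p) 2 2 - 1 / p = c2 * h.G (p + \<tau>) - 1 / p"
    using ev by eventually_elim (simp add: 1)
  from landau_o.big.in_cong[OF this] M_bigo(4)
  have "(\<lambda>p. c2 * h.G (p + \<tau>) - 1 / p) \<in> O[at 0](\<lambda>_. 1)" by simp
  hence "c2 = C2" using h_residue by (rule residue_normalization_unique[where g = "\<lambda>p. h.G (p + \<tau>)"])
  show ?thesis
    using 1[OF p] \<open>c1 = C1\<close> \<open>c2 = C2\<close> exhaust_2[of i] exhaust_2[of j] by (auto simp: row_def off_def)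
qed

lemma M_eq_model_M:
  assumes "p \<in> RHP_domain \<tau> - RHP_poles \<tau> D"
  shows "M p = model_M n \<tau> D p"
proof -
  obtain k where k: "p \<in> strip k" and np: "p \<notin> RHP_poles \<tau> D"
    using assms by (auto simp: RHP_domain_eq)
  define q where "q = p + of_int (- k) * \<tau>"
  have q: "q \<in> strip 0" "q \<notin> RHP_poles \<tau> D"
    using strip_plus_int_tau[of p "- k" k] k np RHP_poles_shift(3)[of p "- k"] by (auto simp: q_def)
  have "M q = M p" unfolding q_def by (rule M_per_int_tau[OF k np])
  hence "ent (M p) i j = row i (p - of_int k * \<tau> + off j)" for i j
    using M_strip_0[OF q, of i j] by (simp add: q_def)
  thus ?thesis by (simp add: mat_eq_iff_ent model_M_strip[OF k])
qed

end

theorem theorem3p9: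
  fixes n :: nat and \<tau> :: complex and D :: real
  assumes "n \<ge> 1" and "Re \<tau> = 0" and "Im \<tau> > 0" and "0 < D" and "D < 1"
  shows "model_RHP_solution n \<tau> D (model_M n \<tau> D)
    \<and> (\<forall>M. model_RHP_solution n \<tau> D M \<longrightarrow>
          (\<forall>p \<in> RHP_domain \<tau> - RHP_poles \<tau> D. M p = model_M n \<tau> D p))
    \<and> model_f n \<tau> D meromorphic_on UNIV
    \<and> model_h n \<tau> D meromorphic_on UNIV
    \<and> theta_conditions n \<tau> D 0 (model_f n \<tau> D)
    \<and> theta_conditions n \<tau> D \<tau> (model_h n \<tau> D)
    \<and> (\<forall>g. theta_conditions n \<tau> D 0 g \<longrightarrow>
          (\<exists>c. \<forall>p. p \<notin> poles2 \<tau> D 0 \<longrightarrow> g p = c * model_f n \<tau> D p))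
    \<and> (\<forall>g. theta_conditions n \<tau> D \<tau> g \<longrightarrow>
          (\<exists>c. \<forall>p. p \<notin> poles2 \<tau> D \<tau> \<longrightarrow> g p = c * model_h n \<tau> D p))"
proof -
  interpret model_problem_n \<tau> D n
    by standard (use assms in auto)
  have "M p = model_M n \<tau> D p"
    if "model_RHP_solution n \<tau> D M" "p \<in> RHP_domain \<tau> - RHP_poles \<tau> D" for M p
  proof -
    interpret model_solution \<tau> D n M by standard (rule that)
    show ?thesis by (rule M_eq_model_M) (rule that)
  qed
  thus ?thesis
    using model_M_solution f.G_meromorphic h.G_meromorphic
      f.G_theta_conditions[OF refl] h.G_theta_conditions[OF refl]
      f.theta_conditions_unique[OF _ refl] h.theta_conditions_unique[OF _ refl]
    unfolding model_f_eq model_h_eq by blast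
qed

end
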